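(* If $F$ is a flat geodesic in $G$, then $G$ is foliated by the geodesics in $G$ that are orthogonal to $F$; that is, every point of $G$ lies on exactly one geodesic that is orthogonal to $F$.
   Context: $\mathbb{D}$ is the open unit disc in $\mathbb{C}$. $G=\{(z+w,zw): |z|<1,|w|<1\}\subset\mathbb{C}^2$ is the symmetrized bidisc. A geodesic (that is, complex geodesic) in $G$ is a set $D=h(\mathbb{D})$ where $h:\mathbb{D}\to G$ is holomorphic and has a holomorphic left inverse $\Phi:G\to\mathbb{D}$, $\Phi\circ h=\mathrm{id}_{\mathbb{D}}$. If $\lambda=h(z)\in D$, the complex tangent space is $T_\lambda D=\mathbb{C}\,h'(z)\subset\mathbb{C}^2$. The royal variety is $\mathcal{R}=\{(2z,z^2):z\in\mathbb{D}\}$. A geodesic $D$ is flat if $D^-\cap\mathcal{R}^-$ (closures in $\mathbb{C}^2$) consists of a single point, and that point lies in $\mathcal{R}$; equivalently (known), $D=F^\beta=\{(\beta+\bar\beta z,z):z\in\mathbb{D}\}$ for some $\beta\in\mathbb{D}$. Sharp direction: let $\mathrm{Orb}(\lambda)$ be the orbit of $\lambda\in G$ under the group $\mathrm{Aut}\,G$ of biholomorphic self-maps of $G$. It is known that $\mathrm{Orb}(\lambda)=\mathcal{R}$ if $\lambda\in\mathcal{R}$, and $\mathrm{Orb}(\lambda)$ is a smooth properly embedded real 3-dimensional submanifold of $G$ if $\lambda\notin\mathcal{R}$. In both cases the real tangent space to $\mathrm{Orb}(\lambda)$ at $\lambda$ contains a unique one-dimensional complex subspace of $\mathbb{C}^2$,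 denoted $\sharp_\lambda$. A geodesic $D$ is orthogonal to a flat geodesic $F$ if $D$ meets $F$ at a point $\lambda$ and $T_\lambda D=\sharp_\lambda$. *)

theory Defs
  imports "HOL-Complex_Analysis.Complex_Analysis"
begin

abbreviation unit_disc :: "complex set" where
  "unit_disc \<equiv> ball 0 1"

definition sym_bidisc :: "(complex \<times> complex) set" where
  "sym_bidisc = {(z + w, z * w) | z w. z \<in> unit_disc \<and> w \<in> unit_disc}"

definition royal_variety :: "(complex \<times> complex) set" where
  "royal_variety = {(2 * z, z\<^sup>2) | z. z \<in> unit_disc}"

text \<open>The type \<open>complex \<times> complex\<close> only carries a real vector space structure in the
  library; this is the scalar multiplication of $\mathbb{C}^2$ over $\mathbb{C}$.\<close>

definition cscale :: "complex \<Rightarrow> complex \<times> complex \<Rightarrow> complex \<times> complex" where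
  "cscale c v = (c * fst v, c * snd v)"

definition complex_line :: "(complex \<times> complex) set \<Rightarrow> bool" where
  "complex_line L \<longleftrightarrow> (\<exists>v. v \<noteq> 0 \<and> L = range (\<lambda>c. cscale c v))"

text \<open>Holomorphy in two variables, on an open set: Frechet differentiability with
  $\mathbb{C}$-linear derivative (a \<open>has_derivative\<close> derivative is real linear, so
  homogeneity over $\mathbb{C}$ is all that has to be added).\<close>

definition holomorphic2_on :: "(complex \<times> complex \<Rightarrow> complex) \<Rightarrow> (complex \<times> complex) set \<Rightarrow> bool"
  (infixl "holomorphic2'_on" 50) where
  "f holomorphic2_on S \<longleftrightarrow>
     (\<forall>p\<in>S. \<exists>f'. (f has_derivative f') (at p) \<and> (\<forall>c v. f' (cscale c v) = c * f' v))"

definition holomorphic2_map_on ::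
  "(complex \<times> complex \<Rightarrow> complex \<times> complex) \<Rightarrow> (complex \<times> complex) set \<Rightarrow> bool" where
  "holomorphic2_map_on f S \<longleftrightarrow>
     (\<lambda>p. fst (f p)) holomorphic2_on S \<and> (\<lambda>p. snd (f p)) holomorphic2_on S"

definition holomorphic_curve_on :: "(complex \<Rightarrow> complex \<times> complex) \<Rightarrow> complex set \<Rightarrow> bool" where
  "holomorphic_curve_on h S \<longleftrightarrow>
     (\<lambda>z. fst (h z)) holomorphic_on S \<and> (\<lambda>z. snd (h z)) holomorphic_on S"

definition curve_deriv :: "(complex \<Rightarrow> complex \<times> complex) \<Rightarrow> complex \<Rightarrow> complex \<times> complex" where
  "curve_deriv h z = (deriv (\<lambda>z. fst (h z)) z, deriv (\<lambda>z. snd (h z)) z)"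

definition geodesic_param :: "(complex \<Rightarrow> complex \<times> complex) \<Rightarrow> bool" where
  "geodesic_param h \<longleftrightarrow>
     holomorphic_curve_on h unit_disc \<and> h ` unit_disc \<subseteq> sym_bidisc \<and>
     (\<exists>\<Phi>. \<Phi> holomorphic2_on sym_bidisc \<and> \<Phi> ` sym_bidisc \<subseteq> unit_disc \<and>
          (\<forall>z\<in>unit_disc. \<Phi> (h z) = z))"

definition geodesic :: "(complex \<times> complex) set \<Rightarrow> bool" where
  "geodesic D \<longleftrightarrow> (\<exists>h. geodesic_param h \<and> D = h ` unit_disc)"

text \<open>The line spanned by $h'(z)$, where $h(z)$ is the given point, does not depend on the
  parametrization $h$ of the geodesic, so the union over all parametrizations below is that
  single line.\<close>

definition geodesic_tangent ::
  "(complex \<times> complex) set \<Rightarrow> complex \<times> complex \<Rightarrow> (complex \<times> complex) set" where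
  "geodesic_tangent D p =
     {cscale c (curve_deriv h z) | c h z.
        geodesic_param h \<and> D = h ` unit_disc \<and> z \<in> unit_disc \<and> h z = p}"

definition flat_geodesic :: "(complex \<times> complex) set \<Rightarrow> bool" where
  "flat_geodesic D \<longleftrightarrow>
     geodesic D \<and> (\<exists>p\<in>royal_variety. closure D \<inter> closure royal_variety = {p})"

definition Aut_sym_bidisc :: "(complex \<times> complex \<Rightarrow> complex \<times> complex) set" where
  "Aut_sym_bidisc =
     {f. bij_betw f sym_bidisc sym_bidisc \<and> holomorphic2_map_on f sym_bidisc \<and>
         holomorphic2_map_on (inv_into sym_bidisc f) sym_bidisc}"

definition Orb :: "complex \<times> complex \<Rightarrow> (complex \<times> complex) set" where
  "Orb p = {f p | f. f \<in> Aut_sym_bidisc}"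

text \<open>For a smooth embedded submanifold, the velocities at the point of $C^1$ curves lying in
  the submanifold form its real tangent space.\<close>

definition real_tangent_space ::
  "(complex \<times> complex) set \<Rightarrow> complex \<times> complex \<Rightarrow> (complex \<times> complex) set" where
  "real_tangent_space M p =
     {v. \<exists>\<gamma> \<epsilon>. \<epsilon> > 0 \<and> \<gamma> C1_differentiable_on {-\<epsilon><..<\<epsilon>} \<and> \<gamma> ` {-\<epsilon><..<\<epsilon>} \<subseteq> M \<and>
           \<gamma> 0 = p \<and> (\<gamma> has_vector_derivative v) (at (0::real))}"

definition sharp :: "complex \<times> complex \<Rightarrow> (complex \<times> complex) set" where
  "sharp p = (THE L. complex_line L \<and> L \<subseteq> real_tangent_space (Orb p) p)"

definition orthogonal_to ::
  "(complex \<times> complex) set \<Rightarrow> (complex \<times> complex) set \<Rightarrow> bool" where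
  "orthogonal_to D F \<longleftrightarrow> (\<exists>p\<in>D \<inter> F. geodesic_tangent D p = sharp p)"

end

theory Submission imports Defs begin

text \<open>A point \<open>(s, p)\<close> of the symmetrized bidisc \<open>G\<close> is an unordered pair of roots \<open>z, w\<close> in the disc, with
\<open>s = z + w\<close> and \<open>p = z w\<close>. Every disc automorphism \<open>moeb a\<close>, acting on both roots, induces an automorphism
\<open>sym_moeb a\<close> of \<open>G\<close>.

\<^bold>\<open>Reduction.\<close> A flat geodesic is carried by some \<open>sym_moeb a\<close> onto the central one,
\<open>{(0, q). norm q < 1}\<close> (\<open>flat_geodesic_normal_form\<close>), and these automorphisms transport geodesics, their tangents,
and the sharp direction (\<open>orthogonal_sym_moeb\<close>). So it suffices to treat the central flat geodesic.

\<^bold>\<open>The orthogonal geodesics.\<close> The sharp direction at \<open>(0, q)\<close> is the line spanned by \<open>(1, 0)\<close> (\<open>sharp_axis\<close>). There is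
exactly one geodesic through \<open>(0, q)\<close> with this tangent: two of the maps
\<open>Phi \<omega> (s, p) = (2 \<omega> p - s) / (2 - \<omega> s)\<close> from \<open>G\<close> to the disc are extremal for this direction, the equality case of the
Schwarz-Pick lemma determines both of them along the geodesic, and together they determine \<open>s\<close> and \<open>p\<close>
(\<open>horizontal_geodesic_unique\<close>). The geodesic is explicit: with \<open>c^2 = - q\<close> it consists of the points whose roots are
\<open>moeb (- c) u\<close> and \<open>moeb c u\<close>. That a point with roots \<open>z, w\<close> lies on this leaf means
\<open>z - w = b - cnj b * z * w\<close> with \<open>b = 2 c / (1 + norm c ^ 2)\<close>. Given \<open>z\<close> and \<open>w\<close>, this equation has exactly one solution
\<open>b\<close>, which lies in the disc because \<open>(z - w, - z w)\<close> is again a point of \<open>G\<close>; exchanging the roots replaces \<open>c\<close> by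
\<open>- c\<close>, so that \<open>q\<close> is well defined. This is the foliation (\<open>leaf_covers\<close>, \<open>leaf_disjoint\<close>).

\<^bold>\<open>The sharp direction.\<close> Its computation needs an upper bound for the orbits of the full automorphism group. An
automorphism acts isometrically on infinitesimal Caratheodory metrics. At the origin the metric is
\<open>norm a / 2 + norm b\<close>, a weighted \<open>l1\<close>-norm; at \<open>(0, q)\<close> with \<open>q \<noteq> 0\<close> the two coordinate directions would have to be the axes of
an \<open>l1\<close>-norm, but discs that lift to the bidisc show that the metric is too small in between. Hence the royal variety is
invariant (\<open>Aut_origin_to_axis\<close>, \<open>Aut_royal\<close>). An automorphism fixing the origin then rotates the central flat geodesic,
so that every automorphism preserves the hyperbolic distance between the two roots (\<open>root_distance_Aut\<close>), and the orbit
of \<open>(0, q)\<close> is confined to a level set of this distance.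

\<^bold>\<open>Flat geodesics.\<close> Suppose a geodesic \<open>h\<close> with \<open>h 0 = (0, 0)\<close> meets the royal variety only there, and transversally. Then
\<open>s^2 - 4 p\<close> has a simple zero at \<open>0\<close> and no other, so that over \<open>z = x^2\<close> the roots are holomorphic functions \<open>f x\<close> and
\<open>f (- x)\<close>. Extremality of \<open>h\<close> is equality in the Schwarz-Pick lemma for \<open>f x / x\<close>, which is therefore a disc automorphism.
Unless the direction is that of the central flat geodesic, both roots now tend to the same unimodular number along a
radius, and the closure of \<open>h\<close> meets the closure of the royal variety a second time
(\<open>unbalanced_geodesic_royal_boundary\<close>).\<close>

abbreviation (input) G :: "(complex \<times> complex) set" where
  "G \<equiv> sym_bidisc"

abbreviation moeb :: "complex \<Rightarrow> complex \<Rightarrow> complex" where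
  "moeb a \<equiv> Moebius_function 0 a"

lemmas moeb_def = Moebius_function_simple

section \<open>The symmetrized bidisc\<close>

lemma moeb_denominator_nz:
  fixes a z :: complex
  assumes "norm a < 1" "norm z \<le> 1"
  shows "1 - cnj a * z \<noteq> 0"
proof
  assume "1 - cnj a * z = 0"
  then have "cnj a * z = 1" by simp
  then have "norm (cnj a * z) = 1" by simp
  moreover have "norm (cnj a * z) \<le> norm a"
    unfolding norm_mult complex_mod_cnj using assms by (intro mult_left_le) auto
  ultimately show False using assms by simp
qed

lemma of_real_norm_squared: "(complex_of_real (norm z))^2 = z * cnj z"
  using complex_norm_square[of z] by simp

lemma of_real_one_minus_norm_squared:
  "complex_of_real (1 - (norm z)^2) = 1 - z * cnj z"
  by (simp only: of_real_diff of_real_1 complex_norm_square)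

lemma norm_mult_of_real_nonneg: "0 \<le> r \<Longrightarrow> norm (z * complex_of_real r) = norm z * r"
  by (simp only: norm_mult norm_of_real abs_of_nonneg)

lemma mem_sym_bidisc:
  "x \<in> G \<longleftrightarrow> (\<exists>z w. norm z < 1 \<and> norm w < 1 \<and> x = (z + w, z * w))"
  by (auto simp: sym_bidisc_def)

lemma exists_roots:
  fixes s p :: complex
  obtains z w where "s = z + w" "p = z * w"
proof
  let ?r = "csqrt (s^2 - 4 * p)"
  have "?r^2 = s^2 - 4 * p" by simp
  then show "s = (s + ?r) / 2 + (s - ?r) / 2" "p = (s + ?r) / 2 * ((s - ?r) / 2)"
    by (simp_all add: field_simps power2_eq_square)
qed

text \<open>In terms of roots, \<open>s - cnj s * p = z (1 - |w|^2) + w (1 - |z|^2)\<close>. The triangle inequality for this sum, with the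
sign of \<open>(1 - |z|) (1 - |w|)\<close>, gives both directions.\<close>

lemma sym_bidisc_iff:
  "x \<in> G \<longleftrightarrow> norm (fst x - cnj (fst x) * snd x) < 1 - (norm (snd x))^2"
proof -
  obtain z w where zw: "fst x = z + w" "snd x = z * w"
    by (rule exists_roots)
  show ?thesis
  proof
    assume "x \<in> G"
    then obtain z w where zw: "norm z < 1" "norm w < 1" "x = (z + w, z * w)"
      unfolding mem_sym_bidisc by blast
    have eq: "fst x - cnj (fst x) * snd x =
      z * of_real (1 - (norm w)^2) + w * of_real (1 - (norm z)^2)"
      unfolding of_real_one_minus_norm_squared by (simp add: zw algebra_simps)
    have sq: "(norm w)^2 < 1" "(norm z)^2 < 1"
      using zw by (simp_all add: power_less_one_iff)
    have "norm (fst x - cnj (fst x) * snd x) \<le>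
        norm (z * of_real (1 - (norm w)^2)) + norm (w * of_real (1 - (norm z)^2))"
      unfolding eq by (rule norm_triangle_ineq)
    also have "norm (z * of_real (1 - (norm w)^2)) = norm z * (1 - (norm w)^2)"
      using sq by (intro norm_mult_of_real_nonneg) simp
    also have "norm (w * of_real (1 - (norm z)^2)) = norm w * (1 - (norm z)^2)"
      using sq by (intro norm_mult_of_real_nonneg) simp
    also have "norm z * (1 - (norm w)^2) + norm w * (1 - (norm z)^2) = (norm z + norm w) * (1 - norm z * norm w)"
      by (simp add: algebra_simps power2_eq_square)
    also have "\<dots> < (1 + norm z * norm w) * (1 - norm z * norm w)"
    proof (rule mult_strict_right_mono)
      have "0 < (1 - norm z) * (1 - norm w)" using zw by simp
      then show "norm z + norm w < 1 + norm z * norm w" by (simp add: algebra_simps)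
      show "0 < 1 - norm z * norm w"
        using zw mult_strict_mono'[of "norm z" 1 "norm w" 1] by simp
    qed
    also have "\<dots> = 1 - (norm (snd x))^2"
      by (simp add: zw norm_mult algebra_simps power2_eq_square)
    finally show "norm (fst x - cnj (fst x) * snd x) < 1 - (norm (snd x))^2" .
  next
    assume a: "norm (fst x - cnj (fst x) * snd x) < 1 - (norm (snd x))^2"
    then have p1: "norm (snd x) < 1"
      by (smt (verit) norm_ge_zero one_le_power)
    have *: "norm u < 1" if uv: "fst x = u + v" "snd x = u * v" for u v
    proof (rule ccontr)
      assume n: "\<not> norm u < 1"
      have "1 * norm v \<le> norm u * norm v" using n by (intro mult_right_mono) auto
      then have "norm v < 1" using p1 by (simp add: uv norm_mult)
      then have v: "(norm v)^2 < 1" by (simp add: power_less_one_iff)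
      have u: "1 \<le> (norm u)^2" using n by (simp add: one_le_power)
      have eq: "fst x - cnj (fst x) * snd x =
        u * of_real (1 - (norm v)^2) - v * of_real ((norm u)^2 - 1)"
        by (simp only: uv of_real_diff of_real_1 complex_norm_square complex_cnj_add complex_cnj_mult)
           (simp add: algebra_simps)
      have n1: "norm (u * of_real (1 - (norm v)^2)) = norm u * (1 - (norm v)^2)"
        using v by (intro norm_mult_of_real_nonneg) simp
      have n2: "norm (v * of_real ((norm u)^2 - 1)) = norm v * ((norm u)^2 - 1)"
        using u by (intro norm_mult_of_real_nonneg) simp
      have "norm (fst x - cnj (fst x) * snd x) \<ge>
         norm u * (1 - (norm v)^2) - norm v * ((norm u)^2 - 1)"
        unfolding eq n1[symmetric] n2[symmetric] by (rule norm_triangle_ineq2)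
      also have "norm u * (1 - (norm v)^2) - norm v * ((norm u)^2 - 1) =
         (norm u + norm v) * (1 - norm u * norm v)"
        by (simp add: algebra_simps power2_eq_square)
      finally have le: "(norm u + norm v) * (1 - norm u * norm v) \<le> norm (fst x - cnj (fst x) * snd x)" .
      have "(1 + norm u * norm v) * (1 - norm u * norm v) \<le> (norm u + norm v) * (1 - norm u * norm v)"
      proof (rule mult_right_mono)
        have "(norm u - 1) * (1 - norm v) \<ge> 0" using n \<open>norm v < 1\<close> by simp
        then show "1 + norm u * norm v \<le> norm u + norm v" by (simp add: algebra_simps)
        show "0 \<le> 1 - norm u * norm v" using p1 by (simp add: uv norm_mult)
      qed
      also have "(1 + norm u * norm v) * (1 - norm u * norm v) = 1 - (norm (snd x))^2"
        by (simp add: uv norm_mult algebra_simps power2_eq_square)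
      finally show False using a le by linarith
    qed
    have "norm z < 1" using * zw by blast
    moreover have "norm w < 1" using *[of w z] zw by (simp add: algebra_simps)
    ultimately show "x \<in> G" using zw
      by (metis mem_sym_bidisc prod.collapse)
  qed
qed

lemma open_sym_bidisc: "open G"
proof -
  have "G = {x. norm (fst x - cnj (fst x) * snd x) < 1 - (norm (snd x))^2}"
    using sym_bidisc_iff by blast
  also have "open \<dots>"
    by (intro open_Collect_less continuous_intros)
  finally show ?thesis .
qed

lemma sym_bidisc_root_lt_1:
  assumes "(z + w, z * w) \<in> G"
  shows "norm z < 1"
proof -
  obtain u v where uv: "norm u < 1" "norm v < 1" "u + v = z + w" "u * v = z * w"
    using assms unfolding mem_sym_bidisc by force
  have "(z - u) * (z - v) = z * z - z * (u + v) + u * v" by (simp add: algebra_simps)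
  also have "\<dots> = 0" by (simp add: uv algebra_simps)
  finally have "z = u \<or> z = v" by simp
  then show ?thesis using uv by auto
qed

lemma sym_bidisc_snd_lt_1: "x \<in> G \<Longrightarrow> norm (snd x) < 1"
  by (auto simp: mem_sym_bidisc norm_mult)
     (metis mult_strict_mono' norm_ge_zero mult_1)

lemma sym_bidisc_fst_lt_2: "x \<in> G \<Longrightarrow> norm (fst x) < 2"
  by (auto simp: mem_sym_bidisc) (smt (verit) norm_triangle_ineq)

lemma conj_affine_inj:
  fixes b c p :: complex
  assumes "b + cnj b * p = c + cnj c * p" "norm p < 1"
  shows "b = c"
proof (rule ccontr)
  assume "b \<noteq> c"
  have "b - c = - (cnj (b - c) * p)" using assms(1) by (simp add: algebra_simps)
  then have "norm (b - c) = norm (b - c) * norm p"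
    by (metis norm_minus_cancel norm_mult complex_mod_cnj)
  then show False using assms(2) \<open>b \<noteq> c\<close> by simp
qed

text \<open>The parameter \<open>b\<close> labels the flat geodesic \<open>{(b + cnj b * p, p). norm p < 1}\<close> through the point.\<close>

lemma sym_bidisc_flat_coordinate:
  assumes "(s, p) \<in> G"
  obtains b where "norm b < 1" "s = b + cnj b * p"
proof
  let ?b = "(s - cnj s * p) / of_real (1 - (norm p)^2)"
  have p: "norm p < 1" using sym_bidisc_snd_lt_1[OF assms] by simp
  have pos: "1 - (norm p)^2 > 0" using p by (simp add: power_less_one_iff)
  show "norm ?b < 1"
    using assms pos by (simp add: sym_bidisc_iff norm_divide divide_less_eq del: of_real_diff of_real_power)
  let ?d = "complex_of_real (1 - (norm p)^2)"
  have nz: "?d \<noteq> 0" using pos by (metis less_irrefl of_real_eq_0_iff)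
  have d: "?d = 1 - p * cnj p" by (rule of_real_one_minus_norm_squared)
  have "?b + cnj ?b * p = ((s - cnj s * p) + (cnj s - s * cnj p) * p) / ?d"
    by (simp add: add_divide_distrib del: of_real_diff of_real_power)
  also have "(s - cnj s * p) + (cnj s - s * cnj p) * p = s * ?d"
    unfolding d by (simp add: algebra_simps)
  finally show "s = ?b + cnj ?b * p" using nz by simp
qed

lemma conj_affine_in_sym_bidisc:
  assumes "norm b < 1" "norm p < 1"
  shows "(b + cnj b * p, p) \<in> G"
proof -
  have pos: "1 - (norm p)^2 > 0" using assms by (simp add: power_less_one_iff)
  have "b + cnj b * p - cnj (b + cnj b * p) * p = b * of_real (1 - (norm p)^2)"
    unfolding of_real_one_minus_norm_squared by (simp add: algebra_simps)
  moreover have "norm (b * of_real (1 - (norm p)^2)) = norm b * (1 - (norm p)^2)"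
    using pos by (intro norm_mult_of_real_nonneg) simp
  moreover have "norm b * (1 - (norm p)^2) < 1 * (1 - (norm p)^2)"
    using assms pos by (intro mult_strict_right_mono)
  ultimately show ?thesis by (simp add: sym_bidisc_iff)
qed

lemma zero_p_in_sym_bidisc [simp]: "(0, p) \<in> G \<longleftrightarrow> norm p < 1"
  using conj_affine_in_sym_bidisc[of 0 p] sym_bidisc_snd_lt_1 by force

text \<open>The point \<open>a\<close> is the hyperbolic midpoint of \<open>0\<close> and \<open>b\<close>, namely \<open>b / (1 + sqrt (1 - |b|^2))\<close>.\<close>

lemma hyperbolic_midpoint_exists:
  assumes "norm b < 1"
  obtains a where "norm a < 1" "b * (1 + a * cnj a) = 2 * a"
proof
  define w where "w = sqrt (1 - (norm b)^2)"
  have w: "w > 0" "w^2 = 1 - (norm b)^2"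
    using assms by (auto simp: w_def power_less_one_iff intro: order_less_imp_le)
  let ?a = "b / of_real (1 + w)"
  have nz: "(1 + complex_of_real w) \<noteq> 0"
    using w by (metis add_pos_pos less_irrefl of_real_1 of_real_add of_real_eq_0_iff zero_less_one)
  have na: "norm ?a = norm b / (1 + w)" using w
    by (simp add: norm_divide del: of_real_add)
  also have "\<dots> < 1" using w assms by (simp add: divide_less_eq)
  finally show "norm ?a < 1" .
  have "(norm ?a)^2 = (norm b)^2 / (1 + w)^2" by (simp only: na power_divide)
  also have "\<dots> = (1 - w) / (1 + w)"
  proof -
    have "(norm b)^2 = (1 - w) * (1 + w)" using w by (simp add: algebra_simps power2_eq_square)
    then show ?thesis using w by (simp add: power2_eq_square)
  qed
  finally have "1 + (norm ?a)^2 = 2 / (1 + w)" using w by (simp add: field_simps)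
  then have "1 + ?a * cnj ?a = of_real (2 / (1 + w))"
    by (metis complex_norm_square of_real_1 of_real_add)
  then show "b * (1 + ?a * cnj ?a) = 2 * ?a" by simp
qed

lemma hyperbolic_midpoint_unique:
  fixes a c :: complex
  assumes "a * (1 + c * cnj c) = c * (1 + a * cnj a)" "norm a < 1" "norm c < 1"
  shows "a = c"
proof -
  have "a - c = a * c * cnj (a - c)" using assms(1) by (simp add: algebra_simps)
  then have "norm (a - c) = norm (a * c) * norm (a - c)"
    by (metis norm_mult complex_mod_cnj)
  moreover have "norm (a * c) < 1"
    using assms by (simp add: norm_mult) (metis mult_strict_mono' norm_ge_zero mult_1)
  ultimately show ?thesis by simp
qed

section \<open>Holomorphic maps and discs\<close>

lemma cscale_simps [simp]:
  "fst (cscale c v) = c * fst v" "snd (cscale c v) = c * snd v"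
  "cscale 1 v = v" "cscale a (cscale b v) = cscale (a * b) v"
  "cscale c (x, y) = (c * x, c * y)" "cscale c 0 = 0"
  by (auto simp: cscale_def zero_prod_def)

lemma holomorphic2_onD:
  assumes "f holomorphic2_on S" "p \<in> S"
  obtains f' where "(f has_derivative f') (at p)" "\<And>c v. f' (cscale c v) = c * f' v"
  using assms by (auto simp: holomorphic2_on_def)

lemma holomorphic2_map_onD:
  assumes "holomorphic2_map_on f S" "p \<in> S"
  obtains T where "(f has_derivative T) (at p)" "\<And>c v. T (cscale c v) = cscale c (T v)"
proof -
  obtain A where A: "((\<lambda>p. fst (f p)) has_derivative A) (at p)" "\<And>c v. A (cscale c v) = c * A v"
    using assms unfolding holomorphic2_map_on_def by (meson holomorphic2_onD)
  obtain B where B: "((\<lambda>p. snd (f p)) has_derivative B) (at p)" "\<And>c v. B (cscale c v) = c * B v"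
    using assms unfolding holomorphic2_map_on_def by (meson holomorphic2_onD)
  show thesis
  proof
    show "(f has_derivative (\<lambda>v. (A v, B v))) (at p)"
      using has_derivative_Pair[OF A(1) B(1)] by simp
  qed (simp add: A B)
qed

lemma holomorphic2_map_onI:
  assumes "\<And>p. p \<in> S \<Longrightarrow> \<exists>T. (f has_derivative T) (at p) \<and> (\<forall>c v. T (cscale c v) = cscale c (T v))"
  shows "holomorphic2_map_on f S"
  unfolding holomorphic2_map_on_def holomorphic2_on_def
proof (intro conjI ballI)
  fix p assume "p \<in> S"
  then obtain T where T: "(f has_derivative T) (at p)" "\<And>c v. T (cscale c v) = cscale c (T v)"
    using assms by blast
  show "\<exists>f'. ((\<lambda>p. fst (f p)) has_derivative f') (at p) \<and> (\<forall>c v. f' (cscale c v) = c * f' v)"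
    using has_derivative_fst[OF T(1)] T(2) by (intro exI[of _ "\<lambda>v. fst (T v)"]) simp
  show "\<exists>f'. ((\<lambda>p. snd (f p)) has_derivative f') (at p) \<and> (\<forall>c v. f' (cscale c v) = c * f' v)"
    using has_derivative_snd[OF T(1)] T(2) by (intro exI[of _ "\<lambda>v. snd (T v)"]) simp
qed

lemma holomorphic2_map_on_compose:
  assumes f: "holomorphic2_map_on f S" and g: "holomorphic2_map_on g U" and "f ` S \<subseteq> U"
  shows "holomorphic2_map_on (\<lambda>p. g (f p)) S"
proof (rule holomorphic2_map_onI)
  fix p assume p: "p \<in> S"
  obtain A where A: "(f has_derivative A) (at p)" "\<And>c v. A (cscale c v) = cscale c (A v)"
    using holomorphic2_map_onD[OF f p] by blast
  obtain B where B: "(g has_derivative B) (at (f p))" "\<And>c v. B (cscale c v) = cscale c (B v)"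
    using holomorphic2_map_onD[OF g] p assms(3) by blast
  show "\<exists>T. ((\<lambda>p. g (f p)) has_derivative T) (at p) \<and> (\<forall>c v. T (cscale c v) = cscale c (T v))"
    using has_derivative_compose[OF A(1) B(1)] A(2) B(2)
    by (intro exI[of _ "\<lambda>v. B (A v)"]) simp
qed

lemma holomorphic_on_compose_holomorphic2:
  assumes f: "f holomorphic2_on S" and g: "g holomorphic_on U" and "open U" "f ` S \<subseteq> U"
  shows "(\<lambda>p. g (f p)) holomorphic2_on S"
  unfolding holomorphic2_on_def
proof
  fix p assume p: "p \<in> S"
  obtain A where A: "(f has_derivative A) (at p)" "\<And>c v. A (cscale c v) = c * A v"
    using holomorphic2_onD[OF f p] by blast
  have "(g has_field_derivative deriv g (f p)) (at (f p))"
    using assms p holomorphic_derivI by blast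
  then have B: "(g has_derivative (*) (deriv g (f p))) (at (f p))"
    by (simp add: has_field_derivative_def)
  show "\<exists>T. ((\<lambda>p. g (f p)) has_derivative T) (at p) \<and> (\<forall>c v. T (cscale c v) = c * (T v))"
    using has_derivative_compose[OF A(1) B(1)] A(2)
    by (intro exI[of _ "\<lambda>v. deriv g (f p) * A v"]) simp
qed

lemma holomorphic2_on_fst: "fst holomorphic2_on S" and holomorphic2_on_snd: "snd holomorphic2_on S"
  and holomorphic2_on_const: "(\<lambda>_. k) holomorphic2_on S"
  unfolding holomorphic2_on_def
  by (auto intro!: derivative_eq_intros exI)

lemma holomorphic2_on_compose_map:
  assumes f: "holomorphic2_map_on f S" and g: "g holomorphic2_on U" and "f ` S \<subseteq> U"
  shows "(\<lambda>p. g (f p)) holomorphic2_on S"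
proof -
  have "holomorphic2_map_on (\<lambda>x. (g x, 0)) U"
    using g by (simp add: holomorphic2_map_on_def holomorphic2_on_const)
  from holomorphic2_map_on_compose[OF f this assms(3)] show ?thesis
    by (simp add: holomorphic2_map_on_def)
qed

lemma holomorphic2_on_add:
  assumes "f holomorphic2_on S" "g holomorphic2_on S"
  shows "(\<lambda>x. f x + g x) holomorphic2_on S"
  unfolding holomorphic2_on_def
proof
  fix p assume p: "p \<in> S"
  obtain A where A: "(f has_derivative A) (at p)" "\<And>c v. A (cscale c v) = c * A v"
    using holomorphic2_onD[OF assms(1) p] by blast
  obtain B where B: "(g has_derivative B) (at p)" "\<And>c v. B (cscale c v) = c * B v"
    using holomorphic2_onD[OF assms(2) p] by blast
  show "\<exists>T. ((\<lambda>p. f p + g p) has_derivative T) (at p) \<and> (\<forall>c v. T (cscale c v) = c * (T v))"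
    using has_derivative_add[OF A(1) B(1)] A(2) B(2)
    by (intro exI[of _ "\<lambda>v. A v + B v"]) (simp add: algebra_simps)
qed

lemma holomorphic2_on_mult:
  assumes "f holomorphic2_on S" "g holomorphic2_on S"
  shows "(\<lambda>x. f x * g x) holomorphic2_on S"
  unfolding holomorphic2_on_def
proof
  fix p assume p: "p \<in> S"
  obtain A where A: "(f has_derivative A) (at p)" "\<And>c v. A (cscale c v) = c * A v"
    using holomorphic2_onD[OF assms(1) p] by blast
  obtain B where B: "(g has_derivative B) (at p)" "\<And>c v. B (cscale c v) = c * B v"
    using holomorphic2_onD[OF assms(2) p] by blast
  show "\<exists>T. ((\<lambda>p. f p * g p) has_derivative T) (at p) \<and> (\<forall>c v. T (cscale c v) = c * (T v))"
    using has_derivative_mult[OF A(1) B(1)] A(2) B(2)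
    by (intro exI[of _ "\<lambda>v. f p * B v + A v * g p"]) (simp add: algebra_simps)
qed

lemma holomorphic2_on_diff:
  assumes "f holomorphic2_on S" "g holomorphic2_on S"
  shows "(\<lambda>x. f x - g x) holomorphic2_on S"
  using holomorphic2_on_add[OF assms(1) holomorphic2_on_mult[OF holomorphic2_on_const[of "-1"] assms(2)]]
  by simp

lemma holomorphic2_on_divide:
  assumes f: "f holomorphic2_on S" and g: "g holomorphic2_on S" and nz: "\<And>x. x \<in> S \<Longrightarrow> g x \<noteq> 0"
  shows "(\<lambda>x. f x / g x) holomorphic2_on S"
proof -
  have "(\<lambda>x. inverse (g x)) holomorphic2_on S"
    by (rule holomorphic_on_compose_holomorphic2[OF g, of inverse "- {0}"])
       (use nz in \<open>auto intro!: holomorphic_intros open_Compl\<close>)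
  then show ?thesis
    using holomorphic2_on_mult[OF f] by (simp add: field_class.field_divide_inverse)
qed

lemmas holomorphic2_intros =
  holomorphic2_on_fst holomorphic2_on_snd holomorphic2_on_const holomorphic2_on_add
  holomorphic2_on_mult holomorphic2_on_diff holomorphic2_on_divide

lemma holomorphic_curve_has_derivative:
  assumes "holomorphic_curve_on h U" "open U" "z \<in> U"
  shows "(h has_derivative (\<lambda>c. cscale c (curve_deriv h z))) (at z)"
proof -
  have "((\<lambda>z. fst (h z)) has_field_derivative deriv (\<lambda>z. fst (h z)) z) (at z)"
       "((\<lambda>z. snd (h z)) has_field_derivative deriv (\<lambda>z. snd (h z)) z) (at z)"
    using assms by (auto simp: holomorphic_curve_on_def intro: holomorphic_derivI)
  from has_derivative_Pair[OF this[unfolded has_field_derivative_def]]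
  show ?thesis by (simp add: curve_deriv_def cscale_def mult.commute)
qed

lemma holomorphic_curve_compose_map:
  assumes h: "holomorphic_curve_on h U" "open U" and f: "holomorphic2_map_on f S" and "h ` U \<subseteq> S"
  shows "holomorphic_curve_on (\<lambda>z. f (h z)) U"
    and "z \<in> U \<Longrightarrow> (f has_derivative T) (at (h z)) \<Longrightarrow>
           curve_deriv (\<lambda>z. f (h z)) z = T (curve_deriv h z)"
proof -
  have *: "((\<lambda>z. fst (f (h z))) has_field_derivative fst (T (curve_deriv h z))) (at z) \<and>
     ((\<lambda>z. snd (f (h z))) has_field_derivative snd (T (curve_deriv h z))) (at z)"
    if z: "z \<in> U" and T: "(f has_derivative T) (at (h z))" for z T
  proof -
    have hz: "h z \<in> S" using assms z by blast
    obtain T' where T': "(f has_derivative T') (at (h z))" "\<And>c v. T' (cscale c v) = cscale c (T' v)"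
      using holomorphic2_map_onD[OF f hz] by blast
    have "T' = T" using T T'(1) has_derivative_unique by blast
    have D: "((\<lambda>z. f (h z)) has_derivative (\<lambda>c. cscale c (T (curve_deriv h z)))) (at z)"
      using has_derivative_compose[OF holomorphic_curve_has_derivative[OF h z] T] T' \<open>T' = T\<close> by simp
    have e: "(*) k = (\<lambda>x. x * k)" for k :: complex by (simp add: fun_eq_iff)
    show ?thesis
      unfolding has_field_derivative_def e[of "fst (T (curve_deriv h z))"] e[of "snd (T (curve_deriv h z))"]
      using has_derivative_fst[OF D] has_derivative_snd[OF D] by simp
  qed
  show "holomorphic_curve_on (\<lambda>z. f (h z)) U"
    unfolding holomorphic_curve_on_def holomorphic_on_def
  proof (intro conjI ballI)
    fix z assume z: "z \<in> U"
    have "h z \<in> S" using assms(4) z by blast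
    then obtain T' where T': "(f has_derivative T') (at (h z))"
      by (rule holomorphic2_map_onD[OF f])
    show "(\<lambda>z. fst (f (h z))) field_differentiable (at z within U)"
         "(\<lambda>z. snd (f (h z))) field_differentiable (at z within U)"
      using *[OF z T'] field_differentiable_at_within field_differentiable_def by blast+
  qed
  show "curve_deriv (\<lambda>z. f (h z)) z = T (curve_deriv h z)"
    if "z \<in> U" "(f has_derivative T) (at (h z))"
  proof (rule prod_eqI)
    show "fst (curve_deriv (\<lambda>z. f (h z)) z) = fst (T (curve_deriv h z))"
      using *[OF that] by (simp only: curve_deriv_def fst_conv) (blast intro: DERIV_imp_deriv)
    show "snd (curve_deriv (\<lambda>z. f (h z)) z) = snd (T (curve_deriv h z))"
      using *[OF that] by (simp only: curve_deriv_def snd_conv) (blast intro: DERIV_imp_deriv)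
  qed
qed

lemma holomorphic_on_compose_curve:
  assumes h: "holomorphic_curve_on h U" "open U" and f: "f holomorphic2_on S" and "h ` U \<subseteq> S"
  shows "(\<lambda>z. f (h z)) holomorphic_on U"
    and "z \<in> U \<Longrightarrow> (f has_derivative f') (at (h z)) \<Longrightarrow>
           deriv (\<lambda>z. f (h z)) z = f' (curve_deriv h z)"
proof -
  have map: "holomorphic2_map_on (\<lambda>x. (f x, 0)) S"
    using f by (simp add: holomorphic2_map_on_def holomorphic2_on_const)
  show "(\<lambda>z. f (h z)) holomorphic_on U"
    using holomorphic_curve_compose_map(1)[OF h map assms(4)] by (simp add: holomorphic_curve_on_def)
  assume z: "z \<in> U" "(f has_derivative f') (at (h z))"
  have "((\<lambda>x. (f x, 0::complex)) has_derivative (\<lambda>v. (f' v, 0))) (at (h z))"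
    by (intro has_derivative_Pair z has_derivative_const)
  from holomorphic_curve_compose_map(2)[OF h map assms(4) z(1) this]
  have "fst (curve_deriv (\<lambda>z. (f (h z), 0)) z) = f' (curve_deriv h z)" by simp
  then show "deriv (\<lambda>z. f (h z)) z = f' (curve_deriv h z)" by (simp add: curve_deriv_def)
qed

lemma holomorphic_curve_reparam:
  assumes h: "holomorphic_curve_on h U" "open U" and g: "g holomorphic_on V" "open V" and "g ` V \<subseteq> U"
  shows "holomorphic_curve_on (\<lambda>z. h (g z)) V"
    and "z \<in> V \<Longrightarrow> curve_deriv (\<lambda>z. h (g z)) z = cscale (deriv g z) (curve_deriv h (g z))"
proof -
  show "holomorphic_curve_on (\<lambda>z. h (g z)) V"
    using h g assms(5) holomorphic_on_compose_gen[of g V _ U, unfolded o_def]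
    by (auto simp: holomorphic_curve_on_def)
  assume z: "z \<in> V"
  have gz: "(g has_field_derivative deriv g z) (at z)"
    using g z holomorphic_derivI by blast
  have "((\<lambda>z. fst (h z)) has_field_derivative deriv (\<lambda>z. fst (h z)) (g z)) (at (g z))"
       "((\<lambda>z. snd (h z)) has_field_derivative deriv (\<lambda>z. snd (h z)) (g z)) (at (g z))"
    using h assms(5) z by (auto simp: holomorphic_curve_on_def intro!: holomorphic_derivI)
  from DERIV_chain2[OF this(1) gz] DERIV_chain2[OF this(2) gz]
  show "curve_deriv (\<lambda>z. h (g z)) z = cscale (deriv g z) (curve_deriv h (g z))"
    by (auto simp: curve_deriv_def DERIV_imp_deriv mult.commute)
qed

definition analytic_disc :: "(complex \<Rightarrow> complex \<times> complex) \<Rightarrow> bool" where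
  "analytic_disc h \<longleftrightarrow> holomorphic_curve_on h unit_disc \<and> h ` unit_disc \<subseteq> G"

lemma geodesic_param_disc: "geodesic_param h \<Longrightarrow> analytic_disc h"
  by (auto simp: geodesic_param_def analytic_disc_def)

lemma analytic_disc_mem: "analytic_disc h \<Longrightarrow> norm z < 1 \<Longrightarrow> h z \<in> G"
  by (auto simp: analytic_disc_def)

lemma analytic_disc_reparam:
  assumes "analytic_disc h" "g holomorphic_on unit_disc" "g ` unit_disc \<subseteq> unit_disc"
  shows "analytic_disc (\<lambda>z. h (g z))"
    and "norm z < 1 \<Longrightarrow> curve_deriv (\<lambda>z. h (g z)) z = cscale (deriv g z) (curve_deriv h (g z))"
proof -
  note r = holomorphic_curve_reparam[OF _ open_ball assms(2) open_ball assms(3)]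
  have h: "holomorphic_curve_on h unit_disc" using assms(1) by (simp add: analytic_disc_def)
  show "analytic_disc (\<lambda>z. h (g z))"
    using r(1)[OF h] assms by (auto simp: analytic_disc_def image_subset_iff)
  show "norm z < 1 \<Longrightarrow> curve_deriv (\<lambda>z. h (g z)) z = cscale (deriv g z) (curve_deriv h (g z))"
    by (rule r(2)[OF h]) simp
qed

text \<open>The definition of an automorphism refers to \<open>inv_into\<close>, which is unspecified outside \<open>G\<close>. As \<open>G\<close> is open,
any holomorphic inverse on \<open>G\<close> has the same derivatives there.\<close>

lemma Aut_sym_bidiscI:
  assumes f: "holomorphic2_map_on f G" "f ` G \<subseteq> G"
    and g: "holomorphic2_map_on g G" "g ` G \<subseteq> G"
    and gf: "\<And>x. x \<in> G \<Longrightarrow> g (f x) = x" and fg: "\<And>x. x \<in> G \<Longrightarrow> f (g x) = x"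
  shows "f \<in> Aut_sym_bidisc"
proof -
  have bij: "bij_betw f G G"
    using assms by (intro bij_betw_byWitness[of _ g]) auto
  have eq: "inv_into G f x = g x" if "x \<in> G" for x
    using that bij fg g(2) by (intro inv_into_f_eq) (auto simp: bij_betw_def)
  have "holomorphic2_map_on (inv_into G f) G"
  proof (rule holomorphic2_map_onI)
    fix p assume p: "p \<in> G"
    obtain T where T: "(g has_derivative T) (at p)" "\<And>c v. T (cscale c v) = cscale c (T v)"
      using holomorphic2_map_onD[OF g(1) p] by blast
    have "(inv_into G f has_derivative T) (at p)"
      using has_derivative_transform_within_open[OF T(1) open_sym_bidisc p] eq by metis
    then show "\<exists>T. (inv_into G f has_derivative T) (at p) \<and> (\<forall>c v. T (cscale c v) = cscale c (T v))"
      using T(2) by blast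
  qed
  then show ?thesis using bij f by (simp add: Aut_sym_bidisc_def)
qed

definition inverse_automorphisms ::
  "(complex \<times> complex \<Rightarrow> complex \<times> complex) \<Rightarrow> (complex \<times> complex \<Rightarrow> complex \<times> complex) \<Rightarrow> bool" where
  "inverse_automorphisms f g \<longleftrightarrow>
     holomorphic2_map_on f G \<and> f ` G \<subseteq> G \<and>
     holomorphic2_map_on g G \<and> g ` G \<subseteq> G \<and>
     (\<forall>x\<in>G. g (f x) = x \<and> f (g x) = x)"

lemma inverse_automorphismsD:
  assumes "inverse_automorphisms f g"
  shows "g \<in> Aut_sym_bidisc" "holomorphic2_map_on f G" "f ` G \<subseteq> G"
    "holomorphic2_map_on g G" "g ` G \<subseteq> G"
    "x \<in> G \<Longrightarrow> g (f x) = x" "x \<in> G \<Longrightarrow> f (g x) = x"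
  using assms Aut_sym_bidiscI[of g f] by (simp_all add: inverse_automorphisms_def)

lemma Aut_sym_bidiscE:
  assumes "f \<in> Aut_sym_bidisc"
  obtains g where "inverse_automorphisms f g"
proof
  have bij: "bij_betw f G G" and hol: "holomorphic2_map_on f G"
    "holomorphic2_map_on (inv_into G f) G"
    using assms by (auto simp: Aut_sym_bidisc_def)
  have "f ` G \<subseteq> G" using bij by (simp add: bij_betw_def)
  moreover have "inv_into G f ` G \<subseteq> G"
    using bij by (metis bij_betw_imp_surj_on bij_betw_inv_into subset_refl)
  ultimately show "inverse_automorphisms f (inv_into G f)"
    unfolding inverse_automorphisms_def
    using hol bij by (simp add: bij_betw_inv_into_left bij_betw_inv_into_right)
qed

lemma Aut_sym_bidisc_mem: "f \<in> Aut_sym_bidisc \<Longrightarrow> x \<in> G \<Longrightarrow> f x \<in> G"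
  by (auto simp: Aut_sym_bidisc_def bij_betw_def)

lemma Aut_sym_bidisc_compose:
  assumes "f \<in> Aut_sym_bidisc" "g \<in> Aut_sym_bidisc"
  shows "(\<lambda>x. f (g x)) \<in> Aut_sym_bidisc"
proof -
  obtain f' where f'_inv: "inverse_automorphisms f f'"
    by (rule Aut_sym_bidiscE[OF assms(1)])
  note f' = inverse_automorphismsD[OF f'_inv]
  obtain g' where g'_inv: "inverse_automorphisms g g'"
    by (rule Aut_sym_bidiscE[OF assms(2)])
  note g' = inverse_automorphismsD[OF g'_inv]
  show ?thesis
    by (rule Aut_sym_bidiscI[of _ "\<lambda>x. g' (f' x)"])
       (use f' g' in \<open>simp_all add: holomorphic2_map_on_compose[OF g'(2) f'(2) g'(3)]
          holomorphic2_map_on_compose[OF f'(4) g'(4) f'(5)] image_subset_iff\<close>)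
qed

definition inverse_derivatives where
  "inverse_derivatives f g p T T' \<longleftrightarrow>
     (f has_derivative T) (at p) \<and> (g has_derivative T') (at (f p)) \<and>
     (\<forall>c v. T (cscale c v) = cscale c (T v) \<and> T' (cscale c v) = cscale c (T' v)) \<and>
     (\<forall>v. T' (T v) = v \<and> T (T' v) = v)"

lemma inverse_derivativesD:
  assumes "inverse_derivatives f g p T T'"
  shows "(f has_derivative T) (at p)" "(g has_derivative T') (at (f p))"
    "linear T" "linear T'" "T (cscale c v) = cscale c (T v)" "T' (cscale c v) = cscale c (T' v)"
    "T' (T v) = v" "T (T' v) = v"
  using assms has_derivative_linear unfolding inverse_derivatives_def by blast+

lemma Aut_sym_bidisc_derivative:
  assumes inv: "inverse_automorphisms f g" and p: "p \<in> G"
  obtains T T' where "inverse_derivatives f g p T T'"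
proof -
  note g = inverse_automorphismsD[OF inv]
  have fp: "f p \<in> G" using g(3) p by blast
  obtain T where T: "(f has_derivative T) (at p)" "\<And>c v. T (cscale c v) = cscale c (T v)"
    using holomorphic2_map_onD[OF g(2) p] by blast
  obtain T' where T': "(g has_derivative T') (at (f p))" "\<And>c v. T' (cscale c v) = cscale c (T' v)"
    using holomorphic2_map_onD[OF g(4) fp] by blast
  have "((\<lambda>x. g (f x)) has_derivative (\<lambda>v. T' (T v))) (at p)"
    by (rule has_derivative_compose[OF T(1) T'(1)])
  then have "((\<lambda>x. x) has_derivative (\<lambda>v. T' (T v))) (at p)"
    by (rule has_derivative_transform_within_open[OF _ open_sym_bidisc p]) (rule g(6))
  then have 1: "(\<lambda>v. T' (T v)) = (\<lambda>v. v)"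
    using has_derivative_ident has_derivative_unique by blast
  have "((\<lambda>x. f (g x)) has_derivative (\<lambda>v. T (T' v))) (at (f p))"
    by (rule has_derivative_compose[OF T'(1)]) (use T(1) g(6)[OF p] in simp)
  then have "((\<lambda>x. x) has_derivative (\<lambda>v. T (T' v))) (at (f p))"
    by (rule has_derivative_transform_within_open[OF _ open_sym_bidisc fp]) (rule g(7))
  then have 2: "(\<lambda>v. T (T' v)) = (\<lambda>v. v)"
    using has_derivative_ident has_derivative_unique by blast
  show thesis
    using that[of T T'] T T' fun_cong[OF 1] fun_cong[OF 2] by (simp add: inverse_derivatives_def)
qed

section \<open>Extremal discs and the induced automorphisms\<close>

lemma moeb_lt_1: "norm a < 1 \<Longrightarrow> norm z < 1 \<Longrightarrow> norm (moeb a z) < 1"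
  by (rule Moebius_function_norm_lt_1)

lemma moeb_holomorphic: "norm a < 1 \<Longrightarrow> moeb a holomorphic_on unit_disc"
  by (rule Moebius_function_holomorphic)

lemma moeb_inverse [simp]:
  "norm a < 1 \<Longrightarrow> norm z < 1 \<Longrightarrow> moeb (- a) (moeb a z) = z"
  "norm a < 1 \<Longrightarrow> norm z < 1 \<Longrightarrow> moeb a (moeb (- a) z) = z"
  by (rule Moebius_function_compose; simp)+

lemma moeb_field_derivative:
  assumes "norm a < 1" "norm z < 1"
  shows "(moeb a has_field_derivative (1 - a * cnj a) / (1 - cnj a * z)^2) (at z)"
proof -
  have nz: "1 - cnj a * z \<noteq> 0" using assms moeb_denominator_nz by simp
  have "((\<lambda>z. z - a) has_field_derivative 1) (at z)"
       "((\<lambda>z. 1 - cnj a * z) has_field_derivative - cnj a) (at z)"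
    by (auto intro!: derivative_eq_intros)
  from DERIV_divide[OF this nz]
  have "(moeb a has_field_derivative
      (1 * (1 - cnj a * z) - (z - a) * - cnj a) / ((1 - cnj a * z) * (1 - cnj a * z))) (at z)"
    by (simp only: moeb_def[abs_def])
  also have "1 * (1 - cnj a * z) - (z - a) * - cnj a = 1 - a * cnj a" by (simp add: algebra_simps)
  finally show ?thesis by (simp only: power2_eq_square)
qed

lemma moeb_norm_eq_1:
  assumes "norm a < 1" "norm z = 1"
  shows "norm (moeb a z) = 1"
proof -
  have nz: "1 - cnj a * z \<noteq> 0" using assms moeb_denominator_nz by simp
  have "z * cnj z = 1" using assms(2) of_real_norm_squared[of z] by simp
  then have "cnj (1 - cnj a * z) * z = z - a" by (simp add: algebra_simps)
  then have "norm (z - a) = norm (1 - cnj a * z)"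
    using assms by (metis complex_mod_cnj mult.right_neutral norm_mult)
  then show ?thesis using nz by (simp add: moeb_def norm_divide)
qed

text \<open>Composing with \<open>moeb (f 0)\<close> reduces this to the Schwarz lemma. In the equality case \<open>f\<close> is determined by \<open>f 0\<close> and its
derivative at \<open>0\<close>; this rigidity is the source of the uniqueness of geodesics.\<close>

lemma schwarz_pick_at_0:
  assumes f: "f holomorphic_on unit_disc" and fi: "\<And>z. norm z < 1 \<Longrightarrow> norm (f z) < 1"
  shows "norm (deriv f 0) \<le> 1 - (norm (f 0))^2"
    and "norm (deriv f 0) = 1 - (norm (f 0))^2 \<Longrightarrow>
      norm (deriv f 0 / of_real (1 - (norm (f 0))^2)) = 1 \<and>
      (\<forall>z. norm z < 1 \<longrightarrow> f z = moeb (- f 0) (deriv f 0 / of_real (1 - (norm (f 0))^2) * z))"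
proof -
  define g where "g z = moeb (f 0) (f z)" for z
  have f0: "norm (f 0) < 1" by (rule fi) simp
  have pos: "1 - (norm (f 0))^2 > 0" using f0 by (simp add: power_less_one_iff)
  have nz: "complex_of_real (1 - (norm (f 0))^2) \<noteq> 0" using pos by (metis less_irrefl of_real_eq_0_iff)
  have g: "g holomorphic_on unit_disc"
    using holomorphic_on_compose_gen[OF f moeb_holomorphic[OF f0]] fi
    unfolding g_def[abs_def] o_def by (auto simp: image_subset_iff)
  have g0: "g 0 = 0" by (simp add: g_def moeb_def)
  have gi: "norm (g z) < 1" if "norm z < 1" for z
    unfolding g_def using moeb_lt_1 f0 fi that by blast
  have fd: "(f has_field_derivative deriv f 0) (at 0)"
    using f by (intro holomorphic_derivI[of f unit_disc]) auto
  have e: "1 - f 0 * cnj (f 0) = of_real (1 - (norm (f 0))^2)"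
    by (simp only: of_real_one_minus_norm_squared)
  have "(g has_field_derivative (1 - f 0 * cnj (f 0)) / (1 - cnj (f 0) * f 0)^2 * deriv f 0) (at 0)"
    unfolding g_def[abs_def] by (rule DERIV_chain2[OF moeb_field_derivative fd]) (use f0 in auto)
  then have "deriv g 0 = (1 - f 0 * cnj (f 0)) / (1 - cnj (f 0) * f 0)^2 * deriv f 0"
    by (rule DERIV_imp_deriv)
  then have dg: "deriv g 0 = deriv f 0 / of_real (1 - (norm (f 0))^2)"
    unfolding mult.commute[of "cnj (f 0)"] e using nz by (simp add: power2_eq_square del: of_real_diff of_real_power)
  then have ndg: "norm (deriv g 0) = norm (deriv f 0) / (1 - (norm (f 0))^2)"
    using pos by (simp add: norm_divide del: of_real_diff of_real_power)
  have "norm (deriv g 0) \<le> 1"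
    by (rule Schwarz_Lemma(2)[OF g g0, of 0]) (use gi in auto)
  then show "norm (deriv f 0) \<le> 1 - (norm (f 0))^2"
    unfolding ndg using pos by (simp add: divide_le_eq)
  assume eq: "norm (deriv f 0) = 1 - (norm (f 0))^2"
  then have "norm (deriv g 0) = 1" using ndg pos by simp
  then obtain \<alpha> where \<alpha>: "\<And>z. norm z < 1 \<Longrightarrow> g z = \<alpha> * z" "norm \<alpha> = 1"
    using Schwarz_Lemma(3)[OF g g0, of 0] gi by auto
  have "((\<lambda>z. \<alpha> * z) has_field_derivative \<alpha>) (at 0)" by (auto intro!: derivative_eq_intros)
  then have "(g has_field_derivative \<alpha>) (at 0)"
    by (rule has_field_derivative_transform_within_open[of _ _ _ "unit_disc"]) (use \<alpha> in auto)
  then have "\<alpha> = deriv g 0" by (simp add: DERIV_imp_deriv)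
  then have a: "\<alpha> = deriv f 0 / of_real (1 - (norm (f 0))^2)" using dg by simp
  have "f z = moeb (- f 0) (\<alpha> * z)" if z: "norm z < 1" for z
    using moeb_inverse(1)[OF f0 fi[OF z]] \<alpha>(1)[OF z] unfolding g_def by metis
  then show "norm (deriv f 0 / of_real (1 - (norm (f 0))^2)) = 1 \<and>
      (\<forall>z. norm z < 1 \<longrightarrow> f z = moeb (- f 0) (deriv f 0 / of_real (1 - (norm (f 0))^2) * z))"
    unfolding a[symmetric] using \<alpha>(2) by blast
qed

text \<open>The automorphism that applies \<open>moeb a\<close> to both roots, written in the elementary symmetric functions of the roots;
see \<open>sym_moeb_sum_prod\<close>.\<close>

definition sym_moeb :: "complex \<Rightarrow> complex \<times> complex \<Rightarrow> complex \<times> complex" where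
  "sym_moeb a x =
    ((fst x * (1 + a * cnj a) - 2 * cnj a * snd x - 2 * a) / (1 - cnj a * fst x + (cnj a)^2 * snd x),
     (snd x - a * fst x + a^2) / (1 - cnj a * fst x + (cnj a)^2 * snd x))"

lemma sym_moeb_denominator:
  "1 - cnj a * (z + w) + (cnj a)^2 * (z * w) = (1 - cnj a * z) * (1 - cnj a * w)"
  by (simp add: algebra_simps power2_eq_square)

lemma sym_moeb_sum_prod:
  assumes "norm a < 1" "norm z \<le> 1" "norm w \<le> 1"
  shows "sym_moeb a (z + w, z * w) = (moeb a z + moeb a w, moeb a z * moeb a w)"
proof -
  have nz: "1 - cnj a * z \<noteq> 0" "1 - cnj a * w \<noteq> 0" using assms moeb_denominator_nz by auto
  have "(z + w) * (1 + a * cnj a) - 2 * cnj a * (z * w) - 2 * a =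
      (z - a) * (1 - cnj a * w) + (w - a) * (1 - cnj a * z)"
    by (simp add: algebra_simps)
  moreover have "z * w - a * (z + w) + a^2 = (z - a) * (w - a)"
    by (simp add: algebra_simps power2_eq_square)
  ultimately show ?thesis
    unfolding sym_moeb_def fst_conv snd_conv sym_moeb_denominator moeb_def
    using nz by (simp add: add_frac_eq)
qed

lemma sym_moeb_in_sym_bidisc:
  assumes "norm a < 1" "x \<in> G"
  shows "sym_moeb a x \<in> G"
proof -
  obtain z w where zw: "norm z < 1" "norm w < 1" "x = (z + w, z * w)"
    using assms unfolding mem_sym_bidisc by blast
  then show ?thesis
    using moeb_lt_1[OF assms(1)] sym_moeb_sum_prod[OF assms(1), of z w]
    unfolding mem_sym_bidisc by (metis less_imp_le)
qed

lemma sym_moeb_inverse [simp]: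
  assumes "norm a < 1" "x \<in> G"
  shows "sym_moeb (- a) (sym_moeb a x) = x" "sym_moeb a (sym_moeb (- a) x) = x"
proof -
  have *: "sym_moeb (- a) (sym_moeb a x) = x" if a: "norm a < 1" for a
  proof -
    obtain z w where zw: "norm z < 1" "norm w < 1" "x = (z + w, z * w)"
      using assms unfolding mem_sym_bidisc by blast
    then show ?thesis
      using a moeb_lt_1[OF a zw(1)] moeb_lt_1[OF a zw(2)] by (simp add: sym_moeb_sum_prod)
  qed
  show "sym_moeb (- a) (sym_moeb a x) = x" using * assms by blast
  show "sym_moeb a (sym_moeb (- a) x) = x" using *[of "- a"] assms by simp
qed

lemma sym_moeb_denominator_nz:
  assumes "norm a < 1" "x \<in> G"
  shows "1 - cnj a * fst x + (cnj a)^2 * snd x \<noteq> 0"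
proof -
  obtain z w where zw: "norm z < 1" "norm w < 1" "x = (z + w, z * w)"
    using assms unfolding mem_sym_bidisc by blast
  then show ?thesis
    using moeb_denominator_nz[of a z] moeb_denominator_nz[of a w] assms
    by (simp only: zw fst_conv snd_conv sym_moeb_denominator mult_eq_0_iff less_imp_le)
       (simp add: less_imp_le)
qed

lemma sym_moeb_holomorphic:
  assumes "norm a < 1"
  shows "holomorphic2_map_on (sym_moeb a) G"
  unfolding holomorphic2_map_on_def sym_moeb_def fst_conv snd_conv
  by (intro conjI holomorphic2_intros sym_moeb_denominator_nz[OF assms])

lemma sym_moeb_Aut: "norm a < 1 \<Longrightarrow> sym_moeb a \<in> Aut_sym_bidisc"
  by (rule Aut_sym_bidiscI[where g = "sym_moeb (- a)"])
     (auto simp: sym_moeb_holomorphic sym_moeb_in_sym_bidisc)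

text \<open>Take \<open>a\<close> to be the hyperbolic midpoint of \<open>0\<close> and the flat coordinate \<open>b\<close> of the point. So every orbit of the
induced automorphisms meets the central flat geodesic.\<close>

lemma sym_moeb_to_zero:
  assumes "x \<in> G"
  obtains a q where "norm a < 1" "norm q < 1" "sym_moeb a x = (0, q)"
proof -
  obtain b where b: "norm b < 1" "fst x = b + cnj b * snd x"
    using sym_bidisc_flat_coordinate[of "fst x" "snd x"] assms by auto
  obtain a where a: "norm a < 1" "b * (1 + a * cnj a) = 2 * a"
    using hyperbolic_midpoint_exists[OF b(1)] by blast
  have "cnj (b * (1 + a * cnj a)) = cnj (2 * a)" using a by simp
  then have a': "cnj b * (1 + a * cnj a) = 2 * cnj a" by (simp add: mult.commute)
  have "fst x * (1 + a * cnj a) - 2 * cnj a * snd x - 2 * a =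
      b * (1 + a * cnj a) + cnj b * (1 + a * cnj a) * snd x - 2 * cnj a * snd x - 2 * a"
    unfolding b(2) by (simp add: algebra_simps)
  also have "\<dots> = 0" unfolding a a' by simp
  finally have 1: "fst (sym_moeb a x) = 0" by (simp add: sym_moeb_def)
  have "norm (snd (sym_moeb a x)) < 1"
    using sym_moeb_in_sym_bidisc[OF a(1) assms] sym_bidisc_snd_lt_1 by blast
  then show thesis using that[OF a(1), of "snd (sym_moeb a x)"] 1 by (metis prod.collapse)
qed

lemma royal_subset: "royal_variety \<subseteq> G"
  unfolding royal_variety_def mem_sym_bidisc subset_iff
  by (auto simp: power2_eq_square)

lemma royal_iff:
  assumes "x \<in> G"
  shows "x \<in> royal_variety \<longleftrightarrow> (fst x)^2 = 4 * snd x"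
proof
  assume "x \<in> royal_variety" then show "(fst x)^2 = 4 * snd x"
    by (auto simp: royal_variety_def power2_eq_square)
next
  assume a: "(fst x)^2 = 4 * snd x"
  have "norm (fst x / 2) < 1" using sym_bidisc_fst_lt_2[OF assms] by (simp add: norm_divide)
  moreover have "x = (2 * (fst x / 2), (fst x / 2)^2)" using a by (simp add: prod_eq_iff power_divide)
  ultimately show "x \<in> royal_variety" unfolding royal_variety_def by fastforce
qed

lemma sym_moeb_royal:
  assumes "norm a < 1" "x \<in> royal_variety"
  shows "sym_moeb a x \<in> royal_variety"
proof -
  obtain z where z: "norm z < 1" "x = (z + z, z * z)"
    using assms by (auto simp: royal_variety_def power2_eq_square)
  show ?thesis
    using moeb_lt_1[OF assms(1) z(1)] sym_moeb_sum_prod[OF assms(1), of z z] z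
    unfolding royal_variety_def by (auto simp: power2_eq_square)
qed

text \<open>For unimodular \<open>\<omega>\<close> these are the functions that realize the Caratheodory metric of \<open>G\<close>.\<close>

definition Phi :: "complex \<Rightarrow> complex \<times> complex \<Rightarrow> complex" where
  "Phi \<omega> x = (2 * \<omega> * snd x - fst x) / (2 - \<omega> * fst x)"

lemma Phi_denominator_nz:
  assumes "norm \<omega> = 1" "x \<in> G"
  shows "2 - \<omega> * fst x \<noteq> 0"
proof
  assume "2 - \<omega> * fst x = 0"
  then have "\<omega> * fst x = 2" by simp
  then have "norm (\<omega> * fst x) = 2" by simp
  then show False using assms sym_bidisc_fst_lt_2[of x] by (simp add: norm_mult)
qed

text \<open>The difference of the squared moduli of denominator and numerator is
\<open>4 (1 - |p|^2 - Re (\<omega> (s - cnj s * p)))\<close>, which is positive by \<open>sym_bidisc_iff\<close>.\<close>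

lemma Phi_lt_1:
  assumes "norm \<omega> = 1" "x \<in> G"
  shows "norm (Phi \<omega> x) < 1"
proof -
  let ?s = "fst x" and ?p = "snd x"
  have w: "\<omega> * cnj \<omega> = 1" using assms(1) of_real_norm_squared[of \<omega>] by simp
  have "complex_of_real ((norm (2 - \<omega> * ?s))^2 - (norm (2 * \<omega> * ?p - ?s))^2) =
     (2 - \<omega> * ?s) * cnj (2 - \<omega> * ?s) - (2 * \<omega> * ?p - ?s) * cnj (2 * \<omega> * ?p - ?s)"
    by (simp only: of_real_diff complex_norm_square)
  also have "\<dots> = 4 * (1 - ?p * cnj ?p) - 2 * (\<omega> * (?s - cnj ?s * ?p) + cnj (\<omega> * (?s - cnj ?s * ?p)))
      + (\<omega> * cnj \<omega> - 1) * (?s * cnj ?s - 4 * ?p * cnj ?p)"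
    by (simp add: algebra_simps)
  also have "\<dots> = of_real (4 * (1 - (norm ?p)^2) - 4 * Re (\<omega> * (?s - cnj ?s * ?p)))"
    unfolding w complex_add_cnj of_real_one_minus_norm_squared[symmetric] by simp
  finally have eq: "(norm (2 - \<omega> * ?s))^2 - (norm (2 * \<omega> * ?p - ?s))^2 =
     4 * (1 - (norm ?p)^2) - 4 * Re (\<omega> * (?s - cnj ?s * ?p))"
    by (simp only: of_real_eq_iff)
  have "Re (\<omega> * (?s - cnj ?s * ?p)) \<le> norm (?s - cnj ?s * ?p)"
    using complex_Re_le_cmod[of "\<omega> * (?s - cnj ?s * ?p)"] assms(1) by (simp only: norm_mult mult_1)
  also have "norm (?s - cnj ?s * ?p) < 1 - (norm ?p)^2" using assms(2) sym_bidisc_iff by blast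
  finally have "(norm (2 * \<omega> * ?p - ?s))^2 < (norm (2 - \<omega> * ?s))^2" using eq by argo
  then have "norm (2 * \<omega> * ?p - ?s) < norm (2 - \<omega> * ?s)"
    by (rule power_less_imp_less_base) simp
  then show ?thesis using Phi_denominator_nz[OF assms] by (simp add: Phi_def norm_divide)
qed

lemma Phi_holomorphic: "norm \<omega> = 1 \<Longrightarrow> Phi \<omega> holomorphic2_on G"
  unfolding Phi_def[abs_def]
  by (intro holomorphic2_intros) (rule Phi_denominator_nz)

text \<open>The values of \<open>Phi \<omega>\<close> and \<open>Phi (- \<omega>)\<close> are two relations that are linear in \<open>s\<close> and \<open>p\<close>; adding them eliminates \<open>p\<close>.\<close>

lemma Phi_pair_inj:
  assumes "norm \<omega> = 1" "x \<in> G" "y \<in> G"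
    and "Phi \<omega> x = Phi \<omega> y" "Phi (- \<omega>) x = Phi (- \<omega>) y"
  shows "x = y"
proof -
  define A where "A = Phi \<omega> y"
  define B where "B = Phi (- \<omega>) y"
  have AB: "norm A < 1" "norm B < 1"
    using Phi_lt_1[of \<omega> y] Phi_lt_1[of "-\<omega>" y] assms by (auto simp: A_def B_def)
  have "norm (\<omega> * (B - A)) < 2"
    using assms(1) AB norm_triangle_ineq4[of B A] by (simp add: norm_mult)
  then have nz: "2 + \<omega> * (B - A) \<noteq> 0"
    by (metis add_eq_0_iff norm_minus_cancel norm_numeral less_irrefl)
  have *: "fst u * (2 + \<omega> * (B - A)) = - 2 * (A + B) \<and> 2 * \<omega> * snd u = fst u + A * (2 - \<omega> * fst u)"
    if u: "u \<in> G" "Phi \<omega> u = A" "Phi (- \<omega>) u = B" for u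
  proof -
    have 1: "2 * \<omega> * snd u - fst u = A * (2 - \<omega> * fst u)"
      using u Phi_denominator_nz[OF assms(1) u(1)] by (auto simp: Phi_def field_simps)
    have 2: "- 2 * \<omega> * snd u - fst u = B * (2 + \<omega> * fst u)"
      using u Phi_denominator_nz[of "-\<omega>", OF _ u(1)] assms(1) by (auto simp: Phi_def field_simps)
    have "(2 * \<omega> * snd u - fst u) + (- 2 * \<omega> * snd u - fst u) =
        A * (2 - \<omega> * fst u) + B * (2 + \<omega> * fst u)" by (simp only: 1 2)
    then have "fst u * (2 + \<omega> * (B - A)) = - 2 * (A + B)"
      by (simp add: algebra_simps add_eq_0_iff)
    moreover have "2 * \<omega> * snd u = fst u + A * (2 - \<omega> * fst u)"
      using 1 by (simp add: algebra_simps)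
    ultimately show ?thesis by blast
  qed
  have x: "Phi \<omega> x = A" "Phi (- \<omega>) x = B" and y: "Phi \<omega> y = A" "Phi (- \<omega>) y = B"
    using assms by (auto simp: A_def B_def)
  have "fst x = fst y" using *[OF assms(2) x] *[OF assms(3) y] nz by (metis mult_right_cancel)
  moreover have "2 * \<omega> * snd x = 2 * \<omega> * snd y"
    using *[OF assms(2) x] *[OF assms(3) y] \<open>fst x = fst y\<close> by metis
  then have "snd x = snd y" using assms(1) by auto
  ultimately show ?thesis by (rule prod_eqI)
qed

lemma Phi_along_disc:
  assumes h: "analytic_disc h" "h 0 = (0, q)" and w: "norm \<omega> = 1"
  shows "(\<lambda>z. Phi \<omega> (h z)) holomorphic_on unit_disc"
    and "norm z < 1 \<Longrightarrow> norm (Phi \<omega> (h z)) < 1"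
    and "Phi \<omega> (h 0) = \<omega> * q"
    and "deriv (\<lambda>z. Phi \<omega> (h z)) 0 =
           (\<omega>^2 * q - 1) / 2 * fst (curve_deriv h 0) + \<omega> * snd (curve_deriv h 0)"
proof -
  have hc: "holomorphic_curve_on h unit_disc" "h ` unit_disc \<subseteq> G"
    using h by (auto simp: analytic_disc_def)
  show "(\<lambda>z. Phi \<omega> (h z)) holomorphic_on unit_disc"
    by (rule holomorphic_on_compose_curve(1)[OF hc(1) open_ball Phi_holomorphic[OF w] hc(2)])
  show "norm z < 1 \<Longrightarrow> norm (Phi \<omega> (h z)) < 1"
    by (rule Phi_lt_1[OF w analytic_disc_mem[OF h(1)]])
  show "Phi \<omega> (h 0) = \<omega> * q" by (simp add: h Phi_def)
  have s: "((\<lambda>z. fst (h z)) has_field_derivative fst (curve_deriv h 0)) (at 0)"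
   and p: "((\<lambda>z. snd (h z)) has_field_derivative snd (curve_deriv h 0)) (at 0)"
    using hc unfolding holomorphic_curve_on_def curve_deriv_def
    by (auto intro!: holomorphic_derivI[of _ unit_disc])
  let ?s' = "fst (curve_deriv h 0)" and ?p' = "snd (curve_deriv h 0)"
  have num: "((\<lambda>z. 2 * \<omega> * snd (h z) - fst (h z)) has_field_derivative 2 * \<omega> * ?p' - ?s') (at 0)"
    by (intro DERIV_diff DERIV_cmult p s)
  have den: "((\<lambda>z. 2 - \<omega> * fst (h z)) has_field_derivative 0 - \<omega> * ?s') (at 0)"
    by (intro DERIV_diff DERIV_cmult DERIV_const s)
  have "2 - \<omega> * fst (h 0) \<noteq> 0" by (simp add: h)
  from DERIV_divide[OF num den this]
  have "((\<lambda>z. Phi \<omega> (h z)) has_field_derivative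
     ((2 * \<omega> * ?p' - ?s') * 2 - 2 * \<omega> * q * (0 - \<omega> * ?s')) / (2 * 2)) (at 0)"
    by (simp add: Phi_def h)
  also have "((2 * \<omega> * ?p' - ?s') * 2 - 2 * \<omega> * q * (0 - \<omega> * ?s')) / (2 * 2) =
     (\<omega>^2 * q - 1) / 2 * ?s' + \<omega> * ?p'"
    unfolding power2_eq_square by (simp add: algebra_simps diff_divide_distrib add_divide_distrib)
  finally have "((\<lambda>z. Phi \<omega> (h z)) has_field_derivative
     (\<omega>^2 * q - 1) / 2 * fst (curve_deriv h 0) + \<omega> * snd (curve_deriv h 0)) (at 0)" .
  then show "deriv (\<lambda>z. Phi \<omega> (h z)) 0 =
           (\<omega>^2 * q - 1) / 2 * fst (curve_deriv h 0) + \<omega> * snd (curve_deriv h 0)"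
    by (rule DERIV_imp_deriv)
qed

lemma disc_velocity_bound:
  assumes h: "analytic_disc h" "h 0 = (0, q)" and w: "norm \<omega> = 1"
  shows "norm ((\<omega>^2 * q - 1) / 2 * fst (curve_deriv h 0) + \<omega> * snd (curve_deriv h 0)) \<le> 1 - (norm q)^2"
  using schwarz_pick_at_0(1)[OF Phi_along_disc(1,2)[OF assms]] w
  unfolding Phi_along_disc(3,4)[OF assms] by (simp add: norm_mult)

lemma unimodular_alignment:
  fixes a b :: complex
  obtains \<omega> where "norm \<omega> = 1" "norm (a + \<omega> * b) = norm a + norm b"
proof (cases "a = 0 \<or> b = 0")
  case True
  then show thesis using that[of 1] by auto
next
  case False
  let ?w = "sgn a / sgn b"
  have sb: "sgn b \<noteq> 0" using False by (simp add: sgn_zero_iff)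
  have ab: "of_real (norm b) * sgn b = b" "of_real (norm a) * sgn a = a"
    by (simp_all add: sgn_eq)
  have "?w * b = of_real (norm b) * (?w * sgn b)"
    by (subst ab(1)[symmetric]) (simp only: mult_ac)
  also have "?w * sgn b = sgn a" using sb by simp
  finally have "a + ?w * b = of_real (norm a) * sgn a + of_real (norm b) * sgn a"
    by (simp only: ab(2))
  then have "a + ?w * b = of_real (norm a + norm b) * sgn a"
    by (simp only: of_real_add distrib_right)
  then have "norm (a + ?w * b) = norm a + norm b"
    using False by (simp add: norm_mult norm_sgn del: of_real_add)
  moreover have "norm ?w = 1" using False by (simp add: norm_divide norm_sgn)
  ultimately show thesis using that by blast
qed

text \<open>The bounds for the individual \<open>\<omega>\<close> combine by choosing \<open>\<omega>\<close> so that the two terms of the velocity are aligned.\<close>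

lemma disc_velocity_bound_origin:
  assumes h: "analytic_disc h" "h 0 = (0, 0)"
  shows "norm (fst (curve_deriv h 0)) / 2 + norm (snd (curve_deriv h 0)) \<le> 1"
proof -
  obtain \<omega> where w: "norm \<omega> = 1" "norm (- fst (curve_deriv h 0) / 2 + \<omega> * snd (curve_deriv h 0)) =
      norm (- fst (curve_deriv h 0) / 2) + norm (snd (curve_deriv h 0))"
    using unimodular_alignment by blast
  then show ?thesis using disc_velocity_bound[OF h w(1)] by (simp add: norm_divide)
qed

text \<open>If the derivative of \<open>\<Phi> \<circ> h\<close> is extremal then \<open>\<Phi> \<circ> h\<close> is a disc automorphism, and composing \<open>\<Phi>\<close> with its
inverse gives a left inverse of \<open>h\<close>.\<close>

lemma geodesic_param_of_extremal:
  assumes h: "analytic_disc h" and F: "\<Phi> holomorphic2_on G" "\<Phi> ` G \<subseteq> unit_disc"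
    and ext: "norm (deriv (\<lambda>z. \<Phi> (h z)) 0) = 1 - (norm (\<Phi> (h 0)))^2"
  shows "geodesic_param h"
proof -
  have hc: "holomorphic_curve_on h unit_disc" "h ` unit_disc \<subseteq> G"
    using h by (auto simp: analytic_disc_def)
  have hol: "(\<lambda>z. \<Phi> (h z)) holomorphic_on unit_disc"
    by (rule holomorphic_on_compose_curve(1)[OF hc(1) open_ball F(1) hc(2)])
  have lt: "norm (\<Phi> (h z)) < 1" if "norm z < 1" for z
    using F(2) analytic_disc_mem[OF h that] by auto
  define c where "c = \<Phi> (h 0)"
  have c: "norm c < 1" unfolding c_def by (rule lt) simp
  obtain \<eta> where eta: "norm \<eta> = 1" "\<And>z. norm z < 1 \<Longrightarrow> \<Phi> (h z) = moeb (- c) (\<eta> * z)"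
    using schwarz_pick_at_0(2)[OF hol lt ext] unfolding c_def by blast
  have ee: "cnj \<eta> * \<eta> = 1" using eta(1) of_real_norm_squared[of \<eta>] by (simp add: mult.commute)
  define \<Psi> where "\<Psi> x = cnj \<eta> * moeb c (\<Phi> x)" for x
  have "\<Psi> holomorphic2_on G"
    unfolding \<Psi>_def[abs_def]
    by (rule holomorphic_on_compose_holomorphic2[OF F(1), of "\<lambda>z. cnj \<eta> * moeb c z" unit_disc])
       (use F(2) moeb_holomorphic[OF c] in \<open>auto intro!: holomorphic_intros\<close>)
  moreover have "\<Psi> ` G \<subseteq> unit_disc"
    using F(2) moeb_lt_1[OF c] eta(1) by (auto simp: \<Psi>_def norm_mult)
  moreover have "\<Psi> (h z) = z" if z: "norm z < 1" for z
  proof -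
    have "norm (\<eta> * z) < 1" using z eta(1) by (simp add: norm_mult)
    then have "\<Psi> (h z) = cnj \<eta> * (\<eta> * z)" using eta(2)[OF z] c by (simp add: \<Psi>_def)
    then show ?thesis using ee by (simp add: mult.assoc[symmetric])
  qed
  ultimately show ?thesis using hc unfolding geodesic_param_def by (metis mem_ball_0)
qed

text \<open>A left inverse of \<open>h\<close> maps the velocity of \<open>k\<close> to \<open>c\<close>, which the Schwarz lemma bounds: in its own direction
a geodesic is the fastest disc.\<close>

lemma geodesic_param_maximal_velocity:
  assumes h: "geodesic_param h" and k: "analytic_disc k" "k 0 = h 0"
    and v: "curve_deriv k 0 = cscale c (curve_deriv h 0)"
  shows "norm c \<le> 1"
proof -
  have hc: "holomorphic_curve_on h unit_disc" "h ` unit_disc \<subseteq> G"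
   and kc: "holomorphic_curve_on k unit_disc" "k ` unit_disc \<subseteq> G"
    using h k by (auto simp: analytic_disc_def geodesic_param_def)
  obtain \<Phi> where F: "\<Phi> holomorphic2_on G" "\<Phi> ` G \<subseteq> unit_disc"
     and inv: "\<And>z. norm z < 1 \<Longrightarrow> \<Phi> (h z) = z"
    using h unfolding geodesic_param_def by auto
  have h0: "h 0 \<in> G" using hc by auto
  obtain f' where f': "(\<Phi> has_derivative f') (at (h 0))" "\<And>c v. f' (cscale c v) = c * f' v"
    using holomorphic2_onD[OF F(1) h0] by blast
  have "((\<lambda>z. z) has_field_derivative 1) (at 0)" by simp
  then have "((\<lambda>z. \<Phi> (h z)) has_field_derivative 1) (at 0)"
    by (rule has_field_derivative_transform_within_open[of _ _ _ "unit_disc"]) (use inv in auto)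
  then have "f' (curve_deriv h 0) = 1"
    using holomorphic_on_compose_curve(2)[OF hc(1) open_ball F(1) hc(2) _ f'(1)]
    by (simp add: DERIV_imp_deriv)
  then have "deriv (\<lambda>z. \<Phi> (k z)) 0 = c"
    using holomorphic_on_compose_curve(2)[OF kc(1) open_ball F(1) kc(2), of 0 f'] f' k v by simp
  moreover have "norm (deriv (\<lambda>z. \<Phi> (k z)) 0) \<le> 1 - (norm (\<Phi> (k 0)))^2"
    by (rule schwarz_pick_at_0(1)[OF holomorphic_on_compose_curve(1)[OF kc(1) open_ball F(1) kc(2)]])
       (use F(2) analytic_disc_mem[OF k(1)] in \<open>auto simp: image_subset_iff\<close>)
  ultimately show ?thesis
    by (smt (verit) zero_le_power2)
qed

section \<open>The geodesics orthogonal to the central flat geodesic\<close>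

lemma geodesic_param_reparam:
  assumes h: "geodesic_param h" and a: "norm a < 1"
  shows "geodesic_param (\<lambda>z. h (moeb (- a) z))"
    and "(\<lambda>z. h (moeb (- a) z)) ` unit_disc = h ` unit_disc"
    and "curve_deriv (\<lambda>z. h (moeb (- a) z)) 0 = cscale (1 - a * cnj a) (curve_deriv h a)"
proof -
  have a': "norm (- a) < 1" using a by simp
  have mi: "moeb (- a) ` unit_disc \<subseteq> unit_disc" using moeb_lt_1[OF a'] by auto
  note r = analytic_disc_reparam[OF geodesic_param_disc[OF h] moeb_holomorphic[OF a'] mi]
  obtain \<Phi> where F: "\<Phi> holomorphic2_on G" "\<Phi> ` G \<subseteq> unit_disc"
     and inv: "\<And>z. norm z < 1 \<Longrightarrow> \<Phi> (h z) = z"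
    using h unfolding geodesic_param_def by auto
  have "(\<lambda>x. moeb a (\<Phi> x)) holomorphic2_on G"
    by (rule holomorphic_on_compose_holomorphic2[OF F(1) moeb_holomorphic[OF a] open_ball F(2)])
  moreover have "(\<lambda>x. moeb a (\<Phi> x)) ` G \<subseteq> unit_disc"
    using F(2) moeb_lt_1[OF a] by (auto simp: image_subset_iff)
  moreover have "\<forall>z\<in>unit_disc. moeb a (\<Phi> (h (moeb (- a) z))) = z"
    using inv moeb_lt_1[OF a'] a by simp
  ultimately show "geodesic_param (\<lambda>z. h (moeb (- a) z))"
    using r(1) unfolding geodesic_param_def analytic_disc_def
    by (intro conjI exI[of _ "\<lambda>x. moeb a (\<Phi> x)"]) simp_all
  have "moeb (- a) ` unit_disc = unit_disc"
  proof
    show "unit_disc \<subseteq> moeb (- a) ` unit_disc"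
    proof
      fix z :: complex assume "z \<in> unit_disc"
      then have "z = moeb (- a) (moeb a z)" "moeb a z \<in> unit_disc"
        using a moeb_lt_1[OF a] by auto
      then show "z \<in> moeb (- a) ` unit_disc" by blast
    qed
  qed (rule mi)
  then show "(\<lambda>z. h (moeb (- a) z)) ` unit_disc = h ` unit_disc"
    by (metis image_image)
  have "deriv (moeb (- a)) 0 = 1 - a * cnj a"
    using moeb_field_derivative[OF a', of 0] by (simp add: DERIV_imp_deriv)
  moreover have "moeb (- a) 0 = a" by (simp add: moeb_def)
  ultimately show "curve_deriv (\<lambda>z. h (moeb (- a) z)) 0 = cscale (1 - a * cnj a) (curve_deriv h a)"
    using r(2)[of 0] by simp
qed

lemma curve_deriv_cong:
  assumes "open U" "z \<in> U" "\<And>w. w \<in> U \<Longrightarrow> h w = k w"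
  shows "curve_deriv h z = curve_deriv k z"
proof -
  have "\<forall>\<^sub>F w in nhds z. h w = k w"
    using assms by (auto simp: eventually_nhds)
  then show ?thesis
    unfolding curve_deriv_def
    by (auto intro!: deriv_cong_ev elim: eventually_mono)
qed

text \<open>Otherwise \<open>h\<close> is its own competitor with \<open>c = 2\<close> in \<open>geodesic_param_maximal_velocity\<close>.\<close>

lemma geodesic_velocity_nz:
  assumes "geodesic_param h" "norm z < 1"
  shows "curve_deriv h z \<noteq> 0"
proof
  assume 0: "curve_deriv h z = 0"
  have "curve_deriv (\<lambda>w. h (moeb (- z) w)) 0 = 0"
    using geodesic_param_reparam(3)[OF assms] 0 by simp
  then have "norm (2::complex) \<le> 1"
    using geodesic_param_reparam(1)[OF assms] 
    by (intro geodesic_param_maximal_velocity[of "\<lambda>w. h (moeb (- z) w)" "\<lambda>w. h (moeb (- z) w)"])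
       (simp_all add: geodesic_param_disc)
  then show False by simp
qed

text \<open>If \<open>h\<close> and \<open>k\<close> parametrize the same geodesic and \<open>\<Phi>\<close> is a left inverse of \<open>k\<close>, then \<open>h = k \<circ> (\<Phi> \<circ> h)\<close>; so the
velocities of all parametrizations span a single line.\<close>

lemma geodesic_tangent_eq:
  assumes k: "geodesic_param k" and w: "norm w < 1"
  shows "geodesic_tangent (k ` unit_disc) (k w) = range (\<lambda>c. cscale c (curve_deriv k w))"
proof
  show "range (\<lambda>c. cscale c (curve_deriv k w)) \<subseteq> geodesic_tangent (k ` unit_disc) (k w)"
    using k w unfolding geodesic_tangent_def by fastforce
  show "geodesic_tangent (k ` unit_disc) (k w) \<subseteq> range (\<lambda>c. cscale c (curve_deriv k w))"
  proof
    fix v assume "v \<in> geodesic_tangent (k ` unit_disc) (k w)"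
    then obtain c h z where h: "v = cscale c (curve_deriv h z)" "geodesic_param h"
      "k ` unit_disc = h ` unit_disc" "norm z < 1" "h z = k w"
      unfolding geodesic_tangent_def by auto
    obtain \<Phi> where F: "\<Phi> holomorphic2_on G" "\<Phi> ` G \<subseteq> unit_disc"
       and inv: "\<And>z. norm z < 1 \<Longrightarrow> \<Phi> (k z) = z"
      using k unfolding geodesic_param_def by auto
    have hc: "holomorphic_curve_on h unit_disc" "h ` unit_disc \<subseteq> G"
      using h(2) by (auto simp: geodesic_param_def)
    define g where "g z = \<Phi> (h z)" for z
    have g: "g holomorphic_on unit_disc" "g ` unit_disc \<subseteq> unit_disc"
      unfolding g_def[abs_def]
      using holomorphic_on_compose_curve(1)[OF hc(1) open_ball F(1) hc(2)] F(2) hc(2)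
      by (auto simp: image_subset_iff)
    have eq: "h u = k (g u)" if "u \<in> unit_disc" for u
    proof -
      have "h u \<in> k ` unit_disc" using that h(3) by blast
      then obtain u' where "norm u' < 1" "h u = k u'" by auto
      then show ?thesis using inv by (simp add: g_def)
    qed
    have "curve_deriv h z = curve_deriv (\<lambda>u. k (g u)) z"
      by (rule curve_deriv_cong[of unit_disc]) (use h(4) eq in auto)
    also have "\<dots> = cscale (deriv g z) (curve_deriv k (g z))"
      by (rule analytic_disc_reparam(2)[OF geodesic_param_disc[OF k] g h(4)])
    also have "g z = w" using h(5) inv[OF w] by (simp add: g_def)
    finally show "v \<in> range (\<lambda>c. cscale c (curve_deriv k w))" using h(1) by simp
  qed
qed

text \<open>The geodesic through \<open>(0, q)\<close> that is orthogonal to the central flat geodesic. For \<open>q = 0\<close> it is the royal variety;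
for \<open>q \<noteq> 0\<close> it avoids the royal variety and lifts to the bidisc (\<open>leaf_roots\<close>).\<close>

definition leaf :: "complex \<Rightarrow> complex \<Rightarrow> complex \<times> complex" where
  "leaf q z = (2 * of_real (1 - norm q) * z / (1 + cnj q * z^2), (z^2 + q) / (1 + cnj q * z^2))"

lemma leaf_roots:
  assumes c: "norm c < 1" "c^2 = - q" and z: "norm z \<le> 1"
  shows "leaf q z = (moeb (- c) z + moeb c z, moeb (- c) z * moeb c z)"
proof -
  have nz: "1 + cnj c * z \<noteq> 0" "1 - cnj c * z \<noteq> 0"
    using moeb_denominator_nz[of "- c" z] moeb_denominator_nz[of c z] c z by auto
  have "q = - (c * c)" using c by (simp add: power2_eq_square)
  then have q: "q = - (c * c)" "cnj q = - (cnj c * cnj c)" by simp_all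
  have "norm q = (norm c)^2" using c(2) by (metis norm_minus_cancel norm_power)
  then have r: "complex_of_real (1 - norm q) = 1 - c * cnj c"
    by (simp only: of_real_one_minus_norm_squared)
  have den: "1 + cnj q * z^2 = (1 + cnj c * z) * (1 - cnj c * z)"
    by (simp add: q algebra_simps power2_eq_square)
  have "2 * (1 - c * cnj c) * z = (z + c) * (1 - cnj c * z) + (z - c) * (1 + cnj c * z)"
    by (simp add: algebra_simps)
  moreover have "z^2 + q = (z + c) * (z - c)" by (simp add: q algebra_simps power2_eq_square)
  ultimately show ?thesis
    unfolding leaf_def r den moeb_def using nz by (simp add: add_frac_eq)
qed

lemma square_root_in_disc:
  assumes "norm q < 1"
  obtains c :: complex where "norm c < 1" "c^2 = - q"
proof
  show "(csqrt (- q))^2 = - q" by simp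
  then have "(norm (csqrt (- q)))^2 = norm q" by (metis norm_minus_cancel norm_power)
  then show "norm (csqrt (- q)) < 1" using assms by (metis abs_square_less_1 abs_norm_cancel)
qed

lemma leaf_analytic_disc:
  assumes q: "norm q < 1"
  shows "analytic_disc (leaf q)" "leaf q 0 = (0, q)"
    "curve_deriv (leaf q) 0 = (of_real (2 * (1 - norm q)), 0)"
proof -
  obtain c where c: "norm c < 1" "c^2 = - q" using square_root_in_disc[OF q] by blast
  have nz: "1 + cnj q * z^2 \<noteq> 0" if "norm z < 1" for z
    using moeb_denominator_nz[of "- q" "z^2"] q that by (simp add: norm_power power_le_one)
  have "holomorphic_curve_on (leaf q) unit_disc"
    unfolding holomorphic_curve_on_def leaf_def fst_conv snd_conv
    using nz by (auto intro!: holomorphic_intros)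
  moreover have "leaf q z \<in> G" if z: "norm z < 1" for z
    using leaf_roots[OF c, of z] moeb_lt_1[OF c(1) z] moeb_lt_1[of "- c" z] c(1) z
    unfolding mem_sym_bidisc by (metis less_imp_le norm_minus_cancel)
  ultimately show "analytic_disc (leaf q)" by (auto simp: analytic_disc_def)
  show "leaf q 0 = (0, q)" by (simp add: leaf_def)
  have d: "((\<lambda>z. 1 + cnj q * z^2) has_field_derivative 0) (at 0)"
    by (auto intro!: derivative_eq_intros)
  have n1: "((\<lambda>z. 2 * of_real (1 - norm q) * z) has_field_derivative 2 * of_real (1 - norm q)) (at 0)"
    by (auto intro!: derivative_eq_intros)
  have n2: "((\<lambda>z. z^2 + q) has_field_derivative 0) (at 0)"
    by (auto intro!: derivative_eq_intros)
  have nz0: "1 + cnj q * 0^2 \<noteq> 0" by simp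
  show "curve_deriv (leaf q) 0 = (of_real (2 * (1 - norm q)), 0)"
    unfolding curve_deriv_def leaf_def fst_conv snd_conv
    using DERIV_divide[OF n1 d nz0] DERIV_divide[OF n2 d nz0]
    by (simp add: DERIV_imp_deriv)
qed

text \<open>At \<open>(0, q)\<close> the function \<open>Phi \<omega>\<close> stretches the direction \<open>(1, 0)\<close> by \<open>|1 - \<omega>^2 q| / 2\<close>, which is largest for this
choice of \<open>\<omega>\<close>; with \<open>\<omega>\<close> also \<open>- \<omega>\<close> is extremal.\<close>

lemma extremal_multiplier:
  obtains \<omega> :: complex where "norm \<omega> = 1" "\<omega>^2 * q = - of_real (norm q)"
proof (cases "q = 0")
  case True
  then show thesis using that[of 1] by simp
next
  case False
  let ?w = "csqrt (- of_real (norm q) / q)"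
  have w2: "?w^2 = - of_real (norm q) / q" by simp
  then have "(norm ?w)^2 = 1" using False by (simp add: norm_divide flip: norm_power)
  then have "norm ?w = 1" by (metis norm_ge_zero power2_eq_1_iff power_one pos_le_minus_divide_eq abs_norm_cancel abs_1 real_sqrt_abs real_sqrt_one)
  then show thesis using that[of ?w] False by simp
qed

lemma leaf_geodesic_param:
  assumes q: "norm q < 1"
  shows "geodesic_param (leaf q)"
proof -
  obtain \<omega> where w: "norm \<omega> = 1" "\<omega>^2 * q = - of_real (norm q)" by (rule extremal_multiplier)
  note d = leaf_analytic_disc[OF q]
  note P = Phi_along_disc[OF d(1,2) w(1)]
  show ?thesis
  proof (rule geodesic_param_of_extremal[OF d(1) Phi_holomorphic[OF w(1)]])
    show "Phi \<omega> ` G \<subseteq> unit_disc" using Phi_lt_1[OF w(1)] by auto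
    have "deriv (\<lambda>z. Phi \<omega> (leaf q z)) 0 = of_real (- (1 - (norm q)^2))"
      unfolding P(4) d(3) w(2) by (simp add: field_simps power2_eq_square)
    then have "norm (deriv (\<lambda>z. Phi \<omega> (leaf q z)) 0) = \<bar>- (1 - (norm q)^2)\<bar>"
      by (simp only: norm_of_real)
    also have "\<dots> = 1 - (norm q)^2" using q by (simp add: power_le_one)
    also have "\<dots> = 1 - (norm (Phi \<omega> (leaf q 0)))^2" using P(3) w(1) by (simp add: norm_mult)
    finally show "norm (deriv (\<lambda>z. Phi \<omega> (leaf q z)) 0) = 1 - (norm (Phi \<omega> (leaf q 0)))^2" .
  qed
qed

lemma rotation_disc_image:
  assumes "norm \<eta> = 1"
  shows "(\<lambda>z. \<eta> * z) ` unit_disc = unit_disc"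
proof
  show "unit_disc \<subseteq> (\<lambda>z. \<eta> * z) ` unit_disc"
  proof
    fix z assume "z \<in> unit_disc"
    then have "z = \<eta> * (z / \<eta>)" "z / \<eta> \<in> unit_disc" using assms by (auto simp: norm_divide)
    then show "z \<in> (\<lambda>z. \<eta> * z) ` unit_disc" by blast
  qed
qed (use assms in \<open>auto simp: norm_mult\<close>)

text \<open>Comparison with the leaf and the bound from \<open>Phi \<omega>\<close> determine \<open>norm \<sigma>\<close>. Up to a rotation \<open>\<eta>\<close> of the disc, \<open>h\<close>
and the leaf therefore have the same velocity, and it is extremal for both \<open>Phi \<omega>\<close> and \<open>Phi (- \<omega>)\<close>. These two
functions hence agree along \<open>h\<close> and the leaf, and they separate points.\<close>

lemma horizontal_geodesic_centered:
  assumes h: "geodesic_param h" "h 0 = (0, q)" and v: "curve_deriv h 0 = (\<sigma>, 0)"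
  shows "h ` unit_disc = leaf q ` unit_disc"
proof -
  have hd: "analytic_disc h" using h geodesic_param_disc by blast
  have q: "norm q < 1" using analytic_disc_mem[OF hd, of 0] h(2) by simp
  note d = leaf_analytic_disc[OF q]
  obtain \<omega> where w: "norm \<omega> = 1" "\<omega>^2 * q = - of_real (norm q)" by (rule extremal_multiplier)
  \<comment> \<open>lower bound by comparison with the leaf, upper bound from \<open>Phi \<omega>\<close>\<close>
  have s0: "\<sigma> \<noteq> 0" using geodesic_velocity_nz[OF h(1), of 0] v by (auto simp: zero_prod_def)
  have "norm (of_real (2 * (1 - norm q)) / \<sigma>) \<le> 1"
    by (rule geodesic_param_maximal_velocity[OF h(1) d(1)]) (use d h v s0 in simp_all)
  then have lo: "2 * (1 - norm q) \<le> norm \<sigma>"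
    using s0 q by (simp add: norm_divide divide_le_eq del: of_real_diff of_real_mult)
  have eq1: "(\<omega>^2 * q - 1) / 2 * \<sigma> = of_real (- ((1 + norm q) / 2)) * \<sigma>"
    unfolding w(2) by (simp add: field_simps)
  have "norm ((\<omega>^2 * q - 1) / 2 * \<sigma>) \<le> 1 - (norm q)^2"
    using disc_velocity_bound[OF hd h(2) w(1)] v by simp
  moreover have "norm ((\<omega>^2 * q - 1) / 2 * \<sigma>) = (1 + norm q) / 2 * norm \<sigma>"
  proof -
    have "norm ((\<omega>^2 * q - 1) / 2 * \<sigma>) = \<bar>- ((1 + norm q) / 2)\<bar> * norm \<sigma>"
      by (simp only: eq1 norm_mult norm_of_real)
    also have "\<bar>- ((1 + norm q) / 2)\<bar> = (1 + norm q) / 2" by simp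
    finally show ?thesis .
  qed
  ultimately have "(1 + norm q) * norm \<sigma> \<le> 2 * (1 - (norm q)^2)" by simp
  then have "(1 + norm q) * norm \<sigma> \<le> (1 + norm q) * (2 * (1 - norm q))"
    by (simp add: algebra_simps power2_eq_square)
  moreover have "0 < 1 + norm q" by (simp add: add_pos_nonneg)
  ultimately have hi: "norm \<sigma> \<le> 2 * (1 - norm q)" by (metis mult_le_cancel_left_pos)
  define \<eta> where "\<eta> = \<sigma> / of_real (2 * (1 - norm q))"
  have r: "2 * (1 - norm q) > 0" using q by simp
  have eta: "norm \<eta> = 1" using lo hi r unfolding \<eta>_def norm_divide norm_of_real by simp
  have sg: "\<sigma> = \<eta> * of_real (2 * (1 - norm q))"
    unfolding \<eta>_def using r by (metis less_irrefl nonzero_divide_eq_eq of_real_eq_0_iff)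
  have *: "Phi w (h z) = Phi w (leaf q (\<eta> * z))"
    if w: "norm w = 1" "w^2 * q = - of_real (norm q)" and z: "norm z < 1" for w z
  proof -
    note P = Phi_along_disc[OF hd h(2) w(1)] and Q = Phi_along_disc[OF d(1,2) w(1)]
    define m where "m = (w^2 * q - 1) / 2"
    have m: "m = of_real (- ((1 + norm q) / 2))" unfolding m_def w(2) by (simp add: field_simps)
    have dP: "deriv (\<lambda>z. Phi w (h z)) 0 = m * \<sigma>" using P(4) v by (simp add: m_def)
    have dQ: "deriv (\<lambda>z. Phi w (leaf q z)) 0 = m * of_real (2 * (1 - norm q))"
      using Q(4) d(3) by (simp add: m_def)
    have nm: "norm (m * of_real (2 * (1 - norm q))) = 1 - (norm q)^2"
    proof -
      have "norm (m * of_real (2 * (1 - norm q))) = \<bar>- ((1 + norm q) / 2)\<bar> * \<bar>2 * (1 - norm q)\<bar>"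
        by (simp only: m norm_mult norm_of_real)
      also have "\<dots> = (1 + norm q) / 2 * (2 * (1 - norm q))" using r by simp
      also have "\<dots> = 1 - (norm q)^2" by (simp add: field_simps power2_eq_square)
      finally show ?thesis .
    qed
    have nwq: "norm (w * q) = norm q" using w by (simp add: norm_mult)
    let ?R = "of_real (1 - (norm (w * q))^2) :: complex"
    have "\<eta> * z \<in> unit_disc" using z eta by (simp add: norm_mult)
    then have 1: "Phi w (leaf q (\<eta> * z)) = moeb (- (w * q)) (m * of_real (2 * (1 - norm q)) / ?R * (\<eta> * z))"
      using schwarz_pick_at_0(2)[OF Q(1,2)] Q(3) unfolding dQ Q(3) nm nwq by simp
    have "norm (m * \<sigma>) = 1 - (norm q)^2"
      using nm eta unfolding sg by (simp add: norm_mult del: of_real_diff of_real_mult)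
    then have 2: "Phi w (h z) = moeb (- (w * q)) (m * \<sigma> / ?R * z)"
      using schwarz_pick_at_0(2)[OF P(1,2)] z unfolding dP P(3) nwq by simp
    show ?thesis unfolding 1 2 sg by (simp add: mult_ac)
  qed
  have "h z = leaf q (\<eta> * z)" if z: "norm z < 1" for z
  proof (rule Phi_pair_inj[OF w(1)])
    show "h z \<in> G" using analytic_disc_mem[OF hd z] .
    show "leaf q (\<eta> * z) \<in> G" by (rule analytic_disc_mem[OF d(1)]) (use z eta in \<open>simp add: norm_mult\<close>)
    show "Phi \<omega> (h z) = Phi \<omega> (leaf q (\<eta> * z))" by (rule *[OF w z])
    show "Phi (- \<omega>) (h z) = Phi (- \<omega>) (leaf q (\<eta> * z))" by (rule *[OF _ _ z]) (use w in simp_all)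
  qed
  then have "h ` unit_disc = leaf q ` ((\<lambda>z. \<eta> * z) ` unit_disc)"
    by (auto simp: image_iff)
  then show ?thesis using rotation_disc_image[OF eta] by simp
qed

lemma horizontal_geodesic_unique:
  assumes D: "geodesic D" "(0, q) \<in> D" and t: "geodesic_tangent D (0, q) \<subseteq> range (\<lambda>c. cscale c (1, 0))"
  shows "D = leaf q ` unit_disc"
proof -
  obtain h where h: "geodesic_param h" "D = h ` unit_disc" using D by (auto simp: geodesic_def)
  obtain z where z: "norm z < 1" "h z = (0, q)" using D h by auto
  have "curve_deriv h z \<in> geodesic_tangent D (0, q)"
    unfolding h(2) z(2)[symmetric] geodesic_tangent_eq[OF h(1) z(1)]
    by (rule image_eqI[of _ _ 1]) simp_all
  then obtain c where c: "curve_deriv h z = (c, 0)" using t by auto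
  show ?thesis
    unfolding h(2) geodesic_param_reparam(2)[OF h(1) z(1), symmetric]
    by (rule horizontal_geodesic_centered[OF geodesic_param_reparam(1)[OF h(1) z(1)]])
       (use z c geodesic_param_reparam(3)[OF h(1) z(1)] in \<open>simp_all add: moeb_def\<close>)
qed

lemma leaf_tangent:
  assumes q: "norm q < 1"
  shows "geodesic_tangent (leaf q ` unit_disc) (0, q) = range (\<lambda>c. cscale c (1, 0))"
proof -
  note d = leaf_analytic_disc[OF q]
  have "geodesic_tangent (leaf q ` unit_disc) (0, q) =
      range (\<lambda>c. cscale c (of_real (2 * (1 - norm q)), 0))"
    using geodesic_tangent_eq[OF leaf_geodesic_param[OF q], of 0] d by simp
  also have "\<dots> = range (\<lambda>c. cscale c (1, 0))"
  proof
    show "range (\<lambda>c. cscale c (1, 0)) \<subseteq> range (\<lambda>c. cscale c (of_real (2 * (1 - norm q)), 0))"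
    proof (rule image_subsetI)
      fix c :: complex
      have "2 * (1 - norm q) \<noteq> 0" using q by simp
      then have nz: "complex_of_real (2 * (1 - norm q)) \<noteq> 0" by (metis of_real_eq_0_iff)
      have "cscale c (1, 0) = cscale (c / of_real (2 * (1 - norm q))) (of_real (2 * (1 - norm q)), 0)"
        using nz by (simp del: of_real_mult of_real_diff)
      then show "cscale c (1, 0) \<in> range (\<lambda>c. cscale c (of_real (2 * (1 - norm q)), 0))"
        by (rule range_eqI)
    qed
  qed auto
  finally show ?thesis .
qed

lemma one_plus_norm_squared_nz: "1 + c * cnj c \<noteq> (0::complex)"
proof -
  have "1 + c * cnj c = of_real (1 + (norm c)^2)"
    by (simp only: of_real_add of_real_1 complex_norm_square)
  moreover have "1 + (norm c)^2 \<noteq> 0" using zero_le_power2[of "norm c"] by linarith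
  ultimately show ?thesis by (metis of_real_eq_0_iff)
qed

text \<open>After division by \<open>1 + |c|^2\<close> the equation on the right expresses that \<open>b = 2 c / (1 + |c|^2)\<close> is the flat coordinate of
the point \<open>(z - w, - z * w)\<close>, whose roots are \<open>z\<close> and \<open>- w\<close>.\<close>

lemma moeb_pair_equation:
  assumes "norm c < 1" "norm z < 1" "norm w < 1"
  shows "moeb c z = moeb (- c) w \<longleftrightarrow> (z - w) * (1 + c * cnj c) = 2 * c - 2 * cnj c * (z * w)"
proof -
  have nz: "1 + cnj c * w \<noteq> 0" "1 - cnj c * z \<noteq> 0"
    using moeb_denominator_nz[of "- c" w] moeb_denominator_nz[of c z] assms by auto
  have "moeb c z = moeb (- c) w \<longleftrightarrow> (z - c) * (1 + cnj c * w) = (w + c) * (1 - cnj c * z)"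
    unfolding moeb_def using nz by (simp add: frac_eq_eq)
  also have "\<dots> \<longleftrightarrow> (z - c) * (1 + cnj c * w) - (w + c) * (1 - cnj c * z) = 0" by simp
  also have "(z - c) * (1 + cnj c * w) - (w + c) * (1 - cnj c * z) =
      (z - w) * (1 + c * cnj c) - (2 * c - 2 * cnj c * (z * w))"
    by (simp add: algebra_simps)
  finally show ?thesis by simp
qed

text \<open>The flat coordinate \<open>b\<close> of the point with roots \<open>z\<close> and \<open>- w\<close> lies in the disc, and its hyperbolic midpoint \<open>c\<close> is the
parameter of the leaf, with \<open>q = - c^2\<close>.\<close>

lemma leaf_covers:
  assumes "x \<in> G"
  obtains q where "norm q < 1" "x \<in> leaf q ` unit_disc"
proof -
  obtain z w where zw: "norm z < 1" "norm w < 1" "x = (z + w, z * w)"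
    using assms unfolding mem_sym_bidisc by blast
  have "(z + (- w), z * (- w)) \<in> G"
    unfolding mem_sym_bidisc using zw by (metis norm_minus_cancel)
  then obtain b where b: "norm b < 1" "z + (- w) = b + cnj b * (z * (- w))"
    by (rule sym_bidisc_flat_coordinate)
  obtain c where c: "norm c < 1" "b * (1 + c * cnj c) = 2 * c"
    using hyperbolic_midpoint_exists[OF b(1)] by blast
  have "cnj (b * (1 + c * cnj c)) = cnj (2 * c)" using c by simp
  then have c': "cnj b * (1 + c * cnj c) = 2 * cnj c" by (simp add: mult.commute)
  have "(z - w) * (1 + c * cnj c) = (b + cnj b * (z * (- w))) * (1 + c * cnj c)" using b(2) by simp
  also have "\<dots> = b * (1 + c * cnj c) - cnj b * (1 + c * cnj c) * (z * w)"
    by (simp add: algebra_simps)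
  also have "\<dots> = 2 * c - 2 * cnj c * (z * w)" unfolding c c' by simp
  finally have eq: "moeb c z = moeb (- c) w" using moeb_pair_equation[OF c(1) zw(1,2)] by blast
  define u where "u = moeb c z"
  have u: "norm u < 1" "moeb (- c) u = z" "moeb c u = w"
    unfolding u_def using moeb_lt_1[OF c(1) zw(1)] moeb_inverse[OF c(1) zw(1)]
      moeb_inverse[OF c(1) zw(2)] by (simp_all only: eq)
  have "norm (- (c^2)) < 1" using c(1) by (simp add: norm_power power_less_one_iff)
  moreover have "x = leaf (- (c^2)) u"
    using leaf_roots[OF c(1), of "- (c^2)" u] u zw by simp
  ultimately show thesis using that u(1) by (metis image_eqI mem_ball_0)
qed

text \<open>The flat coordinate and the midpoint are unique, so \<open>c\<close> is determined by the ordered pair of roots. The two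
orderings give \<open>c\<close> and \<open>- c\<close>, hence the same \<open>q\<close>.\<close>

lemma leaf_disjoint:
  assumes "norm q < 1" "norm q' < 1" "x \<in> leaf q ` unit_disc" "x \<in> leaf q' ` unit_disc"
  shows "q = q'"
proof -
  have *: "\<exists>c z w. c^2 = - q \<and> norm c < 1 \<and> norm z < 1 \<and> norm w < 1 \<and> x = (z + w, z * w) \<and>
       (z - w) * (1 + c * cnj c) = 2 * c - 2 * cnj c * (z * w)"
    if q: "norm q < 1" and x: "x \<in> leaf q ` unit_disc" for q
  proof -
    obtain c where c: "norm c < 1" "c^2 = - q" using square_root_in_disc[OF q] by blast
    obtain u where u: "norm u < 1" "x = leaf q u" using x by auto
    have zw: "norm (moeb (- c) u) < 1" "norm (moeb c u) < 1"
      using moeb_lt_1[OF _ u(1)] c by auto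
    have "moeb c (moeb (- c) u) = moeb (- c) (moeb c u)" using c u by simp
    then have "(moeb (- c) u - moeb c u) * (1 + c * cnj c) =
        2 * c - 2 * cnj c * (moeb (- c) u * moeb c u)"
      using moeb_pair_equation[OF c(1) zw] by blast
    then show ?thesis using leaf_roots[OF c, of u] u zw c by (metis less_imp_le)
  qed
  have uniq: "c = d" if "norm c < 1" "norm d < 1" "norm z < 1" "norm w < 1"
      "(z - w) * (1 + c * cnj c) = 2 * c - 2 * cnj c * (z * w)"
      "(z - w) * (1 + d * cnj d) = 2 * d - 2 * cnj d * (z * w)" for c d z w
  proof -
    have aff: "z - w = b + cnj b * (- (z * w)) \<and> b * (1 + c * cnj c) = 2 * c"
      if "norm c < 1" "(z - w) * (1 + c * cnj c) = 2 * c - 2 * cnj c * (z * w)"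
         "b = 2 * c / (1 + c * cnj c)" for b c
    proof -
      have nz: "1 + c * cnj c \<noteq> 0"
        by (rule one_plus_norm_squared_nz)
      have bm: "b * (1 + c * cnj c) = 2 * c" using that(3) nz by simp
      then have "cnj (b * (1 + c * cnj c)) = cnj (2 * c)" by simp
      then have cb: "cnj b * (1 + c * cnj c) = 2 * cnj c" by (simp add: mult.commute)
      have "(b + cnj b * (- (z * w))) * (1 + c * cnj c) =
          b * (1 + c * cnj c) - cnj b * (1 + c * cnj c) * (z * w)" by (simp add: algebra_simps)
      also have "\<dots> = (z - w) * (1 + c * cnj c)" unfolding bm cb that(2) ..
      finally have "z - w = b + cnj b * (- (z * w))" using nz by (metis mult_right_cancel)
      then show ?thesis using bm by blast
    qed
    have zw: "norm (- (z * w)) < 1"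
      using that by (simp add: norm_mult) (metis mult_strict_mono' norm_ge_zero mult_1)
    define b where "b = 2 * c / (1 + c * cnj c)"
    define e where "e = 2 * d / (1 + d * cnj d)"
    note B = aff[OF that(1,5) b_def] and E = aff[OF that(2,6) e_def]
    have "b = e" using conj_affine_inj[OF _ zw, of b e] B E by metis
    have "2 * (c * (1 + d * cnj d)) = b * (1 + c * cnj c) * (1 + d * cnj d)" using B by simp
    also have "\<dots> = e * (1 + d * cnj d) * (1 + c * cnj c)" unfolding \<open>b = e\<close> by (simp only: mult_ac)
    also have "\<dots> = 2 * (d * (1 + c * cnj c))" using E by simp
    finally have "c * (1 + d * cnj d) = d * (1 + c * cnj c)" by simp
    then show "c = d" using hyperbolic_midpoint_unique that(1,2) by blast
  qed
  obtain c z w where c: "c^2 = - q" "norm c < 1" "norm z < 1" "norm w < 1" "x = (z + w, z * w)"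
      "(z - w) * (1 + c * cnj c) = 2 * c - 2 * cnj c * (z * w)"
    using *[OF assms(1,3)] by (elim exE conjE) (rule that)
  obtain d u v where d: "d^2 = - q'" "norm d < 1" "norm u < 1" "norm v < 1" "x = (u + v, u * v)"
      "(u - v) * (1 + d * cnj d) = 2 * d - 2 * cnj d * (u * v)"
    using *[OF assms(2,4)] by (elim exE conjE) (rule that)
  have "u + v = z + w" "u * v = z * w" using c(5) d(5) by (metis fst_conv, metis snd_conv)
  have "(u - z) * (u - w) = u * u - u * (z + w) + z * w" by (simp add: algebra_simps)
  also have "\<dots> = u * u - u * (u + v) + u * v" using \<open>u + v = z + w\<close> \<open>u * v = z * w\<close> by simp
  also have "\<dots> = 0" by (simp add: algebra_simps)
  finally have "(u - z) * (u - w) = 0" .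
  then consider "u = z" "v = w" | "u = w" "v = z"
    using \<open>u + v = z + w\<close> by (metis add.commute add_left_cancel eq_iff_diff_eq_0 mult_eq_0_iff)
  then have "c^2 = d^2"
  proof cases
    case 1
    then show ?thesis using uniq[OF c(2) d(2) c(3,4,6)] d(6) by simp
  next
    case 2
    have "(z - w) * (1 + (- d) * cnj (- d)) = 2 * (- d) - 2 * cnj (- d) * (z * w)"
      using d(6) 2 by (simp add: algebra_simps)
    then have "c = - d" using uniq[of c "- d" z w] c d(2) by simp
    then show ?thesis by simp
  qed
  then show ?thesis using c(1) d(1) by simp
qed

section \<open>Automorphisms preserve the royal variety\<close>

text \<open>Equality in the Schwarz lemma for \<open>p\<close> and for \<open>Phi 1\<close> makes both of them rotations by \<open>b\<close>, and the relation between
them forces \<open>s = 0\<close>.\<close>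

lemma vertical_disc_rigid:
  assumes h: "analytic_disc h" "h 0 = (0, 0)" and b: "curve_deriv h 0 = (a, b)" "norm b = 1"
    and z: "norm z < 1"
  shows "h z = (0, b * z)"
proof -
  have "a = 0" using disc_velocity_bound_origin[OF h] b by simp
  have s: "(\<lambda>z. snd (h z)) holomorphic_on unit_disc"
    using h by (simp add: analytic_disc_def holomorphic_curve_on_def)
  have s1: "norm (snd (h z)) < 1" if "norm z < 1" for z
    using sym_bidisc_snd_lt_1 analytic_disc_mem[OF h(1) that] by blast
  have ds: "deriv (\<lambda>z. snd (h z)) 0 = b" using b(1) by (simp add: curve_deriv_def)
  have p: "snd (h z) = b * z"
    using schwarz_pick_at_0(2)[OF s s1] z h(2) b(2) ds by (simp add: moeb_def)
  note P = Phi_along_disc[OF h norm_one]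
  have dP: "deriv (\<lambda>z. Phi 1 (h z)) 0 = b" using P(4) b \<open>a = 0\<close> by simp
  have "Phi 1 (h z) = b * z"
    using schwarz_pick_at_0(2)[OF P(1,2)] z h(2) b(2) dP P(3) by (simp add: moeb_def)
  then have "2 * (b * z) - fst (h z) = b * z * (2 - fst (h z))"
    using Phi_denominator_nz[OF norm_one analytic_disc_mem[OF h(1) z]] p
    by (simp add: Phi_def divide_eq_eq)
  then have "fst (h z) * (1 - b * z) = 0" by (simp add: algebra_simps)
  moreover have "b * z \<noteq> 1" using b(2) z by (metis norm_mult norm_one mult_1 less_irrefl)
  ultimately have "fst (h z) = 0" by simp
  then show ?thesis using p by (metis prod.collapse)
qed

lemma sum_prod_disc:
  assumes "f holomorphic_on unit_disc" "g holomorphic_on unit_disc"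
    and "\<And>z. norm z < 1 \<Longrightarrow> norm (f z) < 1" "\<And>z. norm z < 1 \<Longrightarrow> norm (g z) < 1"
    and "(f has_field_derivative f') (at 0)" "(g has_field_derivative g') (at 0)"
  shows "analytic_disc (\<lambda>z. (f z + g z, f z * g z))"
    and "curve_deriv (\<lambda>z. (f z + g z, f z * g z)) 0 = (f' + g', f' * g 0 + f 0 * g')"
proof -
  have "(f z + g z, f z * g z) \<in> G" if "norm z < 1" for z
    unfolding mem_sym_bidisc using assms(3,4)[OF that] by blast
  then show "analytic_disc (\<lambda>z. (f z + g z, f z * g z))"
    using assms(1,2) unfolding analytic_disc_def holomorphic_curve_on_def
    by (auto intro!: holomorphic_intros)
  show "curve_deriv (\<lambda>z. (f z + g z, f z * g z)) 0 = (f' + g', f' * g 0 + f 0 * g')"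
    using DERIV_add[OF assms(5,6)] DERIV_mult[OF assms(5,6)]
    by (simp add: curve_deriv_def DERIV_imp_deriv mult.commute)
qed

lemma vertical_disc:
  assumes q: "norm q < 1"
  shows "analytic_disc (\<lambda>z. (0, moeb (- q) z))" "curve_deriv (\<lambda>z. (0, moeb (- q) z)) 0 = (0, 1 - q * cnj q)"
proof -
  have q': "norm (- q) < 1" using q by simp
  show "analytic_disc (\<lambda>z. (0, moeb (- q) z))"
    using moeb_holomorphic[OF q'] moeb_lt_1[OF q']
    by (auto simp: analytic_disc_def holomorphic_curve_on_def)
  show "curve_deriv (\<lambda>z. (0, moeb (- q) z)) 0 = (0, 1 - q * cnj q)"
    using moeb_field_derivative[OF q', of 0] by (simp add: curve_deriv_def DERIV_imp_deriv)
qed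

text \<open>The symmetrization of the bidisc disc with components \<open>moeb (- c) (e1 * z)\<close> and \<open>moeb c (e2 * z)\<close>.\<close>

lemma lifted_disc:
  assumes c: "norm c < 1" and e: "norm e1 = 1" "norm e2 = 1"
  obtains h where "analytic_disc h" "h 0 = (0, - (c^2))"
    "curve_deriv h 0 = ((1 - c * cnj c) * (e1 + e2), (1 - c * cnj c) * (c * (e2 - e1)))"
proof -
  have *: "(\<lambda>z. moeb a (e * z)) holomorphic_on unit_disc \<and>
      (\<forall>z. norm z < 1 \<longrightarrow> norm (moeb a (e * z)) < 1) \<and>
      ((\<lambda>z. moeb a (e * z)) has_field_derivative (1 - a * cnj a) * e) (at 0)"
    if a: "norm a < 1" and e: "norm e = 1" for a e
  proof (intro conjI allI impI)
    have ball: "(\<lambda>z. e * z) ` unit_disc \<subseteq> unit_disc" using e by (auto simp: norm_mult)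
    show "(\<lambda>z. moeb a (e * z)) holomorphic_on unit_disc"
      using holomorphic_on_compose_gen[OF _ moeb_holomorphic[OF a] ball]
      by (auto simp: o_def intro!: holomorphic_intros)
    show "norm (moeb a (e * z)) < 1" if "norm z < 1" for z
      using moeb_lt_1[OF a, of "e * z"] that e by (simp add: norm_mult)
    have "((\<lambda>z. e * z) has_field_derivative e) (at 0)" by (auto intro!: derivative_eq_intros)
    from DERIV_chain2[OF moeb_field_derivative[OF a] this]
    show "((\<lambda>z. moeb a (e * z)) has_field_derivative (1 - a * cnj a) * e) (at 0)" by simp
  qed
  have c': "norm (- c) < 1" using c by simp
  define f where "f z = moeb (- c) (e1 * z)" for z
  define g where "g z = moeb c (e2 * z)" for z
  have f: "f holomorphic_on unit_disc" "\<And>z. norm z < 1 \<Longrightarrow> norm (f z) < 1"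
    "(f has_field_derivative (1 - c * cnj c) * e1) (at 0)"
    using *[OF c' e(1)] by (simp_all add: f_def[abs_def])
  have g: "g holomorphic_on unit_disc" "\<And>z. norm z < 1 \<Longrightarrow> norm (g z) < 1"
    "(g has_field_derivative (1 - c * cnj c) * e2) (at 0)"
    using *[OF c e(2)] by (simp_all add: g_def[abs_def])
  have h: "analytic_disc (\<lambda>z. (f z + g z, f z * g z))"
    "curve_deriv (\<lambda>z. (f z + g z, f z * g z)) 0 =
      ((1 - c * cnj c) * e1 + (1 - c * cnj c) * e2, (1 - c * cnj c) * e1 * g 0 + f 0 * ((1 - c * cnj c) * e2))"
    by (rule sum_prod_disc[OF f(1) g(1) _ _ f(3) g(3)]; use f(2) g(2) in simp)+
  have 0: "f 0 = c" "g 0 = - c" by (simp_all add: f_def g_def moeb_def)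
  show thesis
  proof (rule that[OF h(1)])
    show "(f 0 + g 0, f 0 * g 0) = (0, - (c^2))" by (simp add: 0 power2_eq_square)
    show "curve_deriv (\<lambda>z. (f z + g z, f z * g z)) 0 =
      ((1 - c * cnj c) * (e1 + e2), (1 - c * cnj c) * (c * (e2 - e1)))"
      unfolding h(2) 0 by (simp add: algebra_simps)
  qed
qed

lemma analytic_disc_image:
  assumes h: "analytic_disc h" and f: "holomorphic2_map_on f G" "f ` G \<subseteq> G"
  shows "analytic_disc (\<lambda>z. f (h z))"
    and "(f has_derivative T) (at (h 0)) \<Longrightarrow> curve_deriv (\<lambda>z. f (h z)) 0 = T (curve_deriv h 0)"
proof -
  have hc: "holomorphic_curve_on h unit_disc" "h ` unit_disc \<subseteq> G"
    using h by (auto simp: analytic_disc_def)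
  show "analytic_disc (\<lambda>z. f (h z))"
    using holomorphic_curve_compose_map(1)[OF hc(1) open_ball f(1) hc(2)] hc(2) f(2)
    by (auto simp: analytic_disc_def image_subset_iff)
  show "(f has_derivative T) (at (h 0)) \<Longrightarrow> curve_deriv (\<lambda>z. f (h z)) 0 = T (curve_deriv h 0)"
    by (rule holomorphic_curve_compose_map(2)[OF hc(1) open_ball f(1) hc(2)]) auto
qed

lemma clinear_expand:
  assumes "linear T" "\<And>c v. T (cscale c v) = cscale c (T v)"
  shows "T (a, b) = cscale a (T (1, 0)) + cscale b (T (0, 1))"
proof -
  have "(a, b) = cscale a (1, 0) + cscale b (0, 1)" by simp
  then show ?thesis by (metis assms linear_add)
qed

lemma triangle_equality_split:
  fixes A B :: complex
  assumes "norm A \<le> a" "norm B \<le> b" "a + b \<le> norm (A + B)" "A + B \<noteq> 0"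
  shows "A = of_real (a / norm (A + B)) * (A + B)" "B = of_real (b / norm (A + B)) * (A + B)"
    "a + b = norm (A + B)"
proof -
  have n: "norm (A + B) \<le> norm A + norm B" by (rule norm_triangle_ineq)
  then have ab: "norm A = a" "norm B = b" "norm (A + B) = norm A + norm B" using assms by linarith+
  then have e: "of_real (norm A) * B = of_real (norm B) * A"
    using norm_triangle_eq[of A B] by (simp add: scaleR_conv_of_real)
  have nz: "complex_of_real (norm (A + B)) \<noteq> 0" using assms(4) by simp
  have "of_real (norm A) * (A + B) = A * of_real (norm A + norm B)"
    using e by (simp add: algebra_simps)
  then have "of_real a * (A + B) = A * of_real (norm (A + B))" using ab by metis
  then show "A = of_real (a / norm (A + B)) * (A + B)"
    using nz by (simp add: field_simps)
  have "of_real (norm B) * (A + B) = B * of_real (norm A + norm B)"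
    using e by (simp add: algebra_simps)
  then have "of_real b * (A + B) = B * of_real (norm (A + B))" using ab by metis
  then show "B = of_real (b / norm (A + B)) * (A + B)"
    using nz by (simp add: field_simps)
  show "a + b = norm (A + B)" using ab by simp
qed

text \<open>Suppose \<open>q \<noteq> 0\<close> and pull the vectors \<open>(1, 0)\<close> and \<open>(0, 1)\<close> at \<open>(0, q)\<close> back to vectors \<open>v\<close> and \<open>w\<close> at the origin, where
\<open>N\<close> bounds the velocities of discs. Both vectors have several supporting functionals (the functions \<open>Phi \<omega>\<close> with
two, respectively all, values of \<open>\<omega>\<close>), whereas a vector with two nonzero coordinates has only one for the norm \<open>N\<close>.
So \<open>v\<close> and \<open>w\<close> lie on different coordinate axes, and \<open>N\<close> is additive on combinations of them. A lifted disc at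
\<open>(0, q)\<close> violates the resulting bound.\<close>

lemma Aut_origin_to_axis:
  assumes f: "f \<in> Aut_sym_bidisc" and f0: "f (0, 0) = (0, q)"
  shows "q = 0"
proof (rule ccontr)
  assume q0: "q \<noteq> 0"
  obtain g where g_inv: "inverse_automorphisms f g"
    by (rule Aut_sym_bidiscE[OF f])
  note g = inverse_automorphismsD[OF g_inv]
  have o: "(0, 0) \<in> G" by simp
  have g0: "g (0, q) = (0, 0)" using g(6)[OF o] f0 by simp
  have q1: "norm q < 1" using Aut_sym_bidisc_mem[OF f o] f0 by simp
  obtain T T' where inv: "inverse_derivatives f g (0, 0) T T'"
    by (rule Aut_sym_bidisc_derivative[OF g_inv o])
  note T = inverse_derivativesD[OF inv]
  define r where "r = norm q"
  have r: "0 < r" "r < 1" using q0 q1 by (auto simp: r_def)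
  then have r2: "1 - r^2 > 0" by (simp add: power_less_one_iff)
  have cq: "1 - q * cnj q = of_real (1 - r^2)" by (simp only: r_def of_real_one_minus_norm_squared)
  define N where "N v = norm (fst v) / 2 + norm (snd v)" for v :: "complex \<times> complex"
  have Nscale: "N (cscale c v) = norm c * N v" for c v by (simp add: N_def norm_mult algebra_simps)
  define v where "v = T' (1, 0)"
  define w where "w = T' (0, 1)"
  have T'e: "T' (a, b) = cscale a v + cscale b w" for a b
    unfolding v_def w_def by (rule clinear_expand[OF T(4,6)])
  have pull: "N (T' (curve_deriv h 0)) \<le> 1" if h: "analytic_disc h" "h 0 = (0, q)" for h
  proof -
    have "(g has_derivative T') (at (h 0))" using T(2) f0 h(2) by simp
    then have "curve_deriv (\<lambda>z. g (h z)) 0 = T' (curve_deriv h 0)"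
      by (rule analytic_disc_image(2)[OF h(1) g(4,5)])
    then show ?thesis
      using disc_velocity_bound_origin[OF analytic_disc_image(1)[OF h(1) g(4,5)]] g0 h(2)
      by (simp add: N_def)
  qed
  have Nv: "2 * (1 - r) * N v \<le> 1"
  proof -
    have "N (T' (of_real (2 * (1 - r)), 0)) \<le> 1"
      using pull[OF leaf_analytic_disc(1,2)[OF q1]] unfolding leaf_analytic_disc(3)[OF q1] r_def .
    then have "N (cscale (of_real (2 * (1 - r))) v) \<le> 1" unfolding T'e by (simp add: cscale_def)
    then show ?thesis using r unfolding Nscale norm_of_real by simp
  qed
  have Nw: "(1 - r^2) * N w \<le> 1"
  proof -
    have "N (T' (0, of_real (1 - r^2))) \<le> 1"
      using pull[OF vertical_disc(1)[OF q1]] unfolding vertical_disc(2)[OF q1] cq by (simp add: moeb_def)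
    then have "N (cscale (of_real (1 - r^2)) w) \<le> 1" unfolding T'e by (simp add: cscale_def)
    then show ?thesis using r2 unfolding Nscale norm_of_real by simp
  qed
  \<comment> \<open>\<open>l \<omega>\<close> is the derivative of \<open>Phi \<omega>\<close> at \<open>(0, q)\<close>\<close>
  define l where "l \<omega> x = (\<omega>^2 * q - 1) / 2 * fst x + \<omega> * snd x" for \<omega> :: complex and x :: "complex \<times> complex"
  define \<alpha> where "\<alpha> \<omega> = l \<omega> (T (1, 0))" for \<omega>
  define \<beta> where "\<beta> \<omega> = l \<omega> (T (0, 1))" for \<omega>
  have push: "norm (l \<omega> (T (curve_deriv h 0))) \<le> 1 - r^2"
    if h: "analytic_disc h" "h 0 = (0, 0)" and w: "norm \<omega> = 1" for h \<omega>
  proof -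
    have "(f has_derivative T) (at (h 0))" using T(1) h(2) by simp
    then have "curve_deriv (\<lambda>z. f (h z)) 0 = T (curve_deriv h 0)"
      by (rule analytic_disc_image(2)[OF h(1) g(2,3)])
    then show ?thesis
      using disc_velocity_bound[OF analytic_disc_image(1)[OF h(1) g(2,3)] _ w] f0 h(2)
      by (simp add: l_def r_def)
  qed
  have lT: "l \<omega> (T x) = \<alpha> \<omega> * fst x + \<beta> \<omega> * snd x" for \<omega> x
  proof -
    have "T x = cscale (fst x) (T (1, 0)) + cscale (snd x) (T (0, 1))"
      using clinear_expand[OF T(3,5), of "fst x" "snd x"] by (simp only: prod.collapse)
    then show ?thesis unfolding \<alpha>_def \<beta>_def l_def by (simp add: algebra_simps)
  qed
  have al: "norm (\<alpha> \<omega>) \<le> (1 - r^2) / 2" if w: "norm \<omega> = 1" for \<omega>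
  proof -
    have z1: "norm (0::complex) < 1" by simp
    have "l \<omega> (T (2, 0)) = 2 * \<alpha> \<omega>" using lT[of \<omega> "(2, 0)"] by simp
    then show ?thesis
      using push[OF leaf_analytic_disc(1,2)[OF z1] w] leaf_analytic_disc(3)[OF z1] by (simp add: norm_mult)
  qed
  have be: "norm (\<beta> \<omega>) \<le> 1 - r^2" if w: "norm \<omega> = 1" for \<omega>
  proof -
    have z1: "norm (0::complex) < 1" by simp
    show ?thesis
      using push[OF vertical_disc(1)[OF z1] _ w] vertical_disc(2)[OF z1] by (simp add: \<beta>_def moeb_def)
  qed
  have lv: "\<alpha> \<omega> * fst v + \<beta> \<omega> * snd v = (\<omega>^2 * q - 1) / 2" for \<omega>
    using lT[of \<omega> v, symmetric] unfolding v_def T(8) by (simp add: l_def)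
  have lw: "\<alpha> \<omega> * fst w + \<beta> \<omega> * snd w = \<omega>" for \<omega>
    using lT[of \<omega> w, symmetric] unfolding w_def T(8) by (simp add: l_def)
  have bounds: "norm (\<alpha> \<omega> * fst x) \<le> (1 - r^2) * (norm (fst x) / 2) \<and> norm (\<beta> \<omega> * snd x) \<le> (1 - r^2) * norm (snd x)"
    if w: "norm \<omega> = 1" for \<omega> x
    using mult_right_mono[OF al[OF w], of "norm (fst x)"] mult_right_mono[OF be[OF w], of "norm (snd x)"]
    by (simp add: norm_mult)
  obtain \<omega> where w: "norm \<omega> = 1" "\<omega>^2 * q = - of_real (norm q)" by (rule extremal_multiplier)
  have w': "norm (- \<omega>) = 1" "(- \<omega>)^2 * q = - of_real (norm q)" using w by simp_all
  \<comment> \<open>Equality in the triangle inequality determines both summands of \<open>l \<omega> (T v)\<close>, and likewise for \<open>w\<close>. The values for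
    \<open>\<omega>\<close> and \<open>- \<omega>\<close> then contradict each other unless the vector lies on an axis.\<close>
  have fv: "\<alpha> \<omega> * fst v = - of_real ((1 - r^2) * (norm (fst v) / 2)) \<and>
       \<beta> \<omega> * snd v = - of_real ((1 - r^2) * norm (snd v)) \<and> (1 - r^2) * N v = (1 + r) / 2"
    if w: "norm \<omega> = 1" "\<omega>^2 * q = - of_real (norm q)" for \<omega>
  proof -
    have sum: "\<alpha> \<omega> * fst v + \<beta> \<omega> * snd v = - of_real ((1 + r) / 2)"
      unfolding lv w(2) r_def by (simp add: field_simps)
    have nsum: "norm (\<alpha> \<omega> * fst v + \<beta> \<omega> * snd v) = (1 + r) / 2"
      unfolding sum norm_minus_cancel norm_of_real using r by simp
    have "(1 + r) * (2 * (1 - r) * N v) \<le> (1 + r) * 1" using Nv r by (intro mult_left_mono) auto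
    moreover have "(1 + r) * (2 * (1 - r) * N v) =
        2 * ((1 - r^2) * (norm (fst v) / 2) + (1 - r^2) * norm (snd v))"
      by (simp add: N_def field_simps power2_eq_square)
    ultimately have le: "(1 - r^2) * (norm (fst v) / 2) + (1 - r^2) * norm (snd v) \<le> (1 + r) / 2"
      by simp
    have nz: "\<alpha> \<omega> * fst v + \<beta> \<omega> * snd v \<noteq> 0" using nsum r by (metis norm_zero add_pos_pos half_gt_zero less_irrefl zero_less_one)
    note t = triangle_equality_split[OF bounds[OF w(1), THEN conjunct1] bounds[OF w(1), THEN conjunct2]
       le[folded nsum] nz, unfolded nsum, unfolded sum]
    have "of_real (a / ((1 + r) / 2)) * - complex_of_real ((1 + r) / 2) = - of_real a" for a
    proof -
      have "(1 + r) / 2 \<noteq> 0" using r by simp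
      then have "a / ((1 + r) / 2) * ((1 + r) / 2) = a" by (metis nonzero_eq_divide_eq)
      then show ?thesis by (metis mult_minus_right of_real_mult)
    qed
    then show ?thesis using t by (simp only: N_def distrib_left)
  qed
  have fw: "\<alpha> \<omega> * fst w = of_real ((1 - r^2) * (norm (fst w) / 2)) * \<omega> \<and>
       \<beta> \<omega> * snd w = of_real ((1 - r^2) * norm (snd w)) * \<omega> \<and> (1 - r^2) * N w = 1"
    if w: "norm \<omega> = 1" for \<omega>
  proof -
    have nsum: "norm (\<alpha> \<omega> * fst w + \<beta> \<omega> * snd w) = 1" unfolding lw by (rule w)
    have le: "(1 - r^2) * (norm (fst w) / 2) + (1 - r^2) * norm (snd w) \<le> norm (\<alpha> \<omega> * fst w + \<beta> \<omega> * snd w)"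
      using Nw unfolding nsum by (simp add: N_def algebra_simps)
    have nz: "\<alpha> \<omega> * fst w + \<beta> \<omega> * snd w \<noteq> 0" using nsum by (metis norm_zero zero_neq_one)
    note t = triangle_equality_split[OF bounds[OF w, THEN conjunct1] bounds[OF w, THEN conjunct2]
       le nz, unfolded nsum, unfolded lw]
    then show ?thesis by (simp only: N_def distrib_left) simp
  qed
  have v_axis: "fst v = 0 \<or> snd v = 0"
  proof (rule ccontr)
    assume "\<not> (fst v = 0 \<or> snd v = 0)"
    then have "\<alpha> \<omega> = \<alpha> (- \<omega>)" "\<beta> \<omega> = \<beta> (- \<omega>)"
      using fv[OF w] fv[OF w'] by (metis mult_right_cancel)+
    then have "\<omega> = - \<omega>" using lw[of \<omega>] lw[of "- \<omega>"] by simp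
    then show False using w(1) by simp
  qed
  have w_axis: "fst w = 0 \<or> snd w = 0"
  proof (rule ccontr)
    assume n: "\<not> (fst w = 0 \<or> snd w = 0)"
    have "\<alpha> (- \<omega>) * fst w = (- \<alpha> \<omega>) * fst w" "\<beta> (- \<omega>) * snd w = (- \<beta> \<omega>) * snd w"
      using fw[OF w(1)] fw[OF w'(1)] by simp_all
    then have "\<alpha> (- \<omega>) = - \<alpha> \<omega>" "\<beta> (- \<omega>) = - \<beta> \<omega>" using n by (meson mult_right_cancel)+
    then have "\<alpha> (- \<omega>) * fst v + \<beta> (- \<omega>) * snd v = - (\<alpha> \<omega> * fst v + \<beta> \<omega> * snd v)"
      by simp
    then have "(\<omega>^2 * q - 1) / 2 = - ((\<omega>^2 * q - 1) / 2)"
      unfolding lv power2_minus .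
    then have "(\<omega>^2 * q - 1) / 2 = 0" by (simp only: eq_neg_iff_add_eq_0 mult_2[symmetric] mult_eq_0_iff) simp
    then have "\<omega>^2 * q = 1" by simp
    then show False using w(2) r by (metis norm_minus_cancel norm_of_real norm_one r_def abs_norm_cancel less_irrefl)
  qed
  have nN: "N v \<noteq> 0" "N w \<noteq> 0" using fv[OF w] fw[OF w(1)] r by auto
  have cross: "(snd v = 0 \<and> fst w = 0) \<or> (fst v = 0 \<and> snd w = 0)"
  proof (rule ccontr)
    assume "\<not> ?thesis"
    then consider "snd v = 0" "snd w = 0" | "fst v = 0" "fst w = 0" using v_axis w_axis by blast
    then show False
    proof cases
      case 1
      then have "cscale (fst w) v = cscale (fst v) w" by (simp add: cscale_def mult.commute)
      then have "T (cscale (fst w) v) = T (cscale (fst v) w)" by simp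
      then have "fst w = 0" by (simp add: T(5,8) v_def w_def)
      then show False using 1 nN by (simp add: N_def)
    next
      case 2
      then have "cscale (snd w) v = cscale (snd v) w" by (simp add: cscale_def mult.commute)
      then have "T (cscale (snd w) v) = T (cscale (snd v) w)" by simp
      then have "snd w = 0" by (simp add: T(5,8) v_def w_def)
      then show False using 2 nN by (simp add: N_def)
    qed
  qed
  have NT': "N (T' (a, b)) = norm a * N v + norm b * N w" for a b
    using cross unfolding T'e N_def by (auto simp: norm_mult)
  obtain c where c: "norm c < 1" "c^2 = - q" using square_root_in_disc[OF q1] by blast
  define t where "t = norm c"
  have t: "r = t^2" "t > 0"
    using c(2) q0 by (auto simp: t_def r_def) (metis norm_minus_cancel norm_power)
  \<comment> \<open>\<open>u\<close> is \<open>(1 + \<i> t)^2 / (1 + t^2)\<close>; for this angle the lifted disc exceeds the bound by a positive multiple of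
    \<open>r (1 - r)\<close>\<close>
  define u where "u = Complex ((1 - t^2) / (1 + t^2)) (2 * t / (1 + t^2))"
  have pos: "1 + t^2 > 0" by (simp add: add_pos_nonneg)
  have "(1 - t^2)^2 + (2 * t)^2 = (1 + t^2)^2" by (simp add: algebra_simps power2_eq_square)
  then have "((1 - t^2) / (1 + t^2))^2 + (2 * t / (1 + t^2))^2 = 1"
    using pos by (simp add: power_divide flip: add_divide_distrib)
  then have u1: "norm u = 1" by (simp add: u_def cmod_def)
  have uu: "norm (cnj u + u) = 2 * ((1 - t^2) / (1 + t^2))" "norm (u - cnj u) = 2 * (2 * t / (1 + t^2))"
  proof -
    have "cnj u + u = of_real (2 * ((1 - t^2) / (1 + t^2)))" by (simp add: u_def complex_eq_iff)
    then show "norm (cnj u + u) = 2 * ((1 - t^2) / (1 + t^2))"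
      using pos r t by (simp only: norm_of_real) simp
    have "u - cnj u = \<i> * of_real (2 * (2 * t / (1 + t^2)))" by (simp add: u_def complex_eq_iff)
    then show "norm (u - cnj u) = 2 * (2 * t / (1 + t^2))"
      using pos t by (simp only: norm_of_real norm_mult norm_ii mult_1) simp
  qed
  have cc: "norm (1 - c * cnj c) = 1 - r"
  proof -
    have "1 - c * cnj c = of_real (1 - (norm c)^2)" by (simp only: of_real_one_minus_norm_squared)
    then show ?thesis using r t by (simp only: norm_of_real t_def)
  qed
  have cu: "norm (cnj u) = 1" using u1 by simp
  obtain h where h: "analytic_disc h" "h 0 = (0, - (c^2))"
    "curve_deriv h 0 = ((1 - c * cnj c) * (cnj u + u), (1 - c * cnj c) * (c * (u - cnj u)))"
    by (rule lifted_disc[OF c(1) cu u1]) (rule that)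
  have fin: "(1 - r) * (2 * ((1 - t^2) / (1 + t^2))) * N v + (1 - r) * (t * (2 * (2 * t / (1 + t^2)))) * N w \<le> 1"
    using pull[of h] h c(2) unfolding h(3) NT' norm_mult cc uu t_def[symmetric] by simp
  have Nv_eq: "N v = 1 / (2 * (1 - r))"
  proof -
    have "(1 + r) * (2 * (1 - r) * N v) = 2 * ((1 - r^2) * N v)"
      by (simp add: algebra_simps power2_eq_square)
    also have "\<dots> = (1 + r) * 1" using fv[OF w] by simp
    finally have "2 * (1 - r) * N v = 1" using r by (simp only: mult_cancel_left) simp
    then show ?thesis using r by (simp add: field_simps)
  qed
  have Nw_eq: "N w = 1 / ((1 - r) * (1 + r))"
  proof -
    have "(1 - r) * (1 + r) * N w = (1 - r^2) * N w"
      by (simp add: algebra_simps power2_eq_square)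
    then have "(1 - r) * (1 + r) * N w = 1" using fw[OF w(1)] by simp
    moreover have "(1 - r) * (1 + r) \<noteq> 0" using r by simp
    ultimately show ?thesis by (simp only: eq_divide_eq) (simp add: mult.commute)
  qed
  have "(1 - r) * (2 * ((1 - r) / (1 + r))) * (1 / (2 * (1 - r))) = (1 - r) / (1 + r)"
    using r by simp
  moreover have "(1 - r) * (t * (2 * (2 * t / (1 + r)))) * (1 / ((1 - r) * (1 + r))) = 4 * t^2 / (1 + r)^2"
    using r by (simp add: power2_eq_square)
  ultimately have "(1 - r) / (1 + r) + 4 * r / (1 + r)^2 \<le> 1"
    using fin unfolding Nv_eq Nw_eq t(1)[symmetric] by simp
  moreover have "(1 - r) / (1 + r) = (1 - r) * (1 + r) / (1 + r)^2"
    using r by (simp add: power2_eq_square)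
  ultimately have "((1 - r) * (1 + r) + 4 * r) / (1 + r)^2 \<le> 1"
    by (simp only: add_divide_distrib)
  moreover have "0 < (1 + r)^2" using r by simp
  ultimately have "(1 - r) * (1 + r) + 4 * r \<le> (1 + r)^2" by (simp only: divide_le_eq_1_pos)
  then have "r * (1 - r) \<le> 0" by (simp add: algebra_simps power2_eq_square)
  then show False using r by (simp add: mult_le_0_iff)
qed

text \<open>The induced automorphisms act transitively on the royal variety and move every point to the central flat
geodesic, so the claim reduces to an automorphism that maps the origin to some \<open>(0, q)\<close>.\<close>

lemma Aut_royal:
  assumes f: "f \<in> Aut_sym_bidisc" and x: "x \<in> royal_variety"
  shows "f x \<in> royal_variety"
proof -
  have xG: "x \<in> G" using x royal_subset by blast
  have fxG: "f x \<in> G" using Aut_sym_bidisc_mem[OF f xG] .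
  obtain a q where a: "norm a < 1" "norm q < 1" "sym_moeb a x = (0, q)"
    using sym_moeb_to_zero[OF xG] by blast
  have "(0, q) \<in> royal_variety" using sym_moeb_royal[OF a(1) x] a(3) by simp
  then have "q = 0" using royal_iff[of "(0, q)"] a(2) by simp
  then have x0: "sym_moeb (- a) (0, 0) = x" using sym_moeb_inverse(1)[OF a(1) xG] a(3) by simp
  obtain b q' where b: "norm b < 1" "norm q' < 1" "sym_moeb b (f x) = (0, q')"
    using sym_moeb_to_zero[OF fxG] by blast
  have a': "norm (- a) < 1" using a by simp
  have "(\<lambda>y. sym_moeb b (f (sym_moeb (- a) y))) \<in> Aut_sym_bidisc"
    by (rule Aut_sym_bidisc_compose[OF sym_moeb_Aut[OF b(1)] Aut_sym_bidisc_compose[OF f sym_moeb_Aut[OF a']]])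
  then have "q' = 0" by (rule Aut_origin_to_axis) (simp add: x0 b(3))
  then have "f x = sym_moeb (- b) (0, 0)" using sym_moeb_inverse(1)[OF b(1) fxG] b(3) by simp
  moreover have "(0, 0) \<in> royal_variety" by (simp add: royal_iff)
  ultimately show ?thesis using sym_moeb_royal[of "- b" "(0, 0)"] b(1) by simp
qed

text \<open>Since the royal variety is invariant, the derivative at the origin maps \<open>(1, 0)\<close> to a multiple of itself. The metric bounds for
the derivative and for its inverse then force \<open>(0, 1)\<close> to be mapped to a unimodular multiple of itself, and
\<open>vertical_disc_rigid\<close> applies.\<close>

lemma Aut_fixing_origin:
  assumes f: "f \<in> Aut_sym_bidisc" and f0: "f (0, 0) = (0, 0)"
  obtains b where "norm b = 1" "\<And>z. norm z < 1 \<Longrightarrow> f (0, z) = (0, b * z)"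
proof -
  obtain g where g_inv: "inverse_automorphisms f g"
    by (rule Aut_sym_bidiscE[OF f])
  note g = inverse_automorphismsD[OF g_inv]
  have o: "(0, 0) \<in> G" by simp
  obtain T T' where inv: "inverse_derivatives f g (0, 0) T T'"
    by (rule Aut_sym_bidisc_derivative[OF g_inv o])
  note T = inverse_derivativesD[OF inv]
  have g0: "g (0, 0) = (0, 0)" using g(6)[OF o] f0 by simp
  have z1: "norm (0::complex) < 1" by simp
  have V: "analytic_disc (\<lambda>z. (0, z))" "curve_deriv (\<lambda>z. (0, z)) 0 = (0, 1)"
    using vertical_disc[OF z1] by (simp_all add: moeb_def)
  note L = leaf_analytic_disc[OF z1]
  have Lv: "curve_deriv (leaf 0) 0 = (2, 0)" using L(3) by simp
  have T20: "T (2, 0) = cscale 2 (T (1, 0))" using T(5)[of 2 "(1, 0)"] by simp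
  have fL: "analytic_disc (\<lambda>z. f (leaf 0 z))" "curve_deriv (\<lambda>z. f (leaf 0 z)) 0 = cscale 2 (T (1, 0))"
    using analytic_disc_image[OF L(1) g(2,3)] T(1) L(2) unfolding Lv T20[symmetric] by simp_all
  have fV: "analytic_disc (\<lambda>z. f (0, z))" "curve_deriv (\<lambda>z. f (0, z)) 0 = T (0, 1)"
    using analytic_disc_image[OF V(1) g(2,3)] T(1) unfolding V(2) by simp_all
  have gV: "analytic_disc (\<lambda>z. g (0, z))" "curve_deriv (\<lambda>z. g (0, z)) 0 = T' (0, 1)"
    using analytic_disc_image[OF V(1) g(4,5)] T(2) unfolding V(2) f0 by simp_all
  have "snd (curve_deriv (\<lambda>z. f (leaf 0 z)) 0) = 0"
  proof -
    let ?s = "\<lambda>z. fst (f (leaf 0 z))" and ?p = "\<lambda>z. snd (f (leaf 0 z))"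
    have roy: "?p z = (?s z)^2 / 4" if "norm z < 1" for z
    proof -
      have "leaf 0 z \<in> royal_variety" using that by (auto simp: leaf_def royal_variety_def)
      then have "f (leaf 0 z) \<in> royal_variety" by (rule Aut_royal[OF f])
      then show ?thesis using royal_iff royal_subset by fastforce
    qed
    have "(?s has_field_derivative deriv ?s 0) (at 0)"
      using fL(1) unfolding analytic_disc_def holomorphic_curve_on_def
      by (intro holomorphic_derivI[of ?s unit_disc]) auto
    from DERIV_mult[OF this this]
    have "((\<lambda>z. ?s z * ?s z / 4) has_field_derivative 0) (at 0)"
      using L(2) f0 by (auto intro: DERIV_cdivide[where D = 0, simplified])
    then have "(?p has_field_derivative 0) (at 0)"
      by (rule has_field_derivative_transform_within_open[of _ _ _ "unit_disc"])
         (auto simp: roy power2_eq_square)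
    then show ?thesis by (simp add: curve_deriv_def DERIV_imp_deriv)
  qed
  then have "snd (T (1, 0)) = 0" unfolding fL(2) by simp
  then obtain v where v: "T (1, 0) = (v, 0)" by (metis prod.collapse)
  obtain a b where ab: "T (0, 1) = (a, b)" by fastforce
  obtain x y where xy: "T' (0, 1) = (x, y)" by fastforce
  have ab1: "norm a / 2 + norm b \<le> 1"
    using disc_velocity_bound_origin[OF fV(1)] f0 fV(2) ab by simp
  have xy1: "norm x / 2 + norm y \<le> 1"
    using disc_velocity_bound_origin[OF gV(1)] g0 gV(2) xy by simp
  have "T (T' (0, 1)) = cscale x (T (1, 0)) + cscale y (T (0, 1))"
    unfolding xy by (rule clinear_expand[OF T(3,5)])
  then have "snd (T (T' (0, 1))) = y * b" by (simp add: v ab)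
  then have "y * b = 1" using T(8)[of "(0, 1)"] by simp
  then have yb: "norm y * norm b = 1" by (metis norm_mult norm_one)
  have "norm y * norm b \<le> 1 * norm b" using xy1 norm_ge_zero[of x] by (intro mult_right_mono) (linarith, simp)
  then have "1 \<le> norm b" using yb by simp
  then have b1: "norm b = 1" using ab1 norm_ge_zero[of a] by linarith
  have "f (0, z) = (0, b * z)" if "norm z < 1" for z
    by (rule vertical_disc_rigid[OF fV(1) _ _ b1 that]) (use f0 fV(2) ab in simp_all)
  then show thesis using that b1 by blast
qed

section \<open>Automorphisms preserve the distance of the roots\<close>

text \<open>The square of the pseudohyperbolic distance between the two roots, expressed in \<open>s\<close> and \<open>p\<close>; see
\<open>root_distance_sum_prod\<close>.\<close>

definition root_distance :: "complex \<times> complex \<Rightarrow> real" where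
  "root_distance x = norm ((fst x)^2 - 4 * snd x) /
     (1 + (norm (snd x))^2 - ((norm (fst x))^2 - norm ((fst x)^2 - 4 * snd x)) / 2)"

lemma root_distance_denominator:
  "1 + (norm (z * w))^2 - ((norm (z + w))^2 - norm ((z + w)^2 - 4 * (z * w))) / 2 =
     (norm (1 - cnj z * w))^2"
  "norm ((z + w)^2 - 4 * (z * w)) = (norm (z - w))^2"
proof -
  have "(z + w)^2 - 4 * (z * w) = (z - w)^2" by (simp add: algebra_simps power2_eq_square)
  then show 2: "norm ((z + w)^2 - 4 * (z * w)) = (norm (z - w))^2" by (simp add: norm_power)
  have "complex_of_real (1 + (norm (z * w))^2 - ((norm (z + w))^2 - (norm (z - w))^2) / 2) =
      complex_of_real ((norm (1 - cnj z * w))^2)"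
    by (simp only: of_real_add of_real_diff of_real_1 of_real_divide of_real_numeral complex_norm_square)
       (simp add: field_simps)
  then show "1 + (norm (z * w))^2 - ((norm (z + w))^2 - norm ((z + w)^2 - 4 * (z * w))) / 2 =
     (norm (1 - cnj z * w))^2"
    unfolding 2 by (simp only: of_real_eq_iff)
qed

lemma root_distance_sum_prod: "root_distance (z + w, z * w) = (norm (z - w))^2 / (norm (1 - cnj z * w))^2"
  by (simp only: root_distance_def fst_conv snd_conv root_distance_denominator(1)) (simp only: root_distance_denominator(2))

lemma root_distance_denominator_pos:
  assumes "x \<in> G"
  shows "1 + (norm (snd x))^2 - ((norm (fst x))^2 - norm ((fst x)^2 - 4 * snd x)) / 2 > 0"
proof -
  obtain z w where zw: "norm z < 1" "norm w < 1" "x = (z + w, z * w)"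
    using assms unfolding mem_sym_bidisc by blast
  show ?thesis
    unfolding zw(3) fst_conv snd_conv root_distance_denominator(1)
    using moeb_denominator_nz[of z w] zw by simp
qed

lemma root_distance_sym_moeb:
  assumes a: "norm a < 1" and x: "x \<in> G"
  shows "root_distance (sym_moeb a x) = root_distance x"
proof -
  obtain z w where zw: "norm z < 1" "norm w < 1" "x = (z + w, z * w)"
    using x unfolding mem_sym_bidisc by blast
  have nz: "1 - cnj a * z \<noteq> 0" "1 - cnj a * w \<noteq> 0" using a zw moeb_denominator_nz by auto
  then have nz': "1 - a * cnj z \<noteq> 0" by (metis complex_cnj_cnj complex_cnj_diff complex_cnj_mult complex_cnj_one complex_cnj_zero)
  define k where "k = 1 - a * cnj a"
  have k: "norm k \<noteq> 0"
    using moeb_denominator_nz[of a a] a by (simp add: k_def mult.commute)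
  have "moeb a z - moeb a w = ((z - a) * (1 - cnj a * w) - (w - a) * (1 - cnj a * z)) /
      ((1 - cnj a * z) * (1 - cnj a * w))"
    unfolding moeb_def using nz by (simp add: diff_frac_eq)
  also have "(z - a) * (1 - cnj a * w) - (w - a) * (1 - cnj a * z) = (z - w) * k"
    by (simp add: k_def algebra_simps)
  finally have n: "norm (moeb a z - moeb a w) =
      norm (z - w) * (norm k / (norm (1 - cnj a * z) * norm (1 - cnj a * w)))"
    by (simp add: norm_mult norm_divide)
  have gen: "1 - A / B * (C / D) = (B * D - A * C) / (B * D)" if "B \<noteq> 0" "D \<noteq> 0" for A B C D :: complex
    using that by (simp add: field_simps)
  have cm: "cnj (moeb a z) = (cnj z - cnj a) / (1 - a * cnj z)" by (simp add: moeb_def)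
  have "1 - cnj (moeb a z) * moeb a w =
      ((1 - a * cnj z) * (1 - cnj a * w) - (cnj z - cnj a) * (w - a)) / ((1 - a * cnj z) * (1 - cnj a * w))"
    unfolding cm by (subst moeb_def) (rule gen[OF nz' nz(2)])
  also have "(1 - a * cnj z) * (1 - cnj a * w) - (cnj z - cnj a) * (w - a) = (1 - cnj z * w) * k"
    by (simp add: k_def algebra_simps)
  finally have d: "norm (1 - cnj (moeb a z) * moeb a w) =
      norm (1 - cnj z * w) * (norm k / (norm (1 - a * cnj z) * norm (1 - cnj a * w)))"
    by (simp add: norm_mult norm_divide)
  have "norm (1 - a * cnj z) = norm (cnj (1 - cnj a * z))" by simp
  then have e: "norm (1 - a * cnj z) = norm (1 - cnj a * z)" by (simp only: complex_mod_cnj)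
  define m where "m = norm k / (norm (1 - cnj a * z) * norm (1 - cnj a * w))"
  have m: "m \<noteq> 0" using k nz by (simp add: m_def)
  have "root_distance (sym_moeb a x) = (norm (z - w) * m)^2 / (norm (1 - cnj z * w) * m)^2"
    unfolding zw(3) sym_moeb_sum_prod[OF a less_imp_le[OF zw(1)] less_imp_le[OF zw(2)]] root_distance_sum_prod
    unfolding n d e m_def ..
  also have "\<dots> = root_distance x" unfolding zw(3) root_distance_sum_prod using m by (simp add: power_mult_distrib)
  finally show ?thesis .
qed

text \<open>Composition with induced automorphisms, which preserve the hyperbolic distance of the roots, moves the given point
to some \<open>(0, q)\<close> and makes the automorphism fix the origin. It then rotates the central flat geodesic, and
there the distance depends on \<open>norm q\<close> only.\<close>

lemma root_distance_Aut:
  assumes f: "f \<in> Aut_sym_bidisc" and x: "x \<in> G"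
  shows "root_distance (f x) = root_distance x"
proof -
  obtain a q where a: "norm a < 1" "norm q < 1" "sym_moeb a x = (0, q)"
    using sym_moeb_to_zero[OF x] by blast
  have a': "norm (- a) < 1" using a by simp
  have qG: "(0, q) \<in> G" and o: "(0, 0) \<in> G" using a by simp_all
  define F where "F y = f (sym_moeb (- a) y)" for y
  have F: "F \<in> Aut_sym_bidisc"
    unfolding F_def[abs_def] by (rule Aut_sym_bidisc_compose[OF f sym_moeb_Aut[OF a']])
  have Fq: "F (0, q) = f x" using sym_moeb_inverse(1)[OF a(1) x] a(3) by (simp add: F_def)
  have Fo: "F (0, 0) \<in> G" using Aut_sym_bidisc_mem[OF F o] .
  obtain b q' where b: "norm b < 1" "norm q' < 1" "sym_moeb b (F (0, 0)) = (0, q')"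
    using sym_moeb_to_zero[OF Fo] by blast
  have H: "(\<lambda>y. sym_moeb b (F y)) \<in> Aut_sym_bidisc"
    by (rule Aut_sym_bidisc_compose[OF sym_moeb_Aut[OF b(1)] F])
  have "q' = 0" by (rule Aut_origin_to_axis[OF H]) (rule b(3))
  then obtain e where e: "norm e = 1" "\<And>z. norm z < 1 \<Longrightarrow> sym_moeb b (F (0, z)) = (0, e * z)"
    using Aut_fixing_origin[OF H] b(3) by auto
  have "root_distance (f x) = root_distance (sym_moeb b (F (0, q)))"
    using root_distance_sym_moeb[OF b(1)] Fq Aut_sym_bidisc_mem[OF f x] by simp
  also have "\<dots> = root_distance (0, e * q)" using e(2) a(2) by simp
  also have "\<dots> = root_distance (0, q)" using e(1) by (simp add: root_distance_def norm_mult)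
  also have "\<dots> = root_distance x" using root_distance_sym_moeb[OF a(1) x] a(3) by simp
  finally show ?thesis .
qed

lemma Orb_subset: "x \<in> G \<Longrightarrow> Orb x \<subseteq> G"
  unfolding Orb_def using Aut_sym_bidisc_mem by blast

lemma Orb_Aut:
  assumes f: "f \<in> Aut_sym_bidisc" and x: "x \<in> G"
  shows "Orb (f x) = Orb x"
proof -
  obtain g where g_inv: "inverse_automorphisms f g"
    by (rule Aut_sym_bidiscE[OF f])
  note g = inverse_automorphismsD[OF g_inv]
  show ?thesis
  proof
    show "Orb (f x) \<subseteq> Orb x"
      using Aut_sym_bidisc_compose[OF _ f] by (fastforce simp: Orb_def)
    show "Orb x \<subseteq> Orb (f x)"
    proof
      fix y assume "y \<in> Orb x"
      then obtain k where k: "k \<in> Aut_sym_bidisc" "y = k x" by (auto simp: Orb_def)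
      have "y = k (g (f x))" using k(2) g(6)[OF x] by simp
      then show "y \<in> Orb (f x)"
        unfolding Orb_def using Aut_sym_bidisc_compose[OF k(1) g(1)] by (intro CollectI exI[of _ "\<lambda>u. k (g u)"]) simp
    qed
  qed
qed

section \<open>The sharp direction on the central flat geodesic\<close>

lemma C1_differentiable_on_Pair:
  assumes "f C1_differentiable_on S" "g C1_differentiable_on S"
  shows "(\<lambda>t. (f t, g t)) C1_differentiable_on S"
proof -
  obtain f' g' where "\<And>t. t \<in> S \<Longrightarrow> (f has_vector_derivative f' t) (at t)" "continuous_on S f'"
    "\<And>t. t \<in> S \<Longrightarrow> (g has_vector_derivative g' t) (at t)" "continuous_on S g'"
    using assms unfolding C1_differentiable_on_def by blast
  then show ?thesis
    unfolding C1_differentiable_on_def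
    by (intro exI[of _ "\<lambda>t. (f' t, g' t)"])
       (auto intro!: has_vector_derivative_Pair continuous_on_Pair)
qed

lemma C1_differentiable_on_bounded_linear:
  assumes "bounded_linear L" "f C1_differentiable_on S"
  shows "(\<lambda>t. L (f t)) C1_differentiable_on S"
proof -
  obtain f' where "\<And>t. t \<in> S \<Longrightarrow> (f has_vector_derivative f' t) (at t)" "continuous_on S f'"
    using assms unfolding C1_differentiable_on_def by blast
  then show ?thesis
    unfolding C1_differentiable_on_def
    by (intro exI[of _ "\<lambda>t. L (f' t)"])
       (auto intro!: bounded_linear.has_vector_derivative[OF assms(1)] bounded_linear.continuous_on[OF assms(1)])
qed

lemma C1_differentiable_on_divide:
  fixes f g :: "real \<Rightarrow> complex"
  assumes f: "f C1_differentiable_on S" and g: "g C1_differentiable_on S"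
    and nz: "\<And>t. t \<in> S \<Longrightarrow> g t \<noteq> 0"
  shows "(\<lambda>t. f t / g t) C1_differentiable_on S"
proof -
  obtain g' where g': "\<And>t. t \<in> S \<Longrightarrow> (g has_vector_derivative g' t) (at t)" "continuous_on S g'"
    using g unfolding C1_differentiable_on_def by blast
  have cg: "continuous_on S g"
    using g' has_vector_derivative_continuous continuous_at_imp_continuous_on by blast
  have "((\<lambda>t. inverse (g t)) has_vector_derivative g' t * - (inverse (g t) ^ 2)) (at t)" if t: "t \<in> S" for t
  proof -
    have "(inverse has_field_derivative - (inverse (g t) ^ 2)) (at (g t))"
      using DERIV_inverse[OF nz[OF t]] by (simp add: numeral_2_eq_2)
    from field_vector_diff_chain_at[OF g'(1)[OF t] this] show ?thesis by (simp add: o_def)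
  qed
  moreover have "continuous_on S (\<lambda>t. g' t * - (inverse (g t) ^ 2))"
    by (intro continuous_intros g' cg) (use nz in auto)
  ultimately have "(\<lambda>t. inverse (g t)) C1_differentiable_on S"
    unfolding C1_differentiable_on_def by (intro exI[of _ "\<lambda>t. g' t * - (inverse (g t) ^ 2)"]) auto
  from C1_differentiable_on_mult[OF f this] show ?thesis
    by (simp add: field_class.field_divide_inverse)
qed

lemma C1_differentiable_on_holomorphic:
  assumes f: "f holomorphic_on U" "open U" and S: "of_real ` S \<subseteq> U"
  shows "(\<lambda>t. f (complex_of_real t)) C1_differentiable_on S"
  unfolding C1_differentiable_on_def
proof (intro exI conjI ballI)
  fix t assume "t \<in> S"
  then have "(f has_field_derivative deriv f (of_real t)) (at (of_real t))"
    using f S by (intro holomorphic_derivI[OF f]) auto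
  then show "((\<lambda>t. f (complex_of_real t)) has_vector_derivative deriv f (of_real t)) (at t)"
    by (rule has_vector_derivative_real_field)
next
  have "continuous_on U (deriv f)"
    using f holomorphic_deriv holomorphic_on_imp_continuous_on by blast
  then show "continuous_on S (\<lambda>t. deriv f (of_real t))"
    using S by (intro continuous_on_compose2[of U "deriv f" S of_real]) (auto intro: continuous_intros)
qed

lemma C1_differentiable_on_sym_moeb:
  assumes a: "norm a < 1" and g: "\<gamma> C1_differentiable_on S" "\<gamma> ` S \<subseteq> G"
  shows "(\<lambda>t. sym_moeb a (\<gamma> t)) C1_differentiable_on S"
proof -
  note s = C1_differentiable_on_bounded_linear[OF bounded_linear_fst g(1)]
   and p = C1_differentiable_on_bounded_linear[OF bounded_linear_snd g(1)]
  show ?thesis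
    unfolding sym_moeb_def
    by (intro C1_differentiable_on_Pair C1_differentiable_on_divide C1_differentiable_on_add
        C1_differentiable_on_diff C1_differentiable_on_mult s p C1_differentiable_on_const
        sym_moeb_denominator_nz[OF a]) (use g(2) in auto)
qed

lemma tangent_sym_moeb:
  assumes a: "norm a < 1" and p: "p \<in> G" and T: "(sym_moeb a has_derivative T) (at p)"
    and v: "v \<in> real_tangent_space (Orb p) p"
  shows "T v \<in> real_tangent_space (Orb (sym_moeb a p)) (sym_moeb a p)"
proof -
  obtain \<gamma> \<epsilon> where g: "\<epsilon> > 0" "\<gamma> C1_differentiable_on {-\<epsilon><..<\<epsilon>}" "\<gamma> ` {-\<epsilon><..<\<epsilon>} \<subseteq> Orb p"
     "\<gamma> 0 = p" "(\<gamma> has_vector_derivative v) (at (0::real))"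
    using v unfolding real_tangent_space_def by blast
  have gG: "\<gamma> ` {-\<epsilon><..<\<epsilon>} \<subseteq> G" using g(3) Orb_subset[OF p] by blast
  have gO: "(\<lambda>t. sym_moeb a (\<gamma> t)) ` {-\<epsilon><..<\<epsilon>} \<subseteq> Orb (sym_moeb a p)"
  proof (rule image_subsetI)
    fix t assume "t \<in> {-\<epsilon><..<\<epsilon>}"
    then have "\<gamma> t \<in> Orb p" using g(3) by blast
    then obtain k where "k \<in> Aut_sym_bidisc" "\<gamma> t = k p" by (auto simp: Orb_def)
    then have "sym_moeb a (\<gamma> t) \<in> Orb p"
      unfolding Orb_def using Aut_sym_bidisc_compose[OF sym_moeb_Aut[OF a], of k]
      by (intro CollectI exI[of _ "\<lambda>u. sym_moeb a (k u)"]) simp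
    then show "sym_moeb a (\<gamma> t) \<in> Orb (sym_moeb a p)" using Orb_Aut[OF sym_moeb_Aut[OF a] p] by simp
  qed
  have "((\<lambda>t. sym_moeb a (\<gamma> t)) has_derivative (\<lambda>t. T (t *\<^sub>R v))) (at 0)"
    using has_derivative_compose[OF g(5)[unfolded has_vector_derivative_def]] T g(4) by blast
  moreover have "T (t *\<^sub>R v) = t *\<^sub>R T v" for t
    using has_derivative_linear[OF T] by (rule linear_cmul)
  ultimately have "((\<lambda>t. sym_moeb a (\<gamma> t)) has_vector_derivative T v) (at 0)"
    unfolding has_vector_derivative_def by simp
  then show ?thesis
    unfolding real_tangent_space_def
    using g(1,4) gO C1_differentiable_on_sym_moeb[OF a g(2) gG]
    by (intro CollectI exI[of _ "\<lambda>t. sym_moeb a (\<gamma> t)"] exI[of _ \<epsilon>]) simp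
qed

lemma has_real_derivative_norm_squared:
  fixes F :: "real \<Rightarrow> complex"
  assumes "(F has_vector_derivative D) (at x)"
  shows "((\<lambda>t. (norm (F t))^2) has_real_derivative 2 * Re (cnj (F x) * D)) (at x)"
proof -
  have "((\<lambda>t. Re (F t)) has_real_derivative Re D) (at x)"
    "((\<lambda>t. Im (F t)) has_real_derivative Im D) (at x)"
    using bounded_linear.has_vector_derivative[OF bounded_linear_Re assms]
      bounded_linear.has_vector_derivative[OF bounded_linear_Im assms]
    by (simp_all add: has_real_derivative_iff_has_vector_derivative)
  note re = DERIV_mult[OF this(1) this(1)] and im = DERIV_mult[OF this(2) this(2)]
  have "((\<lambda>t. Re (F t) * Re (F t) + Im (F t) * Im (F t)) has_real_derivative
     2 * Re (cnj (F x) * D)) (at x)"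
    using DERIV_add[OF re im] by (simp add: algebra_simps)
  moreover have "(norm (F t))^2 = Re (F t) * Re (F t) + Im (F t) * Im (F t)" for t
    unfolding cmod_power2 by (simp only: power2_eq_square)
  ultimately show ?thesis by simp
qed

text \<open>The orbit lies in a level set of \<open>root_distance\<close>. At \<open>(0, q)\<close> the function is stationary in \<open>s\<close>, and in \<open>p\<close> it depends
on \<open>norm p\<close> alone to first order. For \<open>q = 0\<close> it is not differentiable there, and the equation \<open>s^2 = 4 p\<close> of the royal variety
takes its place.\<close>

lemma tangent_axis_upper:
  assumes q: "norm q < 1" and v: "v \<in> real_tangent_space (Orb (0, q)) (0, q)"
  shows "Re (cnj q * snd v) = 0" and "q = 0 \<Longrightarrow> snd v = 0"
proof -
  have qG: "(0, q) \<in> G" using q by simp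
  obtain \<gamma> \<epsilon> where g: "\<epsilon> > 0" "\<gamma> ` {-\<epsilon><..<\<epsilon>} \<subseteq> Orb (0, q)"
     "\<gamma> 0 = (0, q)" "(\<gamma> has_vector_derivative v) (at (0::real))"
    using v unfolding real_tangent_space_def by blast
  define s where "s t = fst (\<gamma> t)" for t
  define p where "p t = snd (\<gamma> t)" for t
  have 0: "s 0 = 0" "p 0 = q" using g(3) by (simp_all add: s_def p_def)
  have s': "(s has_vector_derivative fst v) (at 0)"
    using bounded_linear.has_vector_derivative[OF bounded_linear_fst g(4)] by (simp add: s_def[abs_def])
  have p': "(p has_vector_derivative snd v) (at 0)"
    using bounded_linear.has_vector_derivative[OF bounded_linear_snd g(4)] by (simp add: p_def[abs_def])
  have A': "((\<lambda>t. (s t)^2 - 4 * p t) has_vector_derivative - 4 * snd v) (at 0)"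
  proof -
    have "((\<lambda>t. s t * s t) has_vector_derivative 0) (at 0)"
      using has_vector_derivative_mult[OF s' s'] 0 by simp
    from has_vector_derivative_diff[OF this has_vector_derivative_mult_right[OF p', of 4]]
    show ?thesis by (simp add: power2_eq_square)
  qed
  have o: "(0::real) \<in> {-\<epsilon><..<\<epsilon>}" using g(1) by simp
  show "snd v = 0" if "q = 0"
  proof -
    have "(s t)^2 - 4 * p t = 0" if "t \<in> {-\<epsilon><..<\<epsilon>}" for t
    proof -
      have "\<gamma> t \<in> Orb (0, q)" using g(2) that by blast
      then obtain k where k: "k \<in> Aut_sym_bidisc" "\<gamma> t = k (0, q)" by (auto simp: Orb_def)
      have "(0, q) \<in> royal_variety" using \<open>q = 0\<close> royal_iff[OF qG] by simp
      then have "\<gamma> t \<in> royal_variety" using Aut_royal[OF k(1)] k(2) by simp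
      then show ?thesis using royal_iff royal_subset unfolding s_def p_def by (metis eq_iff_diff_eq_0 subsetD)
    qed
    then have "((\<lambda>t. 0) has_vector_derivative - 4 * snd v) (at (0::real))"
      by (intro has_vector_derivative_transform_within_open[OF A' _ o]) auto
    then have "- 4 * snd v = 0"
      using vector_derivative_unique_at[OF _ has_vector_derivative_const] by blast
    then show ?thesis by simp
  qed
  show "Re (cnj q * snd v) = 0"
  proof (cases "q = 0")
    case False
    define R where "R = Re (cnj q * snd v)"
    define r where "r = norm q"
    have r: "0 < r" "r < 1" using False q by (simp_all add: r_def)
    define \<kappa> where "\<kappa> = root_distance (0, q)"
    have "\<kappa> * (1 + r^2 + 2 * r) = 4 * r"
    proof -
      have "1 + r^2 + 2 * r \<noteq> 0" using r by (metis add_pos_pos less_irrefl mult_pos_pos zero_less_numeral zero_less_one zero_less_power)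
      moreover have "\<kappa> = 4 * r / (1 + r^2 + 2 * r)" by (simp add: \<kappa>_def root_distance_def r_def norm_mult)
      ultimately show ?thesis by simp
    qed
    then have k0: "\<kappa> \<noteq> 0" using r by auto
    \<comment> \<open>the equation of the level set, squared so that only differentiable functions occur\<close>
    have eq: "(norm ((s t)^2 - 4 * p t))^2 * (1 - \<kappa> / 2)^2 = \<kappa>^2 * (1 + (norm (p t))^2 - (norm (s t))^2 / 2)^2"
      if t: "t \<in> {-\<epsilon><..<\<epsilon>}" for t
    proof -
      have "\<gamma> t \<in> Orb (0, q)" using g(2) t by blast
      then obtain k where k: "k \<in> Aut_sym_bidisc" "\<gamma> t = k (0, q)" by (auto simp: Orb_def)
      have gG: "\<gamma> t \<in> G" using Aut_sym_bidisc_mem[OF k(1) qG] k(2) by simp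
      have "root_distance (\<gamma> t) = \<kappa>" using root_distance_Aut[OF k(1) qG] k(2) by (simp add: \<kappa>_def)
      then have "norm ((s t)^2 - 4 * p t) = \<kappa> * (1 + (norm (p t))^2 - ((norm (s t))^2 - norm ((s t)^2 - 4 * p t)) / 2)"
        using root_distance_denominator_pos[OF gG] unfolding root_distance_def s_def p_def by (simp add: divide_eq_eq)
      then have "norm ((s t)^2 - 4 * p t) * (1 - \<kappa> / 2) = \<kappa> * (1 + (norm (p t))^2 - (norm (s t))^2 / 2)"
        by (simp add: algebra_simps diff_divide_distrib)
      then show ?thesis by (metis power_mult_distrib)
    qed
    have nA: "((\<lambda>t. (norm ((s t)^2 - 4 * p t))^2) has_real_derivative 32 * R) (at 0)"
      using has_real_derivative_norm_squared[OF A'] by (simp add: 0 R_def)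
    have np: "((\<lambda>t. (norm (p t))^2) has_real_derivative 2 * R) (at 0)"
      using has_real_derivative_norm_squared[OF p'] by (simp add: 0 R_def)
    have ns: "((\<lambda>t. (norm (s t))^2) has_real_derivative 0) (at 0)"
      using has_real_derivative_norm_squared[OF s'] by (simp add: 0)
    have B: "((\<lambda>t. 1 + (norm (p t))^2 - (norm (s t))^2 / 2) has_real_derivative 2 * R) (at 0)"
      using DERIV_diff[OF DERIV_add[OF DERIV_const[of 1] np] DERIV_cdivide[OF ns, of 2]] by simp
    have "((\<lambda>t. \<kappa>^2 * (1 + (norm (p t))^2 - (norm (s t))^2 / 2)^2) has_real_derivative
        \<kappa>^2 * (2 * (1 + r^2) * (2 * R))) (at 0)"
      using DERIV_cmult[OF DERIV_mult[OF B B], of "\<kappa>^2"] by (simp add: 0 power2_eq_square r_def algebra_simps)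
    moreover have "((\<lambda>t. \<kappa>^2 * (1 + (norm (p t))^2 - (norm (s t))^2 / 2)^2) has_real_derivative
        32 * R * (1 - \<kappa> / 2)^2) (at 0)"
      by (rule has_field_derivative_transform_within_open[OF DERIV_cmult_right[OF nA, of "(1 - \<kappa> / 2)^2"] open_greaterThanLessThan o])
         (rule eq)
    ultimately have D: "\<kappa>^2 * (2 * (1 + r^2) * (2 * R)) = 32 * R * (1 - \<kappa> / 2)^2"
      by (rule DERIV_unique)
    have E: "16 * r^2 * (1 - \<kappa> / 2)^2 = \<kappa>^2 * (1 + r^2)^2"
      using eq[OF o] by (simp add: 0 r_def norm_mult power_mult_distrib)
    have "2 * R * (16 * r^2 * (1 - \<kappa> / 2)^2) = r^2 * (\<kappa>^2 * (2 * (1 + r^2) * (2 * R)))"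
      unfolding D by simp
    then have "2 * R * (\<kappa>^2 * (1 + r^2)^2) = r^2 * (\<kappa>^2 * (2 * (1 + r^2) * (2 * R)))"
      unfolding E .
    then have "2 * R * \<kappa>^2 * (1 + r^2) * (1 - r^2) = 0"
      by (simp add: algebra_simps power2_eq_square)
    moreover have "0 < 1 + r^2" by (simp add: add_pos_nonneg)
    moreover have "0 < 1 - r^2" using r by (simp add: power_less_one_iff)
    ultimately show ?thesis using k0 by (simp add: R_def)
  qed simp
qed

text \<open>The curve \<open>t \<mapsto> sym_moeb (t a) (0, q)\<close> has velocity \<open>(- 2 (a + cnj a * q), 0)\<close> at \<open>t = 0\<close>, and the real-linear map
\<open>a \<mapsto> a + cnj a * q\<close> is onto because \<open>norm q < 1\<close>.\<close>

lemma tangent_axis_lower: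
  assumes q: "norm q < 1"
  shows "(c, 0) \<in> real_tangent_space (Orb (0, q)) (0, q)"
proof -
  have qG: "(0, q) \<in> G" using q by simp
  have nz: "1 - q * cnj q \<noteq> 0" using moeb_denominator_nz[of q q] q by (simp add: mult.commute)
  define d where "d = - c / 2"
  define a where "a = (d - q * cnj d) / (1 - q * cnj q)"
  have "cnj a = (cnj d - cnj q * d) / (1 - q * cnj q)" by (simp add: a_def mult.commute)
  then have "a + cnj a * q = ((d - q * cnj d) + (cnj d - cnj q * d) * q) / (1 - q * cnj q)"
    by (simp add: a_def add_divide_distrib)
  also have "(d - q * cnj d) + (cnj d - cnj q * d) * q = d * (1 - q * cnj q)" by (simp add: algebra_simps)
  finally have ad: "a + cnj a * q = d" using nz by simp
  define \<epsilon> where "\<epsilon> = 1 / (1 + norm a)"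
  have pa: "1 + norm a > 0" by (simp add: add_pos_nonneg)
  then have e: "\<epsilon> > 0" by (simp add: \<epsilon>_def)
  have small: "norm (z * a) < 1" if "norm z < \<epsilon>" for z :: complex
  proof -
    have "norm z * (1 + norm a) < 1" using that pa by (simp add: \<epsilon>_def less_divide_eq)
    then have "norm z + norm z * norm a < 1" by (simp add: distrib_left)
    then have "norm z * norm a < 1" using norm_ge_zero[of z] by linarith
    then show ?thesis by (simp add: norm_mult)
  qed
  define X where "X z = (- 2 * z * cnj a * q - 2 * z * a) / (1 + (z * cnj a)^2 * q)" for z
  define Y where "Y z = (q + (z * a)^2) / (1 + (z * cnj a)^2 * q)" for z
  have den: "1 + (z * cnj a)^2 * q \<noteq> 0" if "z \<in> ball 0 \<epsilon>" for z
  proof -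
    have "norm (z * cnj a) < 1" using small[of z] that by (simp add: norm_mult)
    then have "norm ((z * cnj a)^2) \<le> 1" by (simp add: norm_power power_le_one)
    then show ?thesis using moeb_denominator_nz[of "- cnj q" "(z * cnj a)^2"] q by (simp add: mult.commute)
  qed
  have hol: "X holomorphic_on ball 0 \<epsilon>" "Y holomorphic_on ball 0 \<epsilon>"
    unfolding X_def[abs_def] Y_def[abs_def] using den by (auto intro!: holomorphic_intros)
  have ball: "of_real ` {-\<epsilon><..<\<epsilon>} \<subseteq> ball (0::complex) \<epsilon>" by auto
  define \<gamma> where "\<gamma> t = (X (of_real t), Y (of_real t))" for t :: real
  have eq: "\<gamma> t = sym_moeb (of_real t * a) (0, q)" for t
    by (simp add: \<gamma>_def X_def Y_def sym_moeb_def mult_ac)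
  have C1: "\<gamma> C1_differentiable_on {-\<epsilon><..<\<epsilon>}"
    unfolding \<gamma>_def[abs_def]
    by (intro C1_differentiable_on_Pair C1_differentiable_on_holomorphic[OF _ open_ball ball] hol)
  have orb: "\<gamma> ` {-\<epsilon><..<\<epsilon>} \<subseteq> Orb (0, q)"
  proof (rule image_subsetI)
    fix t assume t: "t \<in> {-\<epsilon><..<\<epsilon>}"
    then have "norm (of_real t * a) < 1" by (intro small) auto
    then show "\<gamma> t \<in> Orb (0, q)" unfolding eq Orb_def using sym_moeb_Aut by blast
  qed
  have dd: "((\<lambda>z. 1 + (z * cnj a)^2 * q) has_field_derivative 0) (at 0)"
    by (auto intro!: derivative_eq_intros)
  have dX: "((\<lambda>z. - 2 * z * cnj a * q - 2 * z * a) has_field_derivative - 2 * (a + cnj a * q)) (at 0)"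
    by (auto intro!: derivative_eq_intros simp: algebra_simps)
  have dY: "((\<lambda>z. q + (z * a)^2) has_field_derivative 0) (at 0)"
    by (auto intro!: derivative_eq_intros)
  have n0: "1 + (0 * cnj a)^2 * q \<noteq> 0" by simp
  have "(X has_field_derivative c) (at (of_real 0))" "(Y has_field_derivative 0) (at (of_real 0))"
    using DERIV_divide[OF dX dd n0] DERIV_divide[OF dY dd n0]
    unfolding X_def[abs_def] Y_def[abs_def] ad by (simp_all add: d_def)
  then have "(\<gamma> has_vector_derivative (c, 0)) (at 0)"
    unfolding \<gamma>_def[abs_def]
    by (intro has_vector_derivative_Pair has_vector_derivative_real_field)
  moreover have "\<gamma> 0 = (0, q)" by (simp add: \<gamma>_def X_def Y_def)
  ultimately show ?thesis
    unfolding real_tangent_space_def using e C1 orb by blast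
qed

definition horizontal :: "(complex \<times> complex) set" where
  "horizontal = range (\<lambda>c. cscale c (1, 0))"

text \<open>The property by which \<open>sharp\<close> selects its value; the proof that it determines a unique line is needed before
anything can be said about \<open>sharp\<close>.\<close>

definition sharp_line :: "complex \<times> complex \<Rightarrow> (complex \<times> complex) set \<Rightarrow> bool" where
  "sharp_line p L \<longleftrightarrow> complex_line L \<and> L \<subseteq> real_tangent_space (Orb p) p"

lemma sharp_line_axis:
  assumes q: "norm q < 1"
  shows "sharp_line (0, q) L \<longleftrightarrow> L = horizontal"
proof
  assume "L = horizontal"
  moreover have "complex_line horizontal"
    unfolding complex_line_def horizontal_def by (intro exI[of _ "(1, 0)"]) (simp add: zero_prod_def)
  ultimately show "sharp_line (0, q) L"
    using tangent_axis_lower[OF q] by (auto simp: sharp_line_def horizontal_def)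
next
  assume L: "sharp_line (0, q) L"
  then obtain v where v: "v \<noteq> 0" "L = range (\<lambda>c. cscale c v)"
    by (auto simp: sharp_line_def complex_line_def)
  have tan: "cscale c v \<in> real_tangent_space (Orb (0, q)) (0, q)" for c
    using L v(2) by (auto simp: sharp_line_def)
  have "snd v = 0"
  proof (cases "q = 0")
    case True
    then show ?thesis using tangent_axis_upper(2)[OF q tan[of 1]] by simp
  next
    case False
    define u where "u = cnj q * snd v"
    have "Re (cnj q * snd (cscale (cnj u) v)) = 0" by (rule tangent_axis_upper(1)[OF q tan])
    moreover have "cnj q * snd (cscale (cnj u) v) = of_real ((norm u)^2)"
      unfolding complex_norm_square by (simp add: u_def mult_ac)
    ultimately have "(norm u)^2 = 0" by (metis Re_complex_of_real)
    then show ?thesis using False by (simp add: u_def)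
  qed
  moreover from this have "fst v \<noteq> 0" using v(1) by (auto simp: prod_eq_iff)
  ultimately show "L = horizontal"
    unfolding v(2) horizontal_def cscale_def
    by (auto simp: image_iff) (metis nonzero_eq_divide_eq)
qed

lemma sharp_axis: "norm q < 1 \<Longrightarrow> sharp (0, q) = horizontal"
  unfolding sharp_def by (rule the_equality) (auto simp: sharp_line_axis[unfolded sharp_line_def])

section \<open>Flat geodesics\<close>

lemma geodesic_param_Aut:
  assumes f: "f \<in> Aut_sym_bidisc" and h: "geodesic_param h"
  shows "geodesic_param (\<lambda>z. f (h z))"
proof -
  obtain g where g_inv: "inverse_automorphisms f g"
    by (rule Aut_sym_bidiscE[OF f])
  note g = inverse_automorphismsD[OF g_inv]
  obtain \<Phi> where F: "\<Phi> holomorphic2_on G" "\<Phi> ` G \<subseteq> unit_disc"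
     and inv: "\<And>z. norm z < 1 \<Longrightarrow> \<Phi> (h z) = z"
    using h unfolding geodesic_param_def by auto
  have hd: "analytic_disc h" using h geodesic_param_disc by blast
  have "(\<lambda>x. \<Phi> (g x)) holomorphic2_on G"
    by (rule holomorphic2_on_compose_map[OF g(4) F(1) g(5)])
  moreover have "(\<lambda>x. \<Phi> (g x)) ` G \<subseteq> unit_disc"
    using F(2) g(5) by (auto simp: image_subset_iff)
  moreover have "\<forall>z\<in>unit_disc. \<Phi> (g (f (h z))) = z"
    using inv g(6) analytic_disc_mem[OF hd] by simp
  ultimately show ?thesis
    using analytic_disc_image(1)[OF hd g(2,3)] unfolding geodesic_param_def analytic_disc_def by blast
qed

definition central_flat :: "(complex \<times> complex) set" where
  "central_flat = {(0, z) |z. norm z < 1}"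

lemma vertical_rotation_disc:
  assumes "norm e = 1"
  shows "analytic_disc (\<lambda>z. (0, e * z))" "curve_deriv (\<lambda>z. (0, e * z)) 0 = (0, e)"
proof -
  show "analytic_disc (\<lambda>z. (0, e * z))"
    using assms by (auto simp: analytic_disc_def holomorphic_curve_on_def norm_mult intro!: holomorphic_intros)
  have "((\<lambda>z. e * z) has_field_derivative e) (at 0)" by (auto intro!: derivative_eq_intros)
  then show "curve_deriv (\<lambda>z. (0, e * z)) 0 = (0, e)" by (simp add: curve_deriv_def DERIV_imp_deriv)
qed

text \<open>With \<open>c^2 = - b\<close>, the roots at \<open>x^2\<close> are \<open>x * moeb (- c) (\<eta> * x)\<close> and the value of this
function at \<open>- x\<close>. These discs attain the bound of
\<open>disc_velocity_bound_origin\<close> in the directions other than the vertical one.\<close>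

lemma unbalanced_disc:
  assumes b: "norm b < 1" and e: "norm \<eta> = 1"
  obtains k where "analytic_disc k" "k 0 = (0, 0)" "curve_deriv k 0 = (2 * \<eta> * of_real (1 - norm b), b)"
proof -
  define k where "k z = (2 * \<eta> * of_real (1 - norm b) * z / (1 + cnj b * \<eta>^2 * z),
      z * (b + \<eta>^2 * z) / (1 + cnj b * \<eta>^2 * z))" for z
  obtain c where c: "norm c < 1" "c^2 = - b" using square_root_in_disc[OF b] by blast
  have "b = - (c * c)" using c by (simp add: power2_eq_square)
  then have bc: "b = - (c * c)" "cnj b = - (cnj c * cnj c)" by simp_all
  have "norm b = (norm c)^2" using c(2) by (metis norm_minus_cancel norm_power)
  then have r: "complex_of_real (1 - norm b) = 1 - c * cnj c"
    by (simp only: of_real_one_minus_norm_squared)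
  have den: "1 + cnj b * \<eta>^2 * z \<noteq> 0" if "norm z < 1" for z
    using moeb_denominator_nz[of "- b" "\<eta>^2 * z"] b e that by (simp add: norm_mult norm_power mult.assoc)
  have "k z \<in> G" if z: "norm z < 1" for z
  proof -
    define x where "x = csqrt z"
    have x: "z = x * x" using power2_csqrt[of z] by (simp add: x_def power2_eq_square)
    have "(norm x)^2 < 1" using z x by (simp add: norm_mult power2_eq_square)
    then have x1: "norm x < 1" by (metis abs_square_less_1 abs_norm_cancel)
    define u where "u = \<eta> * x"
    have u: "norm u < 1" using x1 e by (simp add: u_def norm_mult)
    have nz: "1 + cnj c * u \<noteq> 0" "1 - cnj c * u \<noteq> 0"
      using moeb_denominator_nz[of "- c" u] moeb_denominator_nz[of c u] c u by auto
    have D: "1 + cnj b * \<eta>^2 * z = (1 + cnj c * u) * (1 - cnj c * u)"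
      by (simp add: bc x u_def algebra_simps power2_eq_square)
    have gen: "x * (A / P) + (- x * (B / Q)) = (x * (A * Q) - x * (B * P)) / (P * Q)"
      if "P \<noteq> 0" "Q \<noteq> 0" for A B P Q :: complex
      using that by (simp add: field_simps)
    have m: "moeb (- c) u = (u + c) / (1 + cnj c * u)" "moeb (- c) (- u) = (c - u) / (1 - cnj c * u)"
      by (simp_all add: moeb_def)
    have "x * moeb (- c) u + (- x * moeb (- c) (- u)) =
        (x * ((u + c) * (1 - cnj c * u)) - x * ((c - u) * (1 + cnj c * u))) / ((1 + cnj c * u) * (1 - cnj c * u))"
      unfolding m by (rule gen[OF nz])
    also have "x * ((u + c) * (1 - cnj c * u)) - x * ((c - u) * (1 + cnj c * u)) =
        2 * \<eta> * of_real (1 - norm b) * z"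
      unfolding r by (simp add: x u_def algebra_simps)
    finally have 1: "x * moeb (- c) u + (- x * moeb (- c) (- u)) = fst (k z)"
      unfolding k_def D by simp
    have "(x * moeb (- c) u) * (- x * moeb (- c) (- u)) =
        (- (x * x) * ((u + c) * (c - u))) / ((1 + cnj c * u) * (1 - cnj c * u))"
      unfolding m by simp
    also have "- (x * x) * ((u + c) * (c - u)) = z * (b + \<eta>^2 * z)"
      by (simp add: x u_def bc(1) algebra_simps power2_eq_square)
    finally have 2: "(x * moeb (- c) u) * (- x * moeb (- c) (- u)) = snd (k z)"
      unfolding k_def D by simp
    have c': "norm (- c) < 1" using c by simp
    have "norm (moeb (- c) u) < 1" "norm (moeb (- c) (- u)) < 1"
      using moeb_lt_1[OF c'] u by simp_all
    then have "norm (x * moeb (- c) u) < 1" "norm (- x * moeb (- c) (- u)) < 1"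
      using x1 mult_strict_mono'[of "norm x" 1] by (simp_all add: norm_mult)
    then show ?thesis unfolding mem_sym_bidisc using 1 2 by (metis prod.collapse)
  qed
  moreover have "holomorphic_curve_on k unit_disc"
    unfolding holomorphic_curve_on_def k_def fst_conv snd_conv using den by (auto intro!: holomorphic_intros)
  ultimately have k: "analytic_disc k" by (auto simp: analytic_disc_def)
  have d: "((\<lambda>z. 1 + cnj b * \<eta>^2 * z) has_field_derivative cnj b * \<eta>^2) (at 0)"
    by (auto intro!: derivative_eq_intros)
  have n1: "((\<lambda>z. 2 * \<eta> * of_real (1 - norm b) * z) has_field_derivative 2 * \<eta> * of_real (1 - norm b)) (at 0)"
    by (auto intro!: derivative_eq_intros)
  have n2: "((\<lambda>z. z * (b + \<eta>^2 * z)) has_field_derivative b) (at 0)"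
    by (auto intro!: derivative_eq_intros)
  have nz0: "1 + cnj b * \<eta>^2 * 0 \<noteq> 0" by simp
  have "curve_deriv k 0 = (2 * \<eta> * of_real (1 - norm b), b)"
    unfolding curve_deriv_def k_def fst_conv snd_conv
    using DERIV_divide[OF n1 d nz0] DERIV_divide[OF n2 d nz0] by (simp add: DERIV_imp_deriv)
  then show thesis using that[OF k] by (simp add: k_def)
qed

lemma geodesic_velocity_origin:
  assumes h: "geodesic_param h" "h 0 = (0, 0)" and ab: "curve_deriv h 0 = (a, b)"
  shows "norm a / 2 + norm b = 1"
proof -
  \<comment> \<open>If \<open>N < 1\<close> then a disc with velocity \<open>(a, b) / N\<close> would be faster than the geodesic.\<close>
  define N where "N = norm a / 2 + norm b"
  have le: "N \<le> 1"
    using disc_velocity_bound_origin[OF geodesic_param_disc[OF h(1)] h(2)] ab by (simp add: N_def)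
  have nz: "a \<noteq> 0 \<or> b \<noteq> 0"
    using geodesic_velocity_nz[OF h(1), of 0] ab by (auto simp: zero_prod_def)
  then have N0: "N > 0" by (auto simp: N_def intro: add_pos_nonneg add_nonneg_pos)
  obtain k where k: "analytic_disc k" "k 0 = (0, 0)" "curve_deriv k 0 = cscale (of_real (1 / N)) (a, b)"
  proof (cases "a = 0")
    case True
    then have "b \<noteq> 0" "N = norm b" using nz by (auto simp: N_def)
    then have "norm (b / of_real N) = 1" by (simp add: norm_divide)
    from vertical_rotation_disc[OF this] show thesis
      using that[of "\<lambda>z. (0, b / of_real N * z)"] True by simp
  next
    case False
    have nb: "norm (b / of_real N) = norm b / N" using N0 by (simp add: norm_divide)
    also have "\<dots> < 1" using False N0 by (simp add: N_def)
    finally have b1: "norm (b / of_real N) < 1" .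
    have e: "norm (sgn a) = 1" using False by (simp add: norm_sgn)
    have "1 - norm b / N = (N - norm b) / N" using N0 by (simp add: diff_divide_distrib)
    then have "1 - norm (b / of_real N) = (norm a / 2) / N" unfolding nb by (simp add: N_def)
    then have "2 * sgn a * of_real (1 - norm (b / of_real N)) = of_real (norm a) * sgn a / of_real N"
      by simp
    also have "of_real (norm a) * sgn a = a" by (simp add: sgn_eq)
    finally have E: "2 * sgn a * of_real (1 - norm (b / of_real N)) = a / of_real N" .
    obtain k where "analytic_disc k" "k 0 = (0, 0)"
      "curve_deriv k 0 = (2 * sgn a * of_real (1 - norm (b / of_real N)), b / of_real N)"
      by (rule unbalanced_disc[OF b1 e]) (rule that)
    then show thesis using that unfolding E by simp
  qed
  have "norm (of_real (1 / N) :: complex) \<le> 1"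
    by (rule geodesic_param_maximal_velocity[OF h(1) k(1)]) (use k h ab in simp_all)
  then have "1 / N \<le> 1" using N0 by (simp add: norm_divide)
  then have "1 \<le> N" using N0 by (simp add: divide_le_eq)
  then show ?thesis using le by (simp add: N_def)
qed

text \<open>Here \<open>s / 2\<close> and \<open>Phi 1\<close> are extremal, hence rotations, and this gives \<open>s^2 = 4 p\<close>.\<close>

lemma royal_velocity_royal:
  assumes h: "analytic_disc h" "h 0 = (0, 0)" and ab: "curve_deriv h 0 = (a, 0)" "norm a = 2"
    and z: "norm z < 1"
  shows "h z \<in> royal_variety"
proof -
  have s: "(\<lambda>z. fst (h z) / 2) holomorphic_on unit_disc"
    using h by (auto simp: analytic_disc_def holomorphic_curve_on_def intro!: holomorphic_intros)
  have s1: "norm (fst (h z) / 2) < 1" if "norm z < 1" for z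
    using sym_bidisc_fst_lt_2[OF analytic_disc_mem[OF h(1) that]] by (simp add: norm_divide)
  have "((\<lambda>z. fst (h z)) has_field_derivative a) (at 0)"
    using h(1) ab(1) holomorphic_derivI[of "\<lambda>z. fst (h z)" unit_disc 0]
    by (auto simp: analytic_disc_def holomorphic_curve_on_def curve_deriv_def)
  then have ds: "deriv (\<lambda>z. fst (h z) / 2) 0 = a / 2"
    by (intro DERIV_imp_deriv DERIV_cdivide)
  have sz: "fst (h z) = a * z"
    using schwarz_pick_at_0(2)[OF s s1] z h(2) ab(2) ds by (simp add: moeb_def norm_divide)
  note P = Phi_along_disc[OF h norm_one]
  have dP: "deriv (\<lambda>z. Phi 1 (h z)) 0 = - (a / 2)" using P(4) ab by simp
  have "Phi 1 (h z) = - (a / 2) * z"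
    using schwarz_pick_at_0(2)[OF P(1,2)] z h(2) ab(2) dP P(3) by (simp add: moeb_def norm_divide)
  moreover have hG: "h z \<in> G" using analytic_disc_mem[OF h(1) z] .
  ultimately have "2 * snd (h z) - fst (h z) = - (a / 2) * z * (2 - fst (h z))"
    using Phi_denominator_nz[OF norm_one hG] by (simp add: Phi_def divide_eq_eq)
  then have "4 * snd (h z) = (fst (h z))^2"
    unfolding sz by (simp add: field_simps power2_eq_square)
  then show ?thesis using royal_iff[OF hG] by simp
qed

lemma radial_sequence:
  obtains t :: "nat \<Rightarrow> complex" where "\<And>n. norm (t n) < 1" "t \<longlonglongrightarrow> 1"
proof
  have "\<bar>1 - 1 / (real n + 2)\<bar> < 1" for n by (simp add: divide_less_eq)
  then show "norm (complex_of_real (1 - 1 / (real n + 2))) < 1" for n unfolding norm_of_real .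
  have "(\<lambda>n. 1 - 1 / (real n + 2)) \<longlonglongrightarrow> 1" by real_asymp
  then show "(\<lambda>n. complex_of_real (1 - 1 / (real n + 2))) \<longlonglongrightarrow> 1"
    by (metis of_real_1 tendsto_of_real)
qed

text \<open>The discriminant \<open>s^2 - 4 p\<close> has a simple zero at \<open>0\<close> and no other, so \<open>f x\<close> and \<open>f (- x)\<close> are holomorphic roots of
\<open>h (x^2)\<close>. With \<open>f x = x * g x\<close> one finds \<open>(g 0)^2 = - b\<close> and \<open>deriv g 0 = a / 2\<close>, so the hypothesis on \<open>a\<close> and \<open>b\<close> is
equality in the Schwarz-Pick lemma: \<open>g\<close> is \<open>moeb (- c)\<close> up to a rotation. As \<open>moeb (- c)\<close> fixes \<open>sgn c\<close> and
\<open>- sgn c\<close>, the two roots have a common limit at a boundary point.\<close>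

lemma unbalanced_geodesic_royal_boundary:
  assumes h: "analytic_disc h" "h 0 = (0, 0)" and ab: "curve_deriv h 0 = (a, b)" "norm a / 2 + norm b = 1"
    and b: "b \<noteq> 0" "norm b < 1"
    and nr: "\<And>z. norm z < 1 \<Longrightarrow> z \<noteq> 0 \<Longrightarrow> h z \<notin> royal_variety"
  shows "\<exists>\<omega>. norm \<omega> = 1 \<and> (2 * \<omega>, \<omega>^2) \<in> closure (h ` unit_disc)"
proof -
  define s where "s z = fst (h z)" for z
  define p where "p z = snd (h z)" for z
  have sp: "s holomorphic_on unit_disc" "p holomorphic_on unit_disc"
    using h(1) by (auto simp: analytic_disc_def holomorphic_curve_on_def s_def[abs_def] p_def[abs_def])
  have ds: "deriv s 0 = a" and dp: "deriv p 0 = b"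
    using ab(1) by (auto simp: curve_deriv_def s_def[abs_def] p_def[abs_def])
  have hz: "h z = (s z, p z)" for z by (simp add: s_def p_def)
  have 0: "s 0 = 0" "p 0 = 0" using h(2) by (simp_all add: s_def p_def)
  have s0: "(s has_field_derivative a) (at 0)" and p0: "(p has_field_derivative b) (at 0)"
    using holomorphic_derivI[OF sp(1) open_ball, of 0] holomorphic_derivI[OF sp(2) open_ball, of 0] ds dp
    by simp_all
  have Dh: "(\<lambda>z. (s z)^2 - 4 * p z) holomorphic_on ball 0 1"
    by (intro holomorphic_intros sp)
  have dD: "deriv (\<lambda>z. (s z)^2 - 4 * p z) 0 = - 4 * b"
    using DERIV_diff[OF DERIV_mult[OF s0 s0] DERIV_cmult[OF p0, of 4]] 0
    by (simp add: power2_eq_square DERIV_imp_deriv)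
  have D0: "(s 0)^2 - 4 * p 0 = 0" by (simp add: 0)
  obtain E where E: "E holomorphic_on ball 0 1" "\<And>z. norm z < 1 \<Longrightarrow> (s z)^2 - 4 * p z = z * E z" "E 0 = - 4 * b"
    using Schwarz3[OF Dh D0] dD by metis
  have Enz: "E z \<noteq> 0" if "z \<in> ball 0 1" for z
  proof (cases "z = 0")
    case True
    then show ?thesis using E(3) b by simp
  next
    case False
    have z1: "norm z < 1" using that by simp
    have "(s z)^2 \<noteq> 4 * p z"
      using nr[OF z1 False] royal_iff[OF analytic_disc_mem[OF h(1) z1]] by (simp add: s_def p_def)
    then show ?thesis using E(2)[OF z1] by auto
  qed
  obtain e where e: "e holomorphic_on ball 0 1" "\<And>z. z \<in> ball 0 1 \<Longrightarrow> E z = (e z)^2"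
    using contractible_imp_holomorphic_sqrt[OF E(1) convex_imp_contractible[OF convex_ball] Enz] by metis
  \<comment> \<open>the quadratic formula; its square root \<open>x * e (x^2)\<close> is odd in \<open>x\<close>, so \<open>f (- x)\<close> is the other root\<close>
  define f where "f x = (s (x^2) + x * e (x^2)) / 2" for x
  have sq: "norm (x^2) < 1" if "norm x < 1" for x :: complex
    using that by (simp add: norm_power power_less_one_iff)
  have comp: "(\<lambda>x. u (x^2)) holomorphic_on ball 0 1" if "u holomorphic_on ball 0 1" for u :: "complex \<Rightarrow> complex"
  proof -
    have "(\<lambda>x::complex. x^2) holomorphic_on ball 0 1" by (intro holomorphic_intros)
    from holomorphic_on_compose_gen[OF this that] show ?thesis
      using sq by (auto simp: o_def image_subset_iff)
  qed
  have fh: "f holomorphic_on ball 0 1"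
    unfolding f_def[abs_def] by (intro holomorphic_intros comp sp e) simp_all
  have fsum: "f x + f (- x) = s (x^2)" for x by (simp add: f_def field_simps)
  have fprod: "f x * f (- x) = p (x^2)" if x: "norm x < 1" for x
  proof -
    have "f x * f (- x) = ((s (x^2))^2 - x^2 * (e (x^2))^2) / 4"
      by (simp add: f_def field_simps power2_eq_square)
    also have "x^2 * (e (x^2))^2 = (s (x^2))^2 - 4 * p (x^2)"
      using E(2)[OF sq[OF x]] e(2)[of "x^2"] sq[OF x] by simp
    finally show ?thesis by simp
  qed
  have hf: "h (x^2) = (f x + f (- x), f x * f (- x))" if "norm x < 1" for x
    unfolding hz fsum fprod[OF that] ..
  have f1: "norm (f x) < 1" if x: "norm x < 1" for x
    using sym_bidisc_root_lt_1 hf[OF x] analytic_disc_mem[OF h(1) sq[OF x]] by metis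
  have f0: "f 0 = 0" by (simp add: f_def 0)
  obtain g where g: "g holomorphic_on ball 0 1" "\<And>x. norm x < 1 \<Longrightarrow> f x = x * g x" "deriv f 0 = g 0"
    by (rule Schwarz3[OF fh f0]) (rule that)
  have "(f has_field_derivative e 0 / 2) (at 0)"
  proof -
    have sqd: "((\<lambda>x. x^2) has_field_derivative 0) (at (0::complex))" by (auto intro!: derivative_eq_intros)
    have "(s has_field_derivative a) (at (0^2))" using s0 by simp
    from DERIV_chain2[OF this sqd] have 1: "((\<lambda>x. s (x^2)) has_field_derivative 0) (at 0)" by simp
    have "(e has_field_derivative deriv e 0) (at (0^2))"
      using holomorphic_derivI[OF e(1) open_ball, of 0] by simp
    from DERIV_chain2[OF this sqd] have 2: "((\<lambda>x. e (x^2)) has_field_derivative 0) (at 0)" by simp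
    show ?thesis
      unfolding f_def[abs_def]
      using DERIV_cdivide[OF DERIV_add[OF 1 DERIV_mult[OF DERIV_ident 2]], of 2] by simp
  qed
  then have "g 0 = e 0 / 2" using g(3) by (simp add: DERIV_imp_deriv)
  then have "(g 0)^2 = (e 0)^2 / 4" by (simp only: power_divide) simp
  then have g0: "(g 0)^2 = - b" using E(3) e(2)[of 0] by simp
  define c where "c = g 0"
  have ncb: "(norm c)^2 = norm b" using g0 unfolding c_def by (metis norm_minus_cancel norm_power)
  have c1: "norm c < 1" using b(2) ncb by (metis abs_square_less_1 abs_norm_cancel)
  have c0: "c \<noteq> 0" using g0 b by (auto simp: c_def)
  have g1: "norm (g x) < 1" if x: "norm x < 1" for x
  proof (cases "x = 0")
    case True then show ?thesis using c1 by (simp add: c_def)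
  next
    case False
    have "norm (f x) \<le> norm x" by (rule Schwarz_Lemma(1)[OF fh f0 f1 x])
    then have le: "norm (g x) \<le> 1" using g(2)[OF x] False by (simp add: norm_mult)
    have "norm (g x) \<noteq> 1"
    proof
      assume "norm (g x) = 1"
      then have "norm (f x) = norm x" using g(2)[OF x] by (simp add: norm_mult)
      then obtain \<alpha> where \<alpha>: "\<And>z. norm z < 1 \<Longrightarrow> f z = \<alpha> * z" "norm \<alpha> = 1"
        using Schwarz_Lemma(3)[OF fh f0 f1 x] x False by blast
      have "((\<lambda>z. \<alpha> * z) has_field_derivative \<alpha>) (at 0)" by (auto intro!: derivative_eq_intros)
      then have "(f has_field_derivative \<alpha>) (at 0)"
        by (rule has_field_derivative_transform_within_open[of _ _ _ "unit_disc"]) (use \<alpha> in auto)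
      then show False using g(3) c1 \<alpha>(2) by (simp add: DERIV_imp_deriv c_def)
    qed
    then show ?thesis using le by simp
  qed
  \<comment> \<open>The odd part of \<open>g\<close> is determined by \<open>s\<close>, since \<open>x * (g x - g (- x)) = s (x^2)\<close>.\<close>
  have "deriv g 0 = a / 2"
  proof -
    obtain S where S: "S holomorphic_on ball 0 1" "\<And>z. norm z < 1 \<Longrightarrow> s z = z * S z" "deriv s 0 = S 0"
      by (rule Schwarz3[OF sp(1) 0(1)]) (rule that)
    have eq: "g x - g (- x) = x * S (x^2)" if x: "x \<in> ball 0 1" for x
    proof (cases "x = 0")
      case False
      have "x * (g x - g (- x)) = f x + f (- x)" using g(2)[of x] g(2)[of "- x"] x by (simp add: algebra_simps)
      also have "\<dots> = x * (x * S (x^2))"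
        using S(2)[OF sq] x by (simp add: fsum power2_eq_square)
      finally show ?thesis using False by simp
    qed simp
    have gd: "(g has_field_derivative deriv g 0) (at 0)" "(g has_field_derivative deriv g 0) (at (- 0))"
      using holomorphic_derivI[OF g(1) open_ball, of 0] by simp_all
    have "((\<lambda>x. - x) has_field_derivative - 1) (at (0::complex))" by (auto intro!: derivative_eq_intros)
    from DERIV_diff[OF gd(1) DERIV_chain2[OF gd(2) this]]
    have 1: "((\<lambda>x. g x - g (- x)) has_field_derivative 2 * deriv g 0) (at 0)" by simp
    have "((\<lambda>x. S (x^2)) has_field_derivative deriv (\<lambda>x. S (x^2)) 0) (at 0)"
      by (rule holomorphic_derivI[OF comp[OF S(1)] open_ball]) simp
    from DERIV_mult[OF DERIV_ident this]
    have 2: "((\<lambda>x. x * S (x^2)) has_field_derivative a) (at 0)" using S(3) ds by simp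
    have "((\<lambda>x. g x - g (- x)) has_field_derivative a) (at 0)"
      by (rule has_field_derivative_transform_within_open[OF 2 open_ball[of 0 1]]) (auto simp: eq)
    then have "2 * deriv g 0 = a" using 1 DERIV_unique by blast
    then show ?thesis by (simp add: eq_divide_eq mult.commute)
  qed
  then have "norm (deriv g 0) = norm a / 2" by (simp only: norm_divide norm_numeral)
  then have "norm (deriv g 0) = 1 - (norm (g 0))^2"
    using ab(2) ncb unfolding c_def by linarith
  then obtain \<eta> where eta: "norm \<eta> = 1" "\<And>x. norm x < 1 \<Longrightarrow> g x = moeb (- c) (\<eta> * x)"
    using schwarz_pick_at_0(2)[OF g(1) g1] unfolding c_def by metis
  define u where "u = sgn c"
  have u: "norm u = 1" "c = of_real (norm c) * u" 
    unfolding u_def using c0 by (simp only: norm_sgn if_False, simp add: sgn_eq)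
  have uu: "cnj u * u = 1" using u(1) of_real_norm_squared[of u] by (simp add: mult.commute)
  then have cu: "cnj c * u = of_real (norm c)"
    by (subst u(2)) (simp add: mult.assoc)
  have pos: "1 + norm c > 0" "1 - norm c > 0" using c1 by (simp_all add: add_pos_nonneg)
  then have nz: "1 + cnj c * u \<noteq> 0" "1 - cnj c * u \<noteq> 0"
    unfolding cu by (metis less_irrefl of_real_1 of_real_add of_real_eq_0_iff, metis less_irrefl of_real_1 of_real_diff of_real_eq_0_iff)
  have mu: "moeb (- c) u = u" "moeb (- c) (- u) = - u"
  proof -
    have "u + c = u * (1 + cnj c * u)" unfolding cu using u(2) by (simp add: algebra_simps)
    then show "moeb (- c) u = u" using nz by (simp add: moeb_def)
    have "c - u = - u * (1 - cnj c * u)" unfolding cu using u(2) by (simp add: algebra_simps)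
    then show "moeb (- c) (- u) = - u" using nz by (simp add: moeb_def)
  qed
  define x0 where "x0 = u / \<eta>"
  have x0: "norm x0 = 1" "\<eta> * x0 = u" using u eta by (auto simp: x0_def norm_divide)
  obtain t :: "nat \<Rightarrow> complex" where t: "\<And>n. norm (t n) < 1" and tl: "t \<longlonglongrightarrow> 1"
    by (rule radial_sequence) (rule that)
  have t1: "norm (t n * x0) < 1" for n unfolding norm_mult x0(1) using t by simp
  define \<omega> where "\<omega> = x0 * u"
  have fl: "(\<lambda>n. f (t n * x0)) \<longlonglongrightarrow> \<omega>"
  proof -
    have "f (t n * x0) = t n * x0 * ((t n * u + c) / (1 + cnj c * (t n * u)))" for n
    proof -
      have e: "\<eta> * (t n * x0) = t n * u" unfolding x0(2)[symmetric] by (rule mult.left_commute)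
      show ?thesis unfolding g(2)[OF t1] eta(2)[OF t1] e moeb_def by simp
    qed
    moreover have "(\<lambda>n. t n * x0 * ((t n * u + c) / (1 + cnj c * (t n * u)))) \<longlonglongrightarrow>
        1 * x0 * ((1 * u + c) / (1 + cnj c * (1 * u)))"
      by (intro tendsto_intros tl) (use nz in simp)
    moreover have "1 * x0 * ((1 * u + c) / (1 + cnj c * (1 * u))) = \<omega>"
      using mu(1) by (simp add: moeb_def \<omega>_def)
    ultimately show ?thesis by simp
  qed
  have fl': "(\<lambda>n. f (- (t n * x0))) \<longlonglongrightarrow> \<omega>"
  proof -
    have "f (- (t n * x0)) = - (t n * x0 * ((c - t n * u) / (1 - cnj c * (t n * u))))" for n
    proof -
      have e: "\<eta> * (- (t n * x0)) = - (t n * u)"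
        unfolding x0(2)[symmetric] by (simp add: mult.left_commute)
      have lt: "norm (- (t n * x0)) < 1" using t1[of n] by simp
      show ?thesis unfolding g(2)[OF lt] eta(2)[OF lt] e moeb_def by simp
    qed
    moreover have "(\<lambda>n. - (t n * x0 * ((c - t n * u) / (1 - cnj c * (t n * u))))) \<longlonglongrightarrow>
        - (1 * x0 * ((c - 1 * u) / (1 - cnj c * (1 * u))))"
      by (intro tendsto_intros tl) (use nz in simp)
    moreover have "- (1 * x0 * ((c - 1 * u) / (1 - cnj c * (1 * u)))) = \<omega>"
      using mu(2) by (simp add: moeb_def \<omega>_def)
    ultimately show ?thesis by simp
  qed
  have "(\<lambda>n. h ((t n * x0)^2)) \<longlonglongrightarrow> (\<omega> + \<omega>, \<omega> * \<omega>)"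
    unfolding hf[OF t1] by (intro tendsto_intros fl fl')
  moreover have "h ((t n * x0)^2) \<in> h ` unit_disc" for n using sq[OF t1] by simp
  ultimately have "(\<omega> + \<omega>, \<omega> * \<omega>) \<in> closure (h ` unit_disc)"
    unfolding closure_sequential by (intro exI[of _ "\<lambda>n. h ((t n * x0)^2)"]) blast
  moreover have "norm \<omega> = 1" using x0 u by (simp add: \<omega>_def norm_mult)
  ultimately show ?thesis by (intro exI[of _ \<omega>]) (simp add: power2_eq_square)
qed

text \<open>The velocity \<open>(a, b)\<close> satisfies \<open>norm a / 2 + norm b = 1\<close>. The case \<open>b = 0\<close> is the royal variety, the case
\<open>0 < norm b < 1\<close> is excluded by the boundary behaviour, and \<open>norm b = 1\<close> is the central flat geodesic.\<close>

lemma centered_flat_geodesic: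
  assumes h: "geodesic_param h" "h 0 = (0, 0)"
    and nr: "\<And>z. norm z < 1 \<Longrightarrow> z \<noteq> 0 \<Longrightarrow> h z \<notin> royal_variety"
    and nb: "\<And>\<omega>. norm \<omega> = 1 \<Longrightarrow> (2 * \<omega>, \<omega>^2) \<notin> closure (h ` unit_disc)"
  shows "h ` unit_disc = central_flat"
proof -
  obtain a b where ab: "curve_deriv h 0 = (a, b)" by fastforce
  have hd: "analytic_disc h" using h geodesic_param_disc by blast
  have n: "norm a / 2 + norm b = 1" by (rule geodesic_velocity_origin[OF h ab])
  have "b \<noteq> 0"
  proof
    assume "b = 0"
    then have "h (1 / 2) \<in> royal_variety"
      using royal_velocity_royal[OF hd h(2), of a "1 / 2"] ab n by simp
    then show False using nr[of "1 / 2"] by simp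
  qed
  then have "\<not> norm b < 1" using unbalanced_geodesic_royal_boundary[OF hd h(2) ab n _ _ nr] nb by blast
  then have b1: "norm b = 1" using n norm_ge_zero[of a] by linarith
  have "h z = (0, b * z)" if "norm z < 1" for z by (rule vertical_disc_rigid[OF hd h(2) ab b1 that])
  then have "h ` unit_disc = (\<lambda>z. (0, z)) ` ((\<lambda>z. b * z) ` unit_disc)"
    by (auto simp: image_iff)
  also have "\<dots> = central_flat" unfolding rotation_disc_image[OF b1] by (auto simp: central_flat_def)
  finally show ?thesis .
qed

text \<open>A left inverse shows that a geodesic is relatively closed in \<open>G\<close>, so the common point \<open>l\<close> of the closures lies on \<open>F\<close>.
Moving \<open>l\<close> to the origin gives a geodesic as in \<open>centered_flat_geodesic\<close>: a second royal point in its closure, inside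
or on the boundary, would be mapped back to a second common point of the closures of \<open>F\<close> and of the royal variety.\<close>

lemma flat_geodesic_normal_form:
  assumes "flat_geodesic F"
  obtains a where "norm a < 1" "sym_moeb a ` F = central_flat"
proof -
  obtain h l where h: "geodesic_param h" "F = h ` unit_disc" and l: "l \<in> royal_variety"
    and cl: "closure F \<inter> closure royal_variety = {l}"
    using assms by (auto simp: flat_geodesic_def geodesic_def)
  have hd: "analytic_disc h" using h geodesic_param_disc by blast
  have lG: "l \<in> G" using l royal_subset by blast
  obtain \<Phi> where F: "\<Phi> holomorphic2_on G" "\<Phi> ` G \<subseteq> unit_disc"
     and inv: "\<And>z. norm z < 1 \<Longrightarrow> \<Phi> (h z) = z"
    using h unfolding geodesic_param_def by auto
  have cont: "isCont \<Phi> x" if "x \<in> G" for x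
    by (rule holomorphic2_onD[OF F(1) that]) (rule has_derivative_continuous)
  have conth: "isCont h z" if "norm z < 1" for z
  proof (rule has_derivative_continuous[OF holomorphic_curve_has_derivative])
    show "holomorphic_curve_on h unit_disc" using hd by (simp add: analytic_disc_def)
  qed (use that in auto)
  have "l \<in> closure F" using cl by blast
  obtain x where x: "\<And>n. x n \<in> F" "x \<longlonglongrightarrow> l"
    using \<open>l \<in> closure F\<close> unfolding closure_sequential by blast
  \<comment> \<open>applying \<open>h \<circ> \<Phi>\<close> to a sequence in \<open>F\<close> with limit \<open>l\<close> shows that \<open>l\<close> is on \<open>F\<close>\<close>
  define z0 where "z0 = \<Phi> l"
  have z0: "norm z0 < 1" using F(2) lG by (auto simp: z0_def)
  have "(\<lambda>n. \<Phi> (x n)) \<longlonglongrightarrow> z0" unfolding z0_def by (rule isCont_tendsto_compose[OF cont[OF lG] x(2)])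
  then have "(\<lambda>n. h (\<Phi> (x n))) \<longlonglongrightarrow> h z0" by (rule isCont_tendsto_compose[OF conth[OF z0]])
  moreover have "h (\<Phi> (x n)) = x n" for n using x(1)[of n] h(2) inv by auto
  ultimately have hz0: "h z0 = l" using x(2) LIMSEQ_unique by simp
  obtain a q where a: "norm a < 1" "norm q < 1" "sym_moeb a l = (0, q)"
    using sym_moeb_to_zero[OF lG] by blast
  have "(0, q) \<in> royal_variety" using sym_moeb_royal[OF a(1) l] a(3) by simp
  then have q: "q = 0" using royal_iff[of "(0, q)"] a(2) by simp
  have a': "norm (- a) < 1" using a by simp
  define h1 where "h1 z = h (moeb (- z0) z)" for z
  have h1: "geodesic_param h1" "h1 ` unit_disc = F" "h1 0 = l"
    using geodesic_param_reparam(1,2)[OF h(1) z0] h(2) hz0 by (simp_all add: h1_def[abs_def] moeb_def)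
  have h1G: "h1 z \<in> G" if "norm z < 1" for z
    using analytic_disc_mem[OF geodesic_param_disc[OF h1(1)] that] .
  define k where "k z = sym_moeb a (h1 z)" for z
  have k: "geodesic_param k" "k ` unit_disc = sym_moeb a ` F" "k 0 = (0, 0)"
    using geodesic_param_Aut[OF sym_moeb_Aut[OF a(1)] h1(1)] h1(2,3) a(3) q
    by (auto simp: k_def[abs_def])
  have "k ` unit_disc = central_flat"
  proof (rule centered_flat_geodesic[OF k(1,3)])
    fix z :: complex assume z: "norm z < 1" "z \<noteq> 0"
    show "k z \<notin> royal_variety"
    proof
      assume "k z \<in> royal_variety"
      then have "sym_moeb (- a) (k z) \<in> royal_variety" by (rule sym_moeb_royal[OF a'])
      then have "h1 z \<in> royal_variety" using sym_moeb_inverse(1)[OF a(1) h1G[OF z(1)]] by (simp add: k_def)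
      moreover have "h1 z \<in> F" using h1(2) z(1) by auto
      ultimately have "h1 z = l" using cl closure_subset by blast
      then have "h1 z = h1 0" using h1(3) by simp
      moreover obtain \<Psi> where "\<And>z. norm z < 1 \<Longrightarrow> \<Psi> (h1 z) = z"
        using h1(1) unfolding geodesic_param_def by (metis mem_ball_0)
      ultimately show False using z by (metis norm_zero zero_less_one)
    qed
  next
    fix \<omega> :: complex assume w: "norm \<omega> = 1"
    show "(2 * \<omega>, \<omega>^2) \<notin> closure (k ` unit_disc)"
    proof
      assume "(2 * \<omega>, \<omega>^2) \<in> closure (k ` unit_disc)"
      then obtain y where y: "\<And>n. y n \<in> sym_moeb a ` F" "y \<longlonglongrightarrow> (2 * \<omega>, \<omega>^2)"
        unfolding closure_sequential k(2) by blast
      define \<omega>' where "\<omega>' = moeb (- a) \<omega>"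
      have w': "norm \<omega>' = 1" unfolding \<omega>'_def by (rule moeb_norm_eq_1[OF a' w])
      have dbl: "(2 * x, x^2) = (x + x, x * x)" for x :: complex by (simp add: power2_eq_square)
      have "1 - cnj (- a) * \<omega> \<noteq> 0" using moeb_denominator_nz[OF a', of \<omega>] w by simp
      then have nz: "1 - cnj (- a) * fst (2 * \<omega>, \<omega>^2) + (cnj (- a))^2 * snd (2 * \<omega>, \<omega>^2) \<noteq> 0"
        unfolding dbl fst_conv snd_conv sym_moeb_denominator by (simp only: mult_eq_0_iff) blast
      have "(\<lambda>n. sym_moeb (- a) (y n)) \<longlonglongrightarrow> sym_moeb (- a) (2 * \<omega>, \<omega>^2)"
        unfolding sym_moeb_def by (intro tendsto_intros y(2) nz)
      moreover have "sym_moeb (- a) (2 * \<omega>, \<omega>^2) = (2 * \<omega>', \<omega>'^2)"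
        unfolding dbl \<omega>'_def by (rule sym_moeb_sum_prod[OF a']) (simp_all add: w)
      moreover have "sym_moeb (- a) (y n) \<in> F" for n
      proof -
        obtain u where u: "u \<in> F" "y n = sym_moeb a u" using y(1) by blast
        have "u \<in> G" using u(1) h1(2) h1G by auto
        then show ?thesis using u a(1) by simp
      qed
      ultimately have 1: "(2 * \<omega>', \<omega>'^2) \<in> closure F" unfolding closure_sequential by metis
      obtain t :: "nat \<Rightarrow> complex" where t: "\<And>n. norm (t n) < 1" and tl: "t \<longlonglongrightarrow> 1"
        by (rule radial_sequence) (rule that)
      have "(\<lambda>n. (2 * (t n * \<omega>'), (t n * \<omega>')^2)) \<longlonglongrightarrow> (2 * (1 * \<omega>'), (1 * \<omega>')^2)"
        by (intro tendsto_intros tl)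
      moreover have "(2 * (t n * \<omega>'), (t n * \<omega>')^2) \<in> royal_variety" for n
      proof -
        have "norm (t n * \<omega>') < 1" unfolding norm_mult w' using t by simp
        then show ?thesis unfolding royal_variety_def by auto
      qed
      ultimately have "(2 * \<omega>', \<omega>'^2) \<in> closure royal_variety"
        unfolding closure_sequential mult_1
        by (intro exI[of _ "\<lambda>n. (2 * (t n * \<omega>'), (t n * \<omega>')^2)"]) blast
      then have "(2 * \<omega>', \<omega>'^2) = l" using 1 cl by blast
      then show False using l w' by (auto simp: royal_variety_def)
    qed
  qed
  then show thesis using that[OF a(1)] k(2) by simp
qed

section \<open>Transport of orthogonality and the foliation\<close>

lemma sym_moeb_derivative:
  assumes a: "norm a < 1" and p: "p \<in> G"
  obtains T T' where "inverse_derivatives (sym_moeb a) (sym_moeb (- a)) p T T'"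
proof (rule Aut_sym_bidisc_derivative[OF _ p])
  show "inverse_automorphisms (sym_moeb a) (sym_moeb (- a))"
    unfolding inverse_automorphisms_def
    using a sym_moeb_in_sym_bidisc[of "- a"] by (auto simp: sym_moeb_holomorphic sym_moeb_in_sym_bidisc)
qed

lemma sharp_line_sym_moeb:
  assumes a: "norm a < 1" and p: "p \<in> G" and L: "sharp_line p L"
    and T: "(sym_moeb a has_derivative T) (at p)" "\<And>c v. T (cscale c v) = cscale c (T v)"
      "linear T" "\<And>v. T' (T v) = v"
  shows "sharp_line (sym_moeb a p) (T ` L)"
proof -
  obtain v where v: "v \<noteq> 0" "L = range (\<lambda>c. cscale c v)"
    using L by (auto simp: sharp_line_def complex_line_def)
  have "T v \<noteq> 0" using v(1) T(3,4) by (metis linear_0)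
  moreover have "T ` L = range (\<lambda>c. cscale c (T v))" unfolding v(2) image_image T(2) ..
  ultimately have "complex_line (T ` L)" unfolding complex_line_def by blast
  moreover have "T ` L \<subseteq> real_tangent_space (Orb (sym_moeb a p)) (sym_moeb a p)"
    using L tangent_sym_moeb[OF a p T(1)] by (auto simp: sharp_line_def)
  ultimately show ?thesis by (simp add: sharp_line_def)
qed

text \<open>Any point can be moved to the central flat geodesic, where the line is known.\<close>

lemma sharp_line_unique:
  assumes p: "p \<in> G"
  shows "\<exists>!L. sharp_line p L"
proof -
  obtain a q where a: "norm a < 1" "norm q < 1" "sym_moeb a p = (0, q)"
    using sym_moeb_to_zero[OF p] by blast
  have a': "norm (- a) < 1" using a by simp
  have ap: "sym_moeb a p \<in> G" using sym_moeb_in_sym_bidisc[OF a(1) p] .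
  obtain T T' where inv: "inverse_derivatives (sym_moeb a) (sym_moeb (- a)) p T T'"
    by (rule sym_moeb_derivative[OF a(1) p])
  note T = inverse_derivativesD[OF inv]
  have "sharp_line (sym_moeb a p) horizontal" unfolding a(3) using sharp_line_axis[OF a(2)] by simp
  from sharp_line_sym_moeb[OF a' ap this T(2,6,4,8)]
  have "sharp_line p (T' ` horizontal)" using sym_moeb_inverse(1)[OF a(1) p] by simp
  moreover have "L = T' ` horizontal" if "sharp_line p L" for L
  proof -
    have "T ` L = horizontal"
      using sharp_line_sym_moeb[OF a(1) p that T(1,5,3,7)] sharp_line_axis[OF a(2)] a(3) by simp
    moreover have "T' ` T ` L = L" unfolding image_image T(7) by simp
    ultimately show ?thesis by simp
  qed
  ultimately show ?thesis by blast
qed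

lemma sharp_sym_moeb:
  assumes a: "norm a < 1" and p: "p \<in> G"
    and T: "(sym_moeb a has_derivative T) (at p)" "\<And>c v. T (cscale c v) = cscale c (T v)"
      "linear T" "\<And>v. T' (T v) = v"
  shows "sharp (sym_moeb a p) = T ` sharp p"
proof -
  have eq: "sharp x = (THE L. sharp_line x L)" for x by (simp add: sharp_def sharp_line_def)
  have "sharp_line p (sharp p)" unfolding eq by (rule theI'[OF sharp_line_unique[OF p]])
  from sharp_line_sym_moeb[OF a p this T]
  show ?thesis
    unfolding eq[of "sym_moeb a p"] using sharp_line_unique[OF sym_moeb_in_sym_bidisc[OF a p]]
    by (rule the1_equality[rotated])
qed

lemma geodesic_subset: "geodesic D \<Longrightarrow> D \<subseteq> G"
  by (auto simp: geodesic_def geodesic_param_def)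

lemma geodesic_sym_moeb: "norm a < 1 \<Longrightarrow> geodesic D \<Longrightarrow> geodesic (sym_moeb a ` D)"
  unfolding geodesic_def
  using geodesic_param_Aut[OF sym_moeb_Aut[of a]] by (metis image_image)

lemma orthogonal_sym_moeb:
  assumes a: "norm a < 1" and D: "geodesic D" and o: "orthogonal_to D F"
  shows "orthogonal_to (sym_moeb a ` D) (sym_moeb a ` F)"
proof -
  obtain p where p: "p \<in> D" "p \<in> F" "geodesic_tangent D p = sharp p"
    using o by (auto simp: orthogonal_to_def)
  have pG: "p \<in> G" using p(1) geodesic_subset[OF D] by blast
  obtain k z where k: "geodesic_param k" "D = k ` unit_disc" "norm z < 1" "k z = p"
    using D p(1) by (auto simp: geodesic_def)
  obtain T T' where inv: "inverse_derivatives (sym_moeb a) (sym_moeb (- a)) p T T'"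
    by (rule sym_moeb_derivative[OF a pG])
  note T = inverse_derivativesD[OF inv]
  have kc: "holomorphic_curve_on k unit_disc" "k ` unit_disc \<subseteq> G"
    using k(1) by (auto simp: geodesic_param_def)
  have cd: "curve_deriv (\<lambda>z. sym_moeb a (k z)) z = T (curve_deriv k z)"
    by (rule holomorphic_curve_compose_map(2)[OF kc(1) open_ball sym_moeb_holomorphic[OF a] kc(2)])
       (use k T(1) in auto)
  have "geodesic_tangent (sym_moeb a ` D) (sym_moeb a p) =
      range (\<lambda>c. cscale c (T (curve_deriv k z)))"
    using geodesic_tangent_eq[OF geodesic_param_Aut[OF sym_moeb_Aut[OF a] k(1)] k(3)] k(2,4) cd
    by (simp add: image_image)
  also have "\<dots> = T ` range (\<lambda>c. cscale c (curve_deriv k z))" unfolding image_image T(5) ..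
  also have "range (\<lambda>c. cscale c (curve_deriv k z)) = sharp p"
    using geodesic_tangent_eq[OF k(1,3)] k(2,4) p(3) by simp
  also have "T ` sharp p = sharp (sym_moeb a p)"
    by (rule sharp_sym_moeb[OF a pG T(1,5,3,7), symmetric])
  finally show ?thesis using p(1,2) unfolding orthogonal_to_def by blast
qed

lemma orthogonal_central_flat_iff:
  "geodesic D \<and> orthogonal_to D central_flat \<longleftrightarrow> (\<exists>q. norm q < 1 \<and> D = leaf q ` unit_disc)"
proof
  assume D: "geodesic D \<and> orthogonal_to D central_flat"
  then obtain q where q: "norm q < 1" "(0, q) \<in> D" "geodesic_tangent D (0, q) = sharp (0, q)"
    by (auto simp: orthogonal_to_def central_flat_def)
  then have "D = leaf q ` unit_disc"
    using D horizontal_geodesic_unique[of D q] sharp_axis[OF q(1)] by (simp add: horizontal_def)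
  then show "\<exists>q. norm q < 1 \<and> D = leaf q ` unit_disc" using q(1) by blast
next
  assume "\<exists>q. norm q < 1 \<and> D = leaf q ` unit_disc"
  then obtain q where q: "norm q < 1" "D = leaf q ` unit_disc" by blast
  have "(0, q) \<in> leaf q ` unit_disc" using leaf_analytic_disc(2)[OF q(1)] by (intro image_eqI[of _ _ 0]) auto
  moreover have "(0, q) \<in> central_flat" using q(1) by (simp add: central_flat_def)
  ultimately have "orthogonal_to D central_flat"
    unfolding orthogonal_to_def q(2) using leaf_tangent[OF q(1)] sharp_axis[OF q(1)]
    by (intro bexI[of _ "(0, q)"]) (simp_all add: horizontal_def)
  then show "geodesic D \<and> orthogonal_to D central_flat"
    using leaf_geodesic_param[OF q(1)] q(2) by (auto simp: geodesic_def)
qed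

theorem theorem1p4:
  fixes F :: "(complex \<times> complex) set"
  assumes "flat_geodesic F"
  shows "\<forall>p\<in>sym_bidisc. \<exists>!D. geodesic D \<and> orthogonal_to D F \<and> p \<in> D"
proof
  fix p assume p: "p \<in> G"
  obtain a where a: "norm a < 1" "sym_moeb a ` F = central_flat"
    by (rule flat_geodesic_normal_form[OF assms])
  have a': "norm (- a) < 1" using a by simp
  have FG: "F \<subseteq> G" using assms geodesic_subset by (auto simp: flat_geodesic_def)
  have inv: "sym_moeb (- a) ` sym_moeb a ` X = X" if "X \<subseteq> G" for X
    using that sym_moeb_inverse(1)[OF a(1)] by (force simp: image_image)
  have inv': "sym_moeb a ` sym_moeb (- a) ` X = X" if "X \<subseteq> G" for X
    using that sym_moeb_inverse(2)[OF a(1)] by (force simp: image_image)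
  obtain q where q: "norm q < 1" "sym_moeb a p \<in> leaf q ` unit_disc"
    using leaf_covers[OF sym_moeb_in_sym_bidisc[OF a(1) p]] by blast
  have E: "geodesic (leaf q ` unit_disc)" "orthogonal_to (leaf q ` unit_disc) central_flat"
    using orthogonal_central_flat_iff q(1) by blast+
  define D where "D = sym_moeb (- a) ` leaf q ` unit_disc"
  show "\<exists>!D. geodesic D \<and> orthogonal_to D F \<and> p \<in> D"
  proof (rule ex1I[of _ D])
    have "geodesic D" unfolding D_def by (rule geodesic_sym_moeb[OF a' E(1)])
    moreover have "orthogonal_to D F"
      using orthogonal_sym_moeb[OF a' E] inv[OF FG] a(2) by (simp add: D_def)
    moreover have "sym_moeb (- a) (sym_moeb a p) \<in> D" unfolding D_def using q(2) by blast
    ultimately show "geodesic D \<and> orthogonal_to D F \<and> p \<in> D" using sym_moeb_inverse(1)[OF a(1) p] by simp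
  next
    fix D' assume D': "geodesic D' \<and> orthogonal_to D' F \<and> p \<in> D'"
    have "geodesic (sym_moeb a ` D')" "orthogonal_to (sym_moeb a ` D') central_flat"
      using D' geodesic_sym_moeb[OF a(1)] orthogonal_sym_moeb[OF a(1), of D' F] a(2) by simp_all
    then obtain q' where q': "norm q' < 1" "sym_moeb a ` D' = leaf q' ` unit_disc"
      using orthogonal_central_flat_iff by blast
    have "sym_moeb a p \<in> leaf q' ` unit_disc" using D' q'(2) by blast
    then have "q' = q" using leaf_disjoint[OF q'(1) q(1) _ q(2)] by blast
    then show "D' = D" using q'(2) inv[OF geodesic_subset, of D'] D' by (simp add: D_def)
  qed
qed

end
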